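(* Fix a real number $q>2$ and $\lambda\in(\lambda_s,\lambda_S)$, and let $p=\lambda/n$. Consider the (discrete-time, heat-bath) Glauber dynamics for the mean-field FK model $\pi_{n,\lambda,q}$ on $n$ vertices. There exists $c=c(\lambda,q)>0$ such that for all sufficiently large $n$, its mixing time satisfies $t_{\textsc{mix}}\geq \exp(cn)$. The same lower bound (with possibly different $c>0$) holds for the Chayes--Machta dynamics for $\pi_{n,\lambda,q}$.
   Context: The mean-field FK (random cluster) model on $n$ vertices with parameters $(p,q)$, $p=\lambda/n$, $q>0$, is the probability measure $\pi_{n,\lambda,q}$ on $\omega\in\{0,1\}^{\binom{n}{2}}$ (subgraphs of the complete graph $K_n$) given by $\pi_{n,\lambda,q}(\omega)\propto p^{|E(\omega)|}(1-p)^{\binom n2-|E(\omega)|}q^{k(\omega)}$, where $E(\omega)$ is the set of open edges and $k(\omega)$ the number of connected components (clusters, counting isolated vertices). For $q>2$ define $\lambda_s=\min_{z\geq 0}\{z+\frac{qz}{e^z-1}\}$ and $\lambda_S=q$. Glauber dynamics: at each step pick a uniformly random edge $e$ of $K_n$ and resample $\omega(e)$ from $\pi_{n,\lambda,q}$ conditioned on $\omega$ off $e$. Chayes--Machta dynamics: from $\omega$, assign each cluster $C$ of $\omega$ an independent Bernoulli$(1/q)$ variable $X_C$; call a vertex active if its cluster has $X_C=1$; then resample every edge $xy$ with both $x,y$ active independently as open with probability $\lambda/n$ (all other edges unchanged), giving $\omega'$. Mixing time: $t_{\textsc{mix}}=\inf\{t:\max_{X_0}\|P^t(X_0,\cdot)-\pi\|_{\mathrm{TV}}<1/(2e)\}$.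 *)

theory Defs
  imports Complex_Main "HOL-Library.Extended_Real"
begin

(* Vertices of K_n are {..<n}; an edge is a 2-element set {i,j}; a configuration
   (subgraph) is a set of edges of K_n. *)
definition edges_Kn :: "nat \<Rightarrow> nat set set" where
  "edges_Kn n = {{i, j} | i j. i < j \<and> j < n}"

definition configs :: "nat \<Rightarrow> nat set set set" where
  "configs n = Pow (edges_Kn n)"

definition edge_rel :: "nat set set \<Rightarrow> (nat \<times> nat) set" where
  "edge_rel \<omega> = {(x, y). {x, y} \<in> \<omega>}"

(* clusters (connected components, isolated vertices included) *)
definition clusters :: "nat \<Rightarrow> nat set set \<Rightarrow> nat set set" where
  "clusters n \<omega> = {..<n} // ((edge_rel \<omega>)\<^sup>*)"

definition num_clusters :: "nat \<Rightarrow> nat set set \<Rightarrow> nat" where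
  "num_clusters n \<omega> = card (clusters n \<omega>)"

(* unnormalised FK weight with p = lambda / n *)
definition fk_weight :: "nat \<Rightarrow> real \<Rightarrow> real \<Rightarrow> nat set set \<Rightarrow> real" where
  "fk_weight n lam q \<omega> =
     (let p = lam / real n in
      p ^ card \<omega> * (1 - p) ^ (card (edges_Kn n) - card \<omega>) * q ^ num_clusters n \<omega>)"

definition fk_measure :: "nat \<Rightarrow> real \<Rightarrow> real \<Rightarrow> nat set set \<Rightarrow> real" where
  "fk_measure n lam q \<omega> =
     fk_weight n lam q \<omega> / (\<Sum>\<eta>\<in>configs n. fk_weight n lam q \<eta>)"

(* heat-bath Glauber dynamics: pick a uniform edge e, resample omega(e) from the
   conditional law given the rest *)
definition glauber_kernel :: "nat \<Rightarrow> real \<Rightarrow> real \<Rightarrow> nat set set \<Rightarrow> nat set set \<Rightarrow> real" where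
  "glauber_kernel n lam q \<omega> \<omega>' =
     (\<Sum>e\<in>edges_Kn n. (1 / real (card (edges_Kn n))) *
        (if \<omega>' - {e} = \<omega> - {e}
         then fk_weight n lam q \<omega>' /
              (fk_weight n lam q (\<omega> - {e}) + fk_weight n lam q (insert e \<omega>))
         else 0))"

(* Chayes--Machta dynamics: each cluster active independently w.p. 1/q; every edge
   with both endpoints active is resampled as open w.p. lambda/n; other edges kept *)
definition cm_kernel :: "nat \<Rightarrow> real \<Rightarrow> real \<Rightarrow> nat set set \<Rightarrow> nat set set \<Rightarrow> real" where
  "cm_kernel n lam q \<omega> \<omega>' =
     (let p = lam / real n in
      \<Sum>S\<in>Pow (clusters n \<omega>).
        (1 / q) ^ card S * (1 - 1 / q) ^ (card (clusters n \<omega>) - card S) *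
        (let EA = {e \<in> edges_Kn n. e \<subseteq> \<Union>S} in
         if \<omega>' - EA = \<omega> - EA
         then p ^ card (\<omega>' \<inter> EA) * (1 - p) ^ (card EA - card (\<omega>' \<inter> EA))
         else 0))"

(* t-step transition probabilities on the finite state space Omega *)
fun kernel_pow :: "'s set \<Rightarrow> ('s \<Rightarrow> 's \<Rightarrow> real) \<Rightarrow> nat \<Rightarrow> 's \<Rightarrow> 's \<Rightarrow> real" where
  "kernel_pow \<Omega> P 0 x y = (if x = y then 1 else 0)"
| "kernel_pow \<Omega> P (Suc t) x y = (\<Sum>z\<in>\<Omega>. kernel_pow \<Omega> P t x z * P z y)"

definition tv_dist :: "'s set \<Rightarrow> ('s \<Rightarrow> real) \<Rightarrow> ('s \<Rightarrow> real) \<Rightarrow> real" where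
  "tv_dist \<Omega> \<mu> \<nu> = (1 / 2) * (\<Sum>y\<in>\<Omega>. \<bar>\<mu> y - \<nu> y\<bar>)"

(* t_mix = inf {t. max_x ||P^t(x,.) - pi||_TV < 1/(2e)}; value \<infinity> if no such t *)
definition mixing_time :: "'s set \<Rightarrow> ('s \<Rightarrow> 's \<Rightarrow> real) \<Rightarrow> ('s \<Rightarrow> real) \<Rightarrow> ereal" where
  "mixing_time \<Omega> P \<pi> =
     Inf {ereal (real t) | t. \<forall>x\<in>\<Omega>. tv_dist \<Omega> (kernel_pow \<Omega> P t x) \<pi> < 1 / (2 * exp 1)}"

(* lambda_s = min over z > 0 of z + q z / (e^z - 1) (the expression at z = 0 is
   understood as its limit q, which does not affect the minimum for q > 2) *)
definition lambda_s :: "real \<Rightarrow> real" where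
  "lambda_s q = Inf ((\<lambda>z. z + q * z / (exp z - 1)) ` {0<..})"

definition lambda_S :: "real \<Rightarrow> real" where
  "lambda_S q = q"

end

theory Submission
  imports Defs "HOL-Probability.Hoeffding" "HOL-Real_Asymp.Real_Asymp"
begin

text \<open>
  For \<open>(k, l) = (0, 0)\<close> and \<open>(k, l) = (1, \<theta> n)\<close> consider the configurations with \<open>k\<close> giants of
  size at least \<open>l\<close> in which at most \<open>\<epsilon> n\<close> other vertices lie in clusters of more than
  \<open>M\<close> vertices (\<open>M\<close> a large constant). As \<open>lam > lambda_s q\<close>, the density \<open>\<theta>\<close> can be chosen so that
  an active giant is replaced by a larger one, and as \<open>lam < q\<close>, without an active giant the updated
  graph is subcritical; so a Chayes--Machta step leaves the interior of either set with exponentially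
  small probability. From its boundary layer the step enters the interior with probability bounded below,
  because a fixed proportion of the vertices in big clusters may become active, hence by reversibility
  the boundary layer has an exponentially small share of the equilibrium mass. Glauber dynamics can
  leave the set only through that layer. The two sets are disjoint, so one of them has mass at
  most 1/2 and is a bottleneck for both chains.

  The random graph estimates rest on one computation: exploring the cluster of a vertex set \<open>K\<close> shows
  that its size equals \<open>s\<close> with at most a binomial point probability, which Hoeffding's lemma makes
  exponentially small unless \<open>m (1 - (1 - p) ^ s)\<close> is close to \<open>s\<close>. A union of clusters with more than
  \<open>M\<close> vertices is the cluster of a set of at most \<open>m / M\<close> vertices, and there are few such sets.
\<close>

section \<open>Random subsets\<close>

text \<open>The delicate point is that the boundary layer is not contained in the set it bounds.
  Deleting one edge of a giant may cut it into two pieces that are both too small. The layer is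
  therefore taken in the larger family with \<open>2 * k\<close> seeds, in which only the joint size
  of the clusters of the seeds is prescribed. A Chayes--Machta step that activates all seeds forms a
  single new giant, so this larger layer is still left towards the interior with probability bounded
  below. A step may add up to \<open>\<eta> * n\<close> vertices in big clusters away from the
  giant. Three nested levels \<open>(\<epsilon> - 2 * \<eta>) * n\<close>,
  \<open>(\<epsilon> - \<eta>) * n\<close> and \<open>\<epsilon> * n\<close> for these stray
  vertices absorb this growth: the first is the interior reached from the layer, the second the
  inner edge of the layer, the third the set itself. The cutoff \<open>M\<close> has two uses.
  Clusters of at most \<open>M\<close> vertices make the number of active vertices concentrate, and
  its size makes the entropy of the seed sets smaller than the large deviation rate. It must
  therefore be fixed after \<open>\<epsilon>\<close> and \<open>\<eta>\<close> but before
  \<open>n\<close>.\<close>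

definition rset :: "'a set \<Rightarrow> real \<Rightarrow> 'a set \<Rightarrow> real" where
  "rset E p G = p ^ card G * (1 - p) ^ card (E - G)"

text \<open>Expectation over a random subset of \<open>E\<close> with independent elements. One
  notion serves for random graphs, where \<open>E\<close> is a set of edges, and for the activation
  of clusters, where \<open>p\<close> is \<open>1 / q\<close>.\<close>

definition rexp :: "'a set \<Rightarrow> real \<Rightarrow> ('a set \<Rightarrow> real) \<Rightarrow> real" where
  "rexp E p f = (\<Sum>G\<in>Pow E. rset E p G * f G)"

abbreviation rprob :: "'a set \<Rightarrow> real \<Rightarrow> ('a set \<Rightarrow> bool) \<Rightarrow> real" where
  "rprob E p P \<equiv> rexp E p (\<lambda>G. of_bool (P G))"

lemma rset_nonneg: "0 \<le> p \<Longrightarrow> p \<le> 1 \<Longrightarrow> 0 \<le> rset E p G"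
  by (simp add: rset_def)

text \<open>Multilinear expansion of the product over \<open>E\<close>. It is the source of the
  total mass (\<open>f = 1\<close>) and of the moment generating functions.\<close>

lemma rexp_prod:
  assumes "finite E"
  shows "rexp E p (\<lambda>G. \<Prod>x\<in>G. f x) = (\<Prod>x\<in>E. 1 - p + p * f x)"
proof -
  have "(\<Prod>x\<in>E. p * f x + (1 - p)) =
      (\<Sum>X\<in>Pow E. (\<Prod>x\<in>X. p * f x) * (\<Prod>x\<in>E - X. 1 - p))"
    by (rule prod_add[OF assms])
  also have "\<dots> = rexp E p (\<lambda>G. \<Prod>x\<in>G. f x)"
    unfolding rexp_def rset_def by (simp add: prod.distrib mult_ac)
  finally show ?thesis by (simp add: add.commute)
qed

lemma rexp_const [simp]:
  assumes "finite E"
  shows "rexp E p (\<lambda>_. c) = c"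
proof -
  have "rexp E p (\<lambda>_. 1) = 1"
    using rexp_prod[OF assms, of p "\<lambda>_. 1"] by simp
  then show ?thesis
    by (simp add: rexp_def sum_distrib_right[symmetric])
qed

lemma rexp_cong:
  "E = E' \<Longrightarrow> (\<And>G. G \<subseteq> E' \<Longrightarrow> f G = g G) \<Longrightarrow> rexp E p f = rexp E' p g"
  unfolding rexp_def by (auto intro!: sum.cong)

lemma rexp_mono:
  assumes "0 \<le> p" "p \<le> 1" "\<And>G. G \<subseteq> E \<Longrightarrow> f G \<le> g G"
  shows "rexp E p f \<le> rexp E p g"
  unfolding rexp_def using assms by (intro sum_mono mult_left_mono rset_nonneg) auto

lemma rexp_nonneg:
  assumes "0 \<le> p" "p \<le> 1" "\<And>G. G \<subseteq> E \<Longrightarrow> 0 \<le> f G"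
  shows "0 \<le> rexp E p f"
  unfolding rexp_def using assms by (intro sum_nonneg mult_nonneg_nonneg rset_nonneg) auto

lemma rexp_add: "rexp E p (\<lambda>G. f G + g G) = rexp E p f + rexp E p g"
  by (simp add: rexp_def distrib_left sum.distrib)

lemma rexp_cmult: "rexp E p (\<lambda>G. c * f G) = c * rexp E p f"
  by (simp add: rexp_def sum_distrib_left mult_ac)

lemma rexp_sum: "rexp E p (\<lambda>G. \<Sum>i\<in>I. f i G) = (\<Sum>i\<in>I. rexp E p (f i))"
  unfolding rexp_def sum_distrib_left by (rule sum.swap)

lemma rprob_mono:
  assumes "0 \<le> p" "p \<le> 1" "\<And>G. G \<subseteq> E \<Longrightarrow> P G \<Longrightarrow> Q G"
  shows "rprob E p P \<le> rprob E p Q"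
  using assms by (intro rexp_mono) auto

lemma rprob_le_1:
  assumes "finite E" "0 \<le> p" "p \<le> 1"
  shows "rprob E p P \<le> 1"
  using rexp_mono[of p E "\<lambda>G. of_bool (P G)" "\<lambda>_. 1"] assms by simp

lemma rprob_nonneg:
  assumes "0 \<le> p" "p \<le> 1"
  shows "0 \<le> rprob E p P"
  using assms by (intro rexp_nonneg) auto

lemma rprob_not:
  assumes "finite E"
  shows "rprob E p (\<lambda>G. \<not> P G) = 1 - rprob E p P"
proof -
  have "rprob E p (\<lambda>G. \<not> P G) + rprob E p P = rexp E p (\<lambda>_. 1)"
    unfolding rexp_add[symmetric] by (rule rexp_cong) auto
  then show ?thesis using assms by simp
qed

lemma rprob_union_bound:
  assumes "finite I" "0 \<le> p" "p \<le> 1" "\<And>G. G \<subseteq> E \<Longrightarrow> P G \<Longrightarrow> \<exists>i\<in>I. Q i G"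
  shows "rprob E p P \<le> (\<Sum>i\<in>I. rprob E p (Q i))"
proof -
  have "of_bool (P G) \<le> (\<Sum>i\<in>I. of_bool (Q i G) :: real)" if G: "G \<subseteq> E" for G
  proof (cases "P G")
    case True
    then obtain i where i: "i \<in> I" "Q i G" using assms(4) G by blast
    have "(1::real) = of_bool (Q i G)" using i by simp
    also have "\<dots> \<le> (\<Sum>i\<in>I. of_bool (Q i G))"
      using i assms(1) by (intro member_le_sum) auto
    finally show ?thesis using True by simp
  qed (auto intro: sum_nonneg)
  then have "rprob E p P \<le> rexp E p (\<lambda>G. \<Sum>i\<in>I. of_bool (Q i G))"
    using assms by (intro rexp_mono)
  then show ?thesis by (simp only: rexp_sum)
qed

lemma rprob_or_le:
  assumes "0 \<le> p" "p \<le> 1"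
  shows "rprob E p (\<lambda>G. P G \<or> Q G) \<le> rprob E p P + rprob E p Q"
  unfolding rexp_add[symmetric] using assms by (intro rexp_mono) auto

text \<open>Independence of the traces on two disjoint ground sets: the weight factorises, so the
  expectation can be iterated.\<close>

lemma rexp_Un:
  assumes "finite A" "finite B" "A \<inter> B = {}"
  shows "rexp (A \<union> B) p f = rexp A p (\<lambda>X. rexp B p (\<lambda>Y. f (X \<union> Y)))"
proof -
  have bij: "bij_betw (\<lambda>(X, Y). X \<union> Y) (Pow A \<times> Pow B) (Pow (A \<union> B))"
    by (rule bij_betw_byWitness[where f' = "\<lambda>G. (G \<inter> A, G \<inter> B)"]) (use assms(3) in auto)
  have w: "rset (A \<union> B) p (X \<union> Y) = rset A p X * rset B p Y" if "X \<subseteq> A" "Y \<subseteq> B" for X Y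
  proof -
    have fin: "finite X" "finite Y" using that assms finite_subset by blast+
    have "card (X \<union> Y) = card X + card Y"
      using that assms fin by (intro card_Un_disjoint) auto
    moreover have "A \<union> B - (X \<union> Y) = (A - X) \<union> (B - Y)" using that assms by auto
    moreover have "card ((A - X) \<union> (B - Y)) = card (A - X) + card (B - Y)"
      using that assms by (intro card_Un_disjoint) auto
    ultimately show ?thesis by (simp add: rset_def power_add)
  qed
  have "rexp (A \<union> B) p f =
      (\<Sum>(X, Y)\<in>Pow A \<times> Pow B. rset (A \<union> B) p (X \<union> Y) * f (X \<union> Y))"
    unfolding rexp_def by (subst sum.reindex_bij_betw[OF bij, symmetric]) (simp add: case_prod_unfold)
  also have "\<dots> = (\<Sum>(X, Y)\<in>Pow A \<times> Pow B. rset A p X * (rset B p Y * f (X \<union> Y)))"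
    by (intro sum.cong) (auto simp: w)
  also have "\<dots> = rexp A p (\<lambda>X. rexp B p (\<lambda>Y. f (X \<union> Y)))"
    by (simp add: rexp_def sum_distrib_left sum.cartesian_product)
  finally show ?thesis .
qed

lemma rexp_image:
  assumes "inj_on h A"
  shows "rexp (h ` A) p f = rexp A p (\<lambda>X. f (h ` X))"
proof -
  have bij: "bij_betw ((`) h) (Pow A) (Pow (h ` A))"
    using bij_betw_Pow[OF inj_on_imp_bij_betw[OF assms]] .
  have w: "rset (h ` A) p (h ` X) = rset A p X" if "X \<subseteq> A" for X
  proof -
    have "h ` A - h ` X = h ` (A - X)" using inj_on_image_set_diff[OF assms, of A X] that by auto
    then show ?thesis
      using that assms by (auto simp: rset_def card_image inj_on_subset)
  qed
  show ?thesis
    unfolding rexp_def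
    by (subst sum.reindex_bij_betw[OF bij, symmetric]) (auto intro!: sum.cong simp: w)
qed

text \<open>Elements contribute independently: one outside \<open>D\<close> has to be absent, factor
  \<open>1 - p\<close>; one in \<open>D\<close> gives \<open>p\<close> if present and
  \<open>(1 - p) * y\<close> if absent. In the exploration, \<open>N\<close> will be the set of
  newly found neighbours.\<close>

lemma rexp_subset_power:
  fixes y :: real
  assumes "finite W" "D \<subseteq> W" 
  shows "rexp W p (\<lambda>N. of_bool (N \<subseteq> D) * y ^ card (D - N)) =
    (1 - p) ^ card (W - D) * (p + (1 - p) * y) ^ card D"
proof -
  have fD: "finite D" using assms finite_subset by blast
  have WD: "W = (W - D) \<union> D" using assms by auto
  have "rexp W p (\<lambda>N. of_bool (N \<subseteq> D) * y ^ card (D - N)) =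
      rexp (W - D) p (\<lambda>X. rexp D p (\<lambda>Y. of_bool (X \<union> Y \<subseteq> D) * y ^ card (D - (X \<union> Y))))"
    by (subst (1) WD, subst rexp_Un) (use assms fD in auto)
  also have "\<dots> = rexp (W - D) p (\<lambda>X. of_bool (X = {}) * rexp D p (\<lambda>Y. y ^ card (D - Y)))"
  proof (rule rexp_cong)
    fix X assume X: "X \<subseteq> W - D"
    show "rexp D p (\<lambda>Y. of_bool (X \<union> Y \<subseteq> D) * y ^ card (D - (X \<union> Y))) =
        of_bool (X = {}) * rexp D p (\<lambda>Y. y ^ card (D - Y))"
    proof (cases "X = {}")
      case True
      then show ?thesis by (auto intro!: rexp_cong)
    next
      case False
      then have "\<not> X \<subseteq> D" using X by auto
      then show ?thesis using False by (simp add: rexp_def)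
    qed
  qed simp
  also have "\<dots> = rexp D p (\<lambda>Y. y ^ card (D - Y)) * rprob (W - D) p (\<lambda>X. X = {})"
    by (simp add: mult.commute[of "of_bool _"] rexp_cmult)
  also have "rprob (W - D) p (\<lambda>X. X = {}) = rset (W - D) p {}"
  proof -
    have "(\<Sum>G\<in>Pow (W - D). rset (W - D) p G * of_bool (G = {})) =
        (\<Sum>G\<in>{{}}. rset (W - D) p G * of_bool (G = {}))"
      using assms by (intro sum.mono_neutral_right) auto
    then show ?thesis by (simp add: rexp_def)
  qed
  also have "rexp D p (\<lambda>Y. y ^ card (D - Y)) = (p + (1 - p) * y) ^ card D"
  proof -
    have "(\<Prod>x\<in>D. p + (1 - p) * y) = (\<Sum>X\<in>Pow D. (\<Prod>x\<in>X. p) * (\<Prod>x\<in>D - X. (1 - p) * y))"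
      by (rule prod_add[OF fD])
    also have "\<dots> = rexp D p (\<lambda>Y. y ^ card (D - Y))"
      by (simp add: rexp_def rset_def power_mult_distrib mult_ac)
    finally show ?thesis by simp
  qed
  finally show ?thesis by (simp add: rset_def mult.commute)
qed

section \<open>Exploring clusters of a random graph\<close>

definition complete_edges :: "nat set \<Rightarrow> nat set set" where
  "complete_edges V = {{i, j} | i j. i \<in> V \<and> j \<in> V \<and> i \<noteq> j}"

text \<open>Admitting a set of seeds makes the exploration inductive and turns any union of clusters
  into one object.\<close>

definition reach :: "nat set set \<Rightarrow> nat set \<Rightarrow> nat set" where
  "reach \<omega> K = (edge_rel \<omega>)\<^sup>* `` K"

lemma complete_edges_subset: "complete_edges V \<subseteq> Pow V"
  by (auto simp: complete_edges_def)

lemma finite_complete_edges [simp]: "finite V \<Longrightarrow> finite (complete_edges V)"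
  using finite_subset[OF complete_edges_subset] by simp

lemma edges_Kn_eq: "edges_Kn n = complete_edges {..<n}"
proof (intro set_eqI iffI)
  fix e assume "e \<in> edges_Kn n"
  then obtain i j where "e = {i, j}" "i < j" "j < n" by (auto simp: edges_Kn_def)
  then show "e \<in> complete_edges {..<n}"
    unfolding complete_edges_def by (intro CollectI exI[of _ i] exI[of _ j]) auto
next
  fix e assume "e \<in> complete_edges {..<n}"
  then obtain i j where "e = {i, j}" "i \<noteq> j" "i < n" "j < n" by (auto simp: complete_edges_def)
  then have "e = {min i j, max i j} \<and> min i j < max i j \<and> max i j < n"
    by (auto simp: min_def max_def)
  then show "e \<in> edges_Kn n" unfolding edges_Kn_def by blast
qed

lemma complete_edges_mono: "V \<subseteq> W \<Longrightarrow> complete_edges V \<subseteq> complete_edges W"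
  by (auto simp: complete_edges_def)

lemma complete_edges_restrict:
  "V \<subseteq> W \<Longrightarrow> {e \<in> complete_edges W. e \<subseteq> V} = complete_edges V"
  by (auto simp: complete_edges_def)

lemma pair_in_complete_edges: "{a, b} \<in> complete_edges V \<longleftrightarrow> a \<in> V \<and> b \<in> V \<and> a \<noteq> b"
  by (auto simp: complete_edges_def doubleton_eq_iff)

lemma sym_edge_rel: "sym (edge_rel \<omega>)"
  by (auto simp: edge_rel_def sym_def insert_commute)

lemma sym_edge_rel_rtrancl: "(a, b) \<in> (edge_rel \<omega>)\<^sup>* \<longleftrightarrow> (b, a) \<in> (edge_rel \<omega>)\<^sup>*"
  using sym_rtrancl[OF sym_edge_rel[of \<omega>]] by (auto elim: symE)

lemma reach_superset: "K \<subseteq> reach \<omega> K"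
  by (auto simp: reach_def)

lemma reach_mono: "\<omega> \<subseteq> \<omega>' \<Longrightarrow> K \<subseteq> K' \<Longrightarrow> reach \<omega> K \<subseteq> reach \<omega>' K'"
proof -
  assume a: "\<omega> \<subseteq> \<omega>'" "K \<subseteq> K'"
  then have "edge_rel \<omega> \<subseteq> edge_rel \<omega>'" by (auto simp: edge_rel_def)
  then have "(edge_rel \<omega>)\<^sup>* \<subseteq> (edge_rel \<omega>')\<^sup>*" by (rule rtrancl_mono)
  then show ?thesis using a unfolding reach_def by blast
qed

lemma reach_closed: "a \<in> reach \<omega> K \<Longrightarrow> {a, b} \<in> \<omega> \<Longrightarrow> b \<in> reach \<omega> K"
  unfolding reach_def edge_rel_def by (auto intro: rtrancl_into_rtrancl)

lemma reach_least:
  assumes "K \<subseteq> X" "\<And>a b. a \<in> X \<Longrightarrow> {a, b} \<in> \<omega> \<Longrightarrow> b \<in> X"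
  shows "reach \<omega> K \<subseteq> X"
proof
  fix v assume "v \<in> reach \<omega> K"
  then obtain k where k: "k \<in> K" "(k, v) \<in> (edge_rel \<omega>)\<^sup>*" by (auto simp: reach_def)
  from k(2) show "v \<in> X"
    by (induction rule: rtrancl_induct) (use k(1) assms in \<open>auto simp: edge_rel_def\<close>)
qed

lemma reach_Un: "reach \<omega> (K \<union> L) = reach \<omega> K \<union> reach \<omega> L"
  by (auto simp: reach_def)

lemma reach_eq_UN: "reach \<omega> K = (\<Union>v\<in>K. reach \<omega> {v})"
  by (auto simp: reach_def)

lemma reach_sym: "a \<in> reach \<omega> {b} \<longleftrightarrow> b \<in> reach \<omega> {a}"
  by (auto simp: reach_def sym_edge_rel_rtrancl)

lemma reach_reach [simp]: "reach \<omega> (reach \<omega> K) = reach \<omega> K"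
  unfolding reach_def by (simp add: relcomp_Image[symmetric])

lemma reach_single_eq: "a \<in> reach \<omega> {b} \<Longrightarrow> reach \<omega> {a} = reach \<omega> {b}"
proof -
  have sub: "reach \<omega> {x} \<subseteq> reach \<omega> {y}" if "x \<in> reach \<omega> {y}" for x y
    using reach_mono[of \<omega> \<omega> "{x}" "reach \<omega> {y}"] that by simp
  assume "a \<in> reach \<omega> {b}"
  then show ?thesis using sub[of a b] sub[of b a] by (simp add: reach_sym)
qed

lemma reach_single_disjoint: "a \<notin> reach \<omega> K \<Longrightarrow> reach \<omega> {a} \<inter> reach \<omega> K = {}"
proof (rule ccontr)
  assume a: "a \<notin> reach \<omega> K" and "reach \<omega> {a} \<inter> reach \<omega> K \<noteq> {}"
  then obtain x where "x \<in> reach \<omega> {a}" "x \<in> reach \<omega> K" by auto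
  then have "a \<in> reach \<omega> {x}" "reach \<omega> {x} \<subseteq> reach \<omega> K"
    using reach_mono[of \<omega> \<omega> "{x}" "reach \<omega> K"] by (auto simp: reach_sym)
  then show False using a by auto
qed

lemma reach_subset: "\<omega> \<subseteq> complete_edges V \<Longrightarrow> K \<subseteq> V \<Longrightarrow> reach \<omega> K \<subseteq> V"
  by (rule reach_least) (auto dest!: subsetD simp: pair_in_complete_edges)

lemma reach_empty [simp]: "reach \<omega> {} = {}"
  by (simp add: reach_def)

section \<open>Exploration of a cluster vertex by vertex\<close>

text \<open>One step of the exploration: reveal the edges at the seed \<open>v\<close>, remove
  \<open>v\<close>, and continue in the remaining graph from the other seeds and the revealed
  neighbours.\<close>

lemma reach_insert:
  assumes G: "G \<subseteq> complete_edges V" and v: "v \<in> V" "v \<in> K"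
  shows "reach G K = insert v (reach (G \<inter> complete_edges (V - {v}))
      ((K - {v}) \<union> {w \<in> V - {v}. {v, w} \<in> G}))"
    (is "_ = insert v (reach ?G ?K)")
proof
  show "reach G K \<subseteq> insert v (reach ?G ?K)"
  proof (rule reach_least)
    show "K \<subseteq> insert v (reach ?G ?K)" using reach_superset[of ?K ?G] by auto
    fix a b assume a: "a \<in> insert v (reach ?G ?K)" and ab: "{a, b} \<in> G"
    then have "{a, b} \<in> complete_edges V" using G by auto
    then have V: "a \<in> V" "b \<in> V" "a \<noteq> b" by (auto simp: pair_in_complete_edges)
    show "b \<in> insert v (reach ?G ?K)"
    proof (cases "a = v \<or> b = v")
      case True
      then show ?thesis using V ab reach_superset[of ?K ?G] by auto
    next
      case False
      then have "{a, b} \<in> ?G" using ab V by (auto simp: pair_in_complete_edges)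
      then show ?thesis using a False reach_closed[of a ?G ?K b] by auto
    qed
  qed
  have "?K \<subseteq> reach G K"
    using v reach_superset[of K G] reach_closed[of v G K] by auto
  then have "reach ?G ?K \<subseteq> reach G (reach G K)" by (intro reach_mono) auto
  then show "insert v (reach ?G ?K) \<subseteq> reach G K" using v reach_superset[of K G] by auto
qed

text \<open>The first factor is the probability that no edge joins \<open>U\<close> to its
  complement. The second is what independence would give for the events that each vertex of
  \<open>U - K\<close> has a neighbour among \<open>card U\<close> vertices; the induction, exposing
  the edges at one seed, takes the place of this missing independence.\<close>

lemma rprob_reach_eq_le:
  fixes p :: real
  assumes "finite V" "K \<subseteq> U" "U \<subseteq> V" "0 \<le> p" "p \<le> 1"
  shows "rprob (complete_edges V) p (\<lambda>G. reach G K = U) \<le>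
    (1 - p) ^ (card U * (card V - card U)) * (1 - (1 - p) ^ card U) ^ (card U - card K)"
  using assms(1-3)
proof (induction "card V" arbitrary: V K U)
  case 0
  then show ?case by (auto simp: rprob_le_1 assms)
next
  case (Suc m)
  define x where "x = 1 - p"
  have x: "0 \<le> x" "x \<le> 1" using assms by (auto simp: x_def)
  show ?case
  proof (cases "K = {}")
    case True
    then show ?thesis
    proof (cases "U = {}")
      case False
      then have "rprob (complete_edges V) p (\<lambda>G. reach G K = U) = 0"
        using True by (auto simp: rexp_def)
      then show ?thesis using x by (simp add: x_def power_le_one)
    qed (auto simp: rprob_le_1 assms Suc)
  next
    case False
    then obtain v where v: "v \<in> K" by auto
    have fin: "finite V" "finite U" "finite K"
      using Suc.prems finite_subset[of U V] finite_subset[of K U] by auto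
    have vU: "v \<in> U" and vV: "v \<in> V" using v Suc.prems by auto
    define E' where "E' = complete_edges (V - {v})"
    define st where "st = (\<lambda>W. (\<lambda>w. {v, w}) ` W)"
    have inj: "inj_on (\<lambda>w. {v, w}) W" for W by (auto simp: inj_on_def doubleton_eq_iff)
    have fE': "finite E'" using fin by (simp add: E'_def)
    have disjE: "E' \<inter> st W = {}" for W
      by (auto simp: E'_def st_def pair_in_complete_edges)
    \<comment> \<open>Edges from \<open>v\<close> to other seeds cannot affect the cluster, those
      from \<open>v\<close> to the rest reveal the new seeds \<open>N\<close>, and those avoiding
      \<open>v\<close> form the graph of the induction hypothesis.\<close>
    have Ev: "complete_edges V = st (K - {v}) \<union> (st (V - K) \<union> E')"
    proof
      show "complete_edges V \<subseteq> st (K - {v}) \<union> (st (V - K) \<union> E')"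
      proof
        fix e assume "e \<in> complete_edges V"
        then obtain i j where e: "e = {i, j}" "i \<in> V" "j \<in> V" "i \<noteq> j"
          by (auto simp: complete_edges_def)
        show "e \<in> st (K - {v}) \<union> (st (V - K) \<union> E')"
        proof (cases "v \<in> e")
          case True
          then have "e = {v, i} \<and> i \<noteq> v \<or> e = {v, j} \<and> j \<noteq> v" using e by auto
          then show ?thesis using e by (auto simp: st_def)
        next
          case False
          then show ?thesis using e by (auto simp: E'_def pair_in_complete_edges)
        qed
      qed
      show "st (K - {v}) \<union> (st (V - K) \<union> E') \<subseteq> complete_edges V"
        using vV v Suc.prems complete_edges_mono[of "V - {v}" V]
        by (auto simp: st_def E'_def pair_in_complete_edges)
    qed
    have dj: "st (K - {v}) \<inter> (st (V - K) \<union> E') = {}"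
    proof -
      have "st (K - {v}) \<inter> st (V - K) = {}"
        using v by (auto simp: st_def doubleton_eq_iff)
      then show ?thesis using disjE[of "K - {v}"] by auto
    qed
    define u k where "u = card U" and "k = card K"
    have u: "u = Suc (card (U - {v}))" using vU fin card_Suc_Diff1[of U v] by (simp add: u_def)
    have k: "k = Suc (card (K - {v}))" using v fin card_Suc_Diff1[of K v] by (simp add: k_def)
    have m: "card (V - {v}) = m" using Suc.hyps(2) vV fin by simp
    have reachE: "reach (X \<union> (st N \<union> G)) K = insert v (reach G ((K - {v}) \<union> N))"
      if X: "X \<subseteq> st (K - {v})" and N: "N \<subseteq> V - K" and G: "G \<subseteq> E'" for X N G
    proof -
      let ?W = "X \<union> (st N \<union> G)"
      have W: "?W \<subseteq> complete_edges V" using X N G unfolding Ev by (auto simp: st_def)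
      have 1: "?W \<inter> complete_edges (V - {v}) = G"
        using X N G disjE[of "K - {v}"] disjE[of N] unfolding E'_def by blast
      have mem: "{v, w} \<in> ?W \<longleftrightarrow> {v, w} \<in> X \<or> w \<in> N" if "w \<noteq> v" for w
        using G that by (auto simp: st_def doubleton_eq_iff E'_def pair_in_complete_edges dest: subsetD)
      have "{v, w} \<in> X \<Longrightarrow> w \<in> K" for w
        using X v by (auto simp: st_def doubleton_eq_iff dest!: subsetD)
      with mem have "{w \<in> V - {v}. {v, w} \<in> ?W} \<subseteq> (K - {v}) \<union> N" by blast
      moreover have "N \<subseteq> {w \<in> V - {v}. {v, w} \<in> ?W}" using N v by (auto simp: st_def)
      ultimately have 2: "(K - {v}) \<union> {w \<in> V - {v}. {v, w} \<in> ?W} = (K - {v}) \<union> N"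
        by blast
      show ?thesis using reach_insert[OF W vV v] unfolding 1 2 .
    qed
    have "rprob (complete_edges V) p (\<lambda>G. reach G K = U) =
        rexp (st (K - {v})) p (\<lambda>X. rexp (st (V - K)) p (\<lambda>Y.
          rexp E' p (\<lambda>G. of_bool (reach (X \<union> (Y \<union> G)) K = U))))"
      unfolding Ev using fin fE' dj disjE
      by (subst rexp_Un; (subst rexp_Un)?) (auto simp: st_def Int_commute)
    also have "\<dots> = rexp (st (K - {v})) p (\<lambda>X. rexp (V - K) p (\<lambda>N.
          rexp E' p (\<lambda>G. of_bool (reach (X \<union> (st N \<union> G)) K = U))))"
      unfolding st_def by (subst rexp_image[OF inj]) simp
    also have "\<dots> = rexp (st (K - {v})) p (\<lambda>X. rexp (V - K) p (\<lambda>N.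
          rprob E' p (\<lambda>G. insert v (reach G ((K - {v}) \<union> N)) = U)))"
      by (intro rexp_cong) (auto simp: reachE)
    also have "\<dots> = rexp (V - K) p (\<lambda>N. rprob E' p (\<lambda>G. insert v (reach G ((K - {v}) \<union> N)) = U))"
      using fin by (simp add: st_def)
    \<comment> \<open>The induction hypothesis is used for \<open>V - {v}\<close>,
      \<open>U - {v}\<close> and the seeds \<open>(K - {v}) \<union> N\<close>. If \<open>N\<close>
      is not contained in \<open>U\<close>, the event is impossible, whence the indicator.\<close>
    also have "\<dots> \<le> rexp (V - K) p (\<lambda>N. x ^ ((u - 1) * (Suc m - u)) *
        (of_bool (N \<subseteq> U - K) * (1 - x ^ (u - 1)) ^ card (U - K - N)))"
    proof (rule rexp_mono)
      fix N assume N: "N \<subseteq> V - K"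
      show "rprob E' p (\<lambda>G. insert v (reach G ((K - {v}) \<union> N)) = U) \<le>
        x ^ ((u - 1) * (Suc m - u)) * (of_bool (N \<subseteq> U - K) * (1 - x ^ (u - 1)) ^ card (U - K - N))"
      proof (cases "N \<subseteq> U - K")
        case True
        have fN: "finite N" using N fin finite_subset by blast
        have "rprob E' p (\<lambda>G. insert v (reach G ((K - {v}) \<union> N)) = U) \<le>
            rprob E' p (\<lambda>G. reach G ((K - {v}) \<union> N) = U - {v})"
        proof (rule rprob_mono)
          fix G assume G: "G \<subseteq> E'" and eq: "insert v (reach G ((K - {v}) \<union> N)) = U"
          have "reach G ((K - {v}) \<union> N) \<subseteq> V - {v}"
            using N v Suc.prems G unfolding E'_def by (intro reach_subset) auto
          then show "reach G ((K - {v}) \<union> N) = U - {v}" using eq by auto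
        qed (use assms in auto)
        also have "\<dots> \<le> x ^ (card (U - {v}) * (card (V - {v}) - card (U - {v}))) *
            (1 - x ^ card (U - {v})) ^ (card (U - {v}) - card ((K - {v}) \<union> N))"
          unfolding E'_def x_def
          by (rule Suc.hyps(1)) (use m fin True Suc.prems v in auto)
        also have "card (U - {v}) * (card (V - {v}) - card (U - {v})) = (u - 1) * (Suc m - u)"
          using m u by simp
        also have "card (U - {v}) - card ((K - {v}) \<union> N) = card (U - K - N)"
        proof -
          have "U - K - N = (U - {v}) - ((K - {v}) \<union> N)" using v by auto
          then show ?thesis
            using True Suc.prems fin fN v by (auto intro!: card_Diff_subset[symmetric])
        qed
        finally show ?thesis using True u by simp
      next
        case False
        have "insert v (reach G ((K - {v}) \<union> N)) \<noteq> U" for G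
          using False N reach_superset[of "(K - {v}) \<union> N" G] by auto
        then show ?thesis using False by (simp add: rexp_def)
      qed
    qed (use assms in auto)
    also have "\<dots> = x ^ ((u - 1) * (Suc m - u)) * (x ^ card (V - K - (U - K)) *
        (p + x * (1 - x ^ (u - 1))) ^ card (U - K))"
      unfolding rexp_cmult x_def using fin Suc.prems by (subst rexp_subset_power) auto
    also have "card (V - K - (U - K)) = Suc m - u"
    proof -
      have "V - K - (U - K) = V - U" using Suc.prems by auto
      then show ?thesis using Suc.prems fin Suc.hyps(2) by (simp add: card_Diff_subset u_def)
    qed
    \<comment> \<open>The identity that closes the induction: a vertex of \<open>U - K\<close> is
      hit by \<open>v\<close>, or missed by \<open>v\<close> and bounded by the factor for the
      remaining \<open>u - 1\<close> vertices.\<close>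
    also have "p + x * (1 - x ^ (u - 1)) = 1 - x ^ u"
      using u by (simp add: x_def algebra_simps)
    also have "card (U - K) = u - k"
      using Suc.prems fin by (simp add: card_Diff_subset u_def k_def)
    also have "x ^ ((u - 1) * (Suc m - u)) * (x ^ (Suc m - u) * (1 - x ^ u) ^ (u - k)) =
        x ^ (u * (Suc m - u)) * (1 - x ^ u) ^ (u - k)"
      using u by (simp add: power_add[symmetric] mult.assoc[symmetric] add.commute)
    finally show ?thesis using Suc.hyps(2) by (simp add: x_def u_def k_def)
  qed
qed

section \<open>Point probabilities of binomial type for cluster sizes\<close>

text \<open>Hoeffding's lemma for one Bernoulli variable. For \<open>t < 0\<close> the nonnegative
  case is applied to the complementary variable, with \<open>1 - r\<close> and \<open>- t\<close>,
  and multiplied by \<open>exp t\<close>.\<close>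

lemma bernoulli_mgf_le:
  fixes r t :: real
  assumes "0 \<le> r" "r \<le> 1"
  shows "1 - r + r * exp t \<le> exp (r * t + t\<^sup>2 / 8)"
proof -
  have pos: "1 - r + r * exp t \<le> exp (r * t + t\<^sup>2 / 8)" if "0 \<le> t" "0 \<le> r" "r \<le> 1" for r t :: real
  proof -
    have "1 \<le> exp t" using that by simp
    then have "0 \<le> r * (exp t - 1)" using that by simp
    then have p: "0 < 1 + r * (exp t - 1)" by linarith
    have "ln (1 + r * (exp t - 1)) \<le> r * t + t\<^sup>2 / 8"
      using Hoeffdings_lemma_aux[of t r] that by (simp add: mult.commute)
    then have "1 + r * (exp t - 1) \<le> exp (r * t + t\<^sup>2 / 8)"
      using p by (metis exp_le_cancel_iff exp_ln)
    then show ?thesis by (simp add: algebra_simps)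
  qed
  show ?thesis
  proof (cases "0 \<le> t")
    case False
    have "1 - (1 - r) + (1 - r) * exp (- t) \<le> exp ((1 - r) * (- t) + (- t)\<^sup>2 / 8)"
      using False assms by (intro pos) auto
    then have "exp t * (1 - (1 - r) + (1 - r) * exp (- t)) \<le> exp t * exp ((1 - r) * (- t) + (- t)\<^sup>2 / 8)"
      by (intro mult_left_mono) auto
    then show ?thesis by (simp add: algebra_simps exp_add[symmetric] exp_minus)
  qed (use pos assms in auto)
qed

text \<open>Exponential tilting: multiplied by \<open>exp (t * j)\<close>, the left side is a single
  summand of the moment generating function.\<close>

lemma binomial_prob_le:
  fixes r :: real
  assumes "0 \<le> r" "r \<le> 1" "j \<le> N" "0 < N"
  shows "real (N choose j) * r ^ j * (1 - r) ^ (N - j) \<le> exp (- 2 * (real j - real N * r)\<^sup>2 / real N)"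
proof -
  \<comment> \<open>The minimiser of the final exponent
    \<open>N * (r * t + t\<^sup>2 / 8) - t * j\<close>.\<close>
  define t where "t = 4 * (real j / real N - r)"
  have "real (N choose j) * r ^ j * (1 - r) ^ (N - j) * exp (t * real j) =
      real (N choose j) * (r * exp t) ^ j * (1 - r) ^ (N - j)"
    by (simp add: power_mult_distrib exp_of_nat_mult[symmetric] mult_ac)
  also have "\<dots> \<le> (\<Sum>i\<le>N. real (N choose i) * (r * exp t) ^ i * (1 - r) ^ (N - i))"
    using assms by (intro member_le_sum) auto
  also have "\<dots> = (r * exp t + (1 - r)) ^ N" by (simp add: binomial_ring)
  also have "\<dots> \<le> exp (r * t + t\<^sup>2 / 8) ^ N"
    using bernoulli_mgf_le[OF assms(1,2), of t] assms by (intro power_mono) (auto simp: add.commute)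
  also have "\<dots> = exp (real N * (r * t + t\<^sup>2 / 8))" by (simp add: exp_of_nat_mult)
  finally have "real (N choose j) * r ^ j * (1 - r) ^ (N - j) \<le> 
      exp (real N * (r * t + t\<^sup>2 / 8)) / exp (t * real j)"
    by (simp add: field_simps)
  also have "\<dots> = exp (real N * (r * t + t\<^sup>2 / 8) - t * real j)" by (simp add: exp_diff)
  also have "real N * (r * t + t\<^sup>2 / 8) - t * real j = - 2 * (real j - real N * r)\<^sup>2 / real N"
    using assms by (simp add: t_def field_simps power2_eq_square)
  finally show ?thesis .
qed

text \<open>Put \<open>r = (1 - p) ^ s\<close>. Summing the bound for a fixed \<open>U\<close> over
  all \<open>U\<close> of size \<open>s\<close> gives exactly the probability of the value
  \<open>m - s\<close> for a binomial variable with \<open>m - k\<close> trials and parameter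
  \<open>r\<close>: each non-seed avoids the cluster with probability \<open>r\<close>.\<close>

lemma rprob_card_reach_le:
  fixes p :: real
  assumes "finite V" "V \<noteq> {}" "K \<subseteq> V" "0 \<le> p" "p \<le> 1"
  shows "rprob (complete_edges V) p (\<lambda>G. card (reach G K) = s) \<le>
    exp (- 2 * (real (card V) * (1 - (1 - p) ^ s) - real s + real (card K) * (1 - p) ^ s)\<^sup>2 / real (card V))"
proof -
  define m k r where "m = card V" and "k = card K" and "r = (1 - p) ^ s"
  have r: "0 \<le> r" "r \<le> 1" using assms by (auto simp: r_def power_le_one)
  have m0: "0 < m" using assms by (auto simp: m_def card_gt_0_iff)
  have fK: "finite K" using assms finite_subset by blast
  have km: "k \<le> m" using assms by (auto simp: k_def m_def intro: card_mono)
  define \<U> where "\<U> = {U. K \<subseteq> U \<and> U \<subseteq> V \<and> card U = s}"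
  have fU: "finite \<U>" unfolding \<U>_def by (rule finite_subset[of _ "Pow V"]) (use assms in auto)
  have sub: "K \<subseteq> reach G K \<and> reach G K \<subseteq> V" if "G \<subseteq> complete_edges V" for G
    using that assms reach_superset reach_subset by blast
  have "rprob (complete_edges V) p (\<lambda>G. card (reach G K) = s) \<le>
      (\<Sum>U\<in>\<U>. rprob (complete_edges V) p (\<lambda>G. reach G K = U))"
    using fU assms sub by (intro rprob_union_bound) (auto simp: \<U>_def)
  also have "\<dots> \<le> (\<Sum>U\<in>\<U>. r ^ (m - s) * (1 - r) ^ (s - k))"
  proof (intro sum_mono)
    fix U assume U: "U \<in> \<U>"
    show "rprob (complete_edges V) p (\<lambda>G. reach G K = U) \<le> r ^ (m - s) * (1 - r) ^ (s - k)"
      using rprob_reach_eq_le[of V K U p] U assms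
      by (simp add: \<U>_def m_def k_def r_def power_mult)
  qed
  also have "\<dots> = real (card \<U>) * (r ^ (m - s) * (1 - r) ^ (s - k))" by simp
  also have "\<dots> \<le> exp (- 2 * (real m * (1 - r) - real s + real k * r)\<^sup>2 / real m)"
  proof (cases "k \<le> s \<and> s \<le> m")
    case False
    have "\<U> = {}"
    proof (rule ccontr)
      assume "\<U> \<noteq> {}"
      then obtain U where "K \<subseteq> U" "U \<subseteq> V" "card U = s" by (auto simp: \<U>_def)
      then show False using False assms card_mono[of U K] card_mono[of V U] finite_subset[of U V]
        by (auto simp: k_def m_def)
    qed
    then show ?thesis by simp
  next
    case True
    have "bij_betw (\<lambda>W. K \<union> W) {W. W \<subseteq> V - K \<and> card W = s - k} \<U>"
    proof (rule bij_betw_byWitness[where f' = "\<lambda>U. U - K"])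
      show "(\<lambda>W. K \<union> W) ` {W. W \<subseteq> V - K \<and> card W = s - k} \<subseteq> \<U>"
      proof clarify
        fix W assume W: "W \<subseteq> V - K" "card W = s - k"
        then have "finite W" using assms finite_subset by blast
        then have "card (K \<union> W) = k + (s - k)"
          using W fK by (subst card_Un_disjoint) (auto simp: k_def)
        then show "K \<union> W \<in> \<U>" using W assms True by (auto simp: \<U>_def)
      qed
      show "(\<lambda>U. U - K) ` \<U> \<subseteq> {W. W \<subseteq> V - K \<and> card W = s - k}"
        using fK by (auto simp: \<U>_def k_def card_Diff_subset)
    qed (auto simp: \<U>_def)
    then have "card \<U> = card {W. W \<subseteq> V - K \<and> card W = s - k}" by (simp add: bij_betw_same_card)
    also have "\<dots> = (m - k) choose (s - k)"
      using assms fK by (subst n_subsets) (auto simp: m_def k_def card_Diff_subset)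
    also have "\<dots> = (m - k) choose (m - s)"
      using True km by (subst binomial_symmetric) auto
    finally have cU: "card \<U> = (m - k) choose (m - s)" .
    show ?thesis
    proof (cases "m = k")
      case True': True
      then have "s = m" using True by auto
      then show ?thesis using True' by (simp add: cU algebra_simps)
    next
      case False
      then have N: "0 < m - k" using km by simp
      have "real (card \<U>) * (r ^ (m - s) * (1 - r) ^ (s - k)) \<le>
          exp (- 2 * (real (m - s) - real (m - k) * r)\<^sup>2 / real (m - k))"
        using binomial_prob_le[OF r diff_le_mono2 N, of s] True
        by (simp add: cU mult.assoc)
      also have "\<dots> \<le> exp (- 2 * (real (m - s) - real (m - k) * r)\<^sup>2 / real m)"
      proof -
        have "(real (m - s) - real (m - k) * r)\<^sup>2 / real m \<le> (real (m - s) - real (m - k) * r)\<^sup>2 / real (m - k)"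
          using N by (intro divide_left_mono) auto
        then show ?thesis by simp
      qed
      also have "real (m - s) - real (m - k) * r = real m * (1 - r) - real s + real k * r"
        using True km by (simp add: of_nat_diff algebra_simps)
      finally show ?thesis .
    qed
  qed
  finally show ?thesis by (simp add: m_def k_def r_def)
qed

section \<open>Sub- and supercritical random graphs\<close>

text \<open>Every counted set has weight \<open>(1 / M) ^ card K\<close> at least \<open>a\<close>,
  while all subsets of \<open>V\<close> together weigh \<open>(1 + 1 / M) ^ card V\<close>. The
  resulting rate tends to 0 as \<open>M\<close> grows, so the union bound over seed sets is
  affordable.\<close>

lemma card_small_subsets_le:
  assumes "finite V" "0 < M"
  shows "real (card {K. K \<subseteq> V \<and> M * card K \<le> card V}) \<le>
    exp (real (card V) * ((ln (real M) + 1) / real M))"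
proof -
  define m where "m = card V"
  define a where "a = exp (- (real m / real M * ln (real M)))"
  let ?S = "{K. K \<subseteq> V \<and> M * card K \<le> card V}"
  have "real (card ?S) * a = (\<Sum>K\<in>?S. a)" by simp
  also have "\<dots> \<le> (\<Sum>K\<in>?S. (1 / real M) ^ card K)"
  proof (rule sum_mono)
    fix K assume "K \<in> ?S"
    then have "M * card K \<le> m" by (simp add: m_def)
    then have "real M * real (card K) \<le> real m" by (simp only: of_nat_mult[symmetric] of_nat_le_iff)
    then have "real (card K) \<le> real m / real M" using assms by (simp add: field_simps)
    then have "real (card K) * ln (real M) \<le> real m / real M * ln (real M)"
      using assms by (intro mult_right_mono) auto
    then have "a \<le> exp (real (card K) * (- ln (real M)))" by (simp add: a_def)
    also have "\<dots> = (1 / real M) ^ card K"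
      using assms by (simp add: exp_of_nat_mult exp_minus field_simps)
    finally show "a \<le> (1 / real M) ^ card K" .
  qed
  also have "\<dots> \<le> (\<Sum>K\<in>Pow V. (1 / real M) ^ card K)"
    using assms by (intro sum_mono2) auto
  also have "\<dots> = (1 / real M + 1) ^ m"
    using prod_add[OF assms(1), of "\<lambda>_. 1 / real M" "\<lambda>_. 1"] by (simp add: m_def)
  also have "\<dots> \<le> exp (1 / real M) ^ m"
    using exp_ge_add_one_self[of "1 / real M"] by (intro power_mono) (auto simp: add.commute)
  also have "\<dots> = exp (real m / real M)" by (simp add: exp_of_nat_mult[symmetric])
  finally have "real (card ?S) \<le> exp (real m / real M) / a"
    by (simp add: a_def field_simps)
  also have "\<dots> = exp (real m * ((ln (real M) + 1) / real M))"
    by (simp add: a_def exp_diff[symmetric] algebra_simps add_divide_distrib)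
  finally show ?thesis by (simp add: m_def)
qed

text \<open>If each of \<open>m\<close> vertices is joined to each of \<open>s\<close> others
  independently with probability \<open>p\<close>, this is the mean number of vertices hit, minus
  \<open>s\<close>. Its zeros are the self-consistent cluster sizes.\<close>

definition drift :: "nat \<Rightarrow> real \<Rightarrow> nat \<Rightarrow> real" where
  "drift m p s = real m * (1 - (1 - p) ^ s) - real s"

definition big :: "nat \<Rightarrow> nat set \<Rightarrow> nat set set \<Rightarrow> nat set" where
  "big M V G = {v \<in> V. M < card (reach G {v})}"

text \<open>Inclusion and exclusion: the subtracted term is the mean number of vertices hit by both
  sets.\<close>

lemma drift_add:
  "drift m p (s + t) = drift m p s + drift m p t - real m * (1 - (1 - p) ^ s) * (1 - (1 - p) ^ t)"
  by (simp add: drift_def algebra_simps power_add)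

definition irregular :: "nat \<Rightarrow> real \<Rightarrow> nat set \<Rightarrow> real \<Rightarrow> nat set set \<Rightarrow> bool" where
  "irregular M p V D G \<longleftrightarrow>
     (\<exists>K\<subseteq>V. M * card K \<le> card V \<and> D \<le> \<bar>drift (card V) p (card (reach G K))\<bar>)"

text \<open>Union bound over seed sets and cluster sizes: at most
  \<open>exp (\<delta>\<^sup>2 / 4 * n)\<close> sets and \<open>n + 1\<close> sizes, each pair of
  probability at most \<open>exp (- (\<delta>\<^sup>2 / 2) * n)\<close>.\<close>

lemma rprob_irregular_le:
  fixes p \<delta> :: real
  assumes "finite V" "card V \<le> n" "0 < n" "0 \<le> p" "p \<le> 1"
    and "0 < \<delta>" "0 < M" "1 / real M \<le> \<delta> / 2" "(ln (real M) + 1) / real M \<le> \<delta>\<^sup>2 / 4"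
  shows "rprob (complete_edges V) p (irregular M p V (\<delta> * real n)) \<le>
    (real n + 1) * exp (- (\<delta>\<^sup>2 / 4) * real n)"
proof (cases "V = {}")
  case True
  then show ?thesis using assms
    by (simp add: irregular_def drift_def complete_edges_def rexp_def mult_le_0_iff)
next
  case False
  define m where "m = card V"
  have m: "0 < m" "m \<le> n" using False assms by (auto simp: m_def card_gt_0_iff)
  define \<K> where "\<K> = {K. K \<subseteq> V \<and> M * card K \<le> card V}"
  define I where "I = \<K> \<times> {s. s \<le> m \<and> \<delta> * real n \<le> \<bar>drift m p s\<bar>}"
  have f\<K>: "finite \<K>" unfolding \<K>_def by (rule finite_subset[of _ "Pow V"]) (use assms in auto)
  have fI: "finite I" using f\<K> by (auto simp: I_def)
  have "rprob (complete_edges V) p (irregular M p V (\<delta> * real n)) \<le>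
      (\<Sum>(K, s)\<in>I. rprob (complete_edges V) p (\<lambda>G. card (reach G K) = s))"
    unfolding case_prod_unfold
  proof (rule rprob_union_bound[OF fI assms(4,5)])
    fix G assume G: "G \<subseteq> complete_edges V" and "irregular M p V (\<delta> * real n) G"
    then obtain K where K: "K \<subseteq> V" "M * card K \<le> card V"
      "\<delta> * real n \<le> \<bar>drift m p (card (reach G K))\<bar>"
      by (auto simp: irregular_def m_def)
    have "card (reach G K) \<le> m"
      unfolding m_def using reach_subset[OF G K(1)] assms by (intro card_mono) auto
    then show "\<exists>i\<in>I. card (reach G (fst i)) = snd i"
      using K by (intro bexI[of _ "(K, card (reach G K))"]) (auto simp: I_def \<K>_def)
  qed
  also have "\<dots> \<le> (\<Sum>i\<in>I. exp (- (\<delta>\<^sup>2 / 2) * real n))"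
  proof (rule sum_mono, clarify)
    fix K s assume i: "(K, s) \<in> I"
    define x where "x = (1 - p) ^ s"
    have x: "0 \<le> x" "x \<le> 1" using assms by (auto simp: x_def power_le_one)
    have "M * card K \<le> m" using i by (auto simp: I_def \<K>_def m_def)
    then have "real M * real (card K) \<le> real m" by (simp only: of_nat_mult[symmetric] of_nat_le_iff)
    then have "real (card K) \<le> real m * (1 / real M)" using assms by (simp add: field_simps)
    also have "\<dots> \<le> real n * (\<delta> / 2)" using m assms by (intro mult_mono) auto
    \<comment> \<open>The seeds shift the deviation by at most half of the threshold
      \<open>\<delta> * n\<close>; the other half produces the rate
      \<open>\<delta>\<^sup>2 / 2\<close>.\<close>
    finally have "real (card K) * x \<le> \<delta> / 2 * real n"
      using x mult_mono[of "real (card K)" "\<delta> / 2 * real n" x 1] by (simp add: mult.commute)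
    moreover have "0 \<le> real (card K) * x" using x by simp
    moreover have "\<delta> * real n \<le> \<bar>drift m p s\<bar>" using i by (auto simp: I_def)
    ultimately have "\<delta> / 2 * real n \<le> \<bar>drift m p s + real (card K) * x\<bar>" by linarith
    then have "(\<delta> / 2 * real n)\<^sup>2 \<le> (drift m p s + real (card K) * x)\<^sup>2"
      using assms by (subst abs_le_square_iff[symmetric]) auto
    then have "2 * (\<delta> / 2 * real n)\<^sup>2 / real n \<le> 2 * (drift m p s + real (card K) * x)\<^sup>2 / real m"
      using m by (intro frac_le) auto
    moreover have "2 * (\<delta> / 2 * real n)\<^sup>2 / real n = \<delta>\<^sup>2 / 2 * real n"
      using assms by (simp add: power2_eq_square field_simps)
    ultimately have le: "- 2 * (drift m p s + real (card K) * x)\<^sup>2 / real m \<le> - (\<delta>\<^sup>2 / 2) * real n"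
      by simp
    have "rprob (complete_edges V) p (\<lambda>G. card (reach G K) = s) \<le>
        exp (- 2 * (drift m p s + real (card K) * x)\<^sup>2 / real m)"
      using rprob_card_reach_le[of V K p s] False assms i
      by (simp add: drift_def m_def x_def I_def \<K>_def)
    also have "\<dots> \<le> exp (- (\<delta>\<^sup>2 / 2) * real n)" using le by simp
    finally show "rprob (complete_edges V) p (\<lambda>G. card (reach G K) = s) \<le> exp (- (\<delta>\<^sup>2 / 2) * real n)" .
  qed
  also have "\<dots> = real (card I) * exp (- (\<delta>\<^sup>2 / 2) * real n)" by simp
  also have "\<dots> \<le> (exp (\<delta>\<^sup>2 / 4 * real n) * (real n + 1)) * exp (- (\<delta>\<^sup>2 / 2) * real n)"
  proof (rule mult_right_mono)
    have "card I = card \<K> * card {s. s \<le> m \<and> \<delta> * real n \<le> \<bar>drift m p s\<bar>}"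
      by (simp add: I_def card_cartesian_product)
    moreover have "card {s. s \<le> m \<and> \<delta> * real n \<le> \<bar>drift m p s\<bar>} \<le> card {..m}"
      by (intro card_mono) auto
    ultimately have "real (card I) \<le> real (card \<K>) * (real m + 1)"
      by (simp add: mult_left_mono)
    also have "\<dots> \<le> exp (\<delta>\<^sup>2 / 4 * real n) * (real n + 1)"
    proof (rule mult_mono)
      have "real (card \<K>) \<le> exp (real m * ((ln (real M) + 1) / real M))"
        using card_small_subsets_le[of V M] assms by (simp add: \<K>_def m_def)
      also have "real m * ((ln (real M) + 1) / real M) \<le> real n * (\<delta>\<^sup>2 / 4)"
        using m assms by (intro mult_mono) auto
      finally show "real (card \<K>) \<le> exp (\<delta>\<^sup>2 / 4 * real n)" by (simp add: mult.commute)
    qed (use m in auto)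
    finally show "real (card I) \<le> exp (\<delta>\<^sup>2 / 4 * real n) * (real n + 1)" .
  qed simp
  also have "\<dots> = (real n + 1) * exp (- (\<delta>\<^sup>2 / 4) * real n)"
  proof -
    have "exp (\<delta>\<^sup>2 / 4 * real n) * exp (- (\<delta>\<^sup>2 / 2) * real n) = exp (- (\<delta>\<^sup>2 / 4) * real n)"
      unfolding exp_add[symmetric] by (simp add: field_simps)
    then show ?thesis by (simp add: mult_ac)
  qed
  finally show ?thesis .
qed

text \<open>One seed per cluster suffices, and \<open>U\<close> has room for at most
  \<open>card U / M\<close> disjoint clusters of more than \<open>M\<close> vertices.\<close>

lemma big_closed_seeds:
  assumes "finite V" "G \<subseteq> complete_edges V" "U \<subseteq> big M V G" "\<And>v. v \<in> U \<Longrightarrow> reach G {v} \<subseteq> U"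
  shows "\<exists>K\<subseteq>U. reach G K = U \<and> M * card K \<le> card U"
  using assms(3,4)
proof (induction "card U" arbitrary: U rule: less_induct)
  case less
  show ?case
  proof (cases "U = {}")
    case False
    then obtain v where v: "v \<in> U" by auto
    have UV: "U \<subseteq> V" using less.prems by (auto simp: big_def)
    have fU: "finite U" using UV assms finite_subset by blast
    let ?R = "reach G {v}"
    have R: "?R \<subseteq> U" "v \<in> ?R" using v less.prems reach_superset[of "{v}" G] by auto
    have fR: "finite ?R" using R fU finite_subset by blast
    have cR: "M < card ?R" using v less.prems by (auto simp: big_def)
    have cU: "card U = card (U - ?R) + card ?R"
      using R fU fR card_mono[of U ?R] by (simp add: card_Diff_subset)
    have "\<exists>K\<subseteq>U - ?R. reach G K = U - ?R \<and> M * card K \<le> card (U - ?R)"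
    proof (rule less.hyps)
      show "card (U - ?R) < card U" using cU cR by simp
      show "U - ?R \<subseteq> big M V G" using less.prems by auto
      fix w assume w: "w \<in> U - ?R"
      then have "reach G {w} \<inter> ?R = {}" using reach_single_disjoint by auto
      then show "reach G {w} \<subseteq> U - ?R" using w less.prems by auto
    qed
    then obtain K where K: "K \<subseteq> U - ?R" "reach G K = U - ?R" "M * card K \<le> card (U - ?R)" by auto
    have fK: "finite K" using K fU finite_subset by blast
    have "card (insert v K) = Suc (card K)" using K R fK by (subst card_insert_disjoint) auto
    then have "M * card (insert v K) \<le> card U" using K cU cR by simp
    moreover have "reach G (insert v K) = U"
      using K R reach_Un[of G "{v}" K] by auto
    ultimately show ?thesis using K v by (intro exI[of _ "insert v K"]) auto
  qed auto
qed

lemma reach_subset_big: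
  assumes "G \<subseteq> complete_edges V" "v \<in> big M V G"
  shows "reach G {v} \<subseteq> big M V G"
proof
  fix w assume w: "w \<in> reach G {v}"
  then have "reach G {w} = reach G {v}" by (rule reach_single_eq)
  moreover have "w \<in> V" using w reach_subset[OF assms(1), of "{v}"] assms(2) by (auto simp: big_def)
  ultimately show "w \<in> big M V G" using assms by (simp add: big_def)
qed

lemma regular_drift_less:
  assumes "finite V" "G \<subseteq> complete_edges V" "\<not> irregular M p V D G"
    and "U \<subseteq> big M V G" "\<And>v. v \<in> U \<Longrightarrow> reach G {v} \<subseteq> U"
  shows "\<bar>drift (card V) p (card U)\<bar> < D"
proof -
  obtain K where K: "K \<subseteq> U" "reach G K = U" "M * card K \<le> card U"
    using big_closed_seeds[OF assms(1,2,4,5)] by auto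
  have UV: "U \<subseteq> V" using assms by (auto simp: big_def)
  then have "card U \<le> card V" using assms by (intro card_mono) auto
  then have "K \<subseteq> V" "M * card K \<le> card V" using K UV by auto
  then have "\<not> D \<le> \<bar>drift (card V) p (card (reach G K))\<bar>"
    using assms(3) unfolding irregular_def by blast
  then show ?thesis using K(2) by simp
qed

section \<open>The subcritical regime\<close>

lemma Bernoulli_power_le:
  fixes p :: real
  assumes "0 \<le> p" "p \<le> 1"
  shows "1 - (1 - p) ^ s \<le> real s * p"
  using Bernoulli_inequality[of "- p" s] assms by simp

text \<open>Bernoulli's inequality gives the union of all big clusters a drift of at most
  \<open>- \<gamma>\<close> times its size. Regularity excludes this once the size reaches
  \<open>b\<close>.\<close>

lemma subcritical_big_le:
  fixes p :: real
  assumes "finite V" "G \<subseteq> complete_edges V" "0 \<le> p" "p \<le> 1" "p * real (card V) \<le> 1 - \<gamma>"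
    and "\<not> irregular M p V (\<gamma> * b) G" "0 \<le> \<gamma>"
  shows "real (card (big M V G)) < b"
proof (rule ccontr)
  assume "\<not> ?thesis"
  then have b: "b \<le> real (card (big M V G))" by simp
  define s where "s = card (big M V G)"
  have "\<bar>drift (card V) p s\<bar> < \<gamma> * b"
    unfolding s_def using assms reach_subset_big[OF assms(2)] by (intro regular_drift_less) blast+
  moreover have "drift (card V) p s \<le> - \<gamma> * real s"
  proof -
    have "real (card V) * (1 - (1 - p) ^ s) \<le> real (card V) * (real s * p)"
      using Bernoulli_power_le[of p s] assms by (intro mult_left_mono) auto
    also have "\<dots> = (p * real (card V)) * real s" by simp
    also have "\<dots> \<le> (1 - \<gamma>) * real s" using assms by (intro mult_right_mono) auto
    finally show ?thesis by (simp add: drift_def algebra_simps)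
  qed
  moreover have "\<gamma> * b \<le> \<gamma> * real s" using b assms by (intro mult_left_mono) (auto simp: s_def)
  ultimately show False by linarith
qed

lemma ex_big_threshold:
  fixes \<delta> :: real
  assumes "0 < \<delta>"
  shows "\<exists>M0. \<forall>M\<ge>M0. 0 < M \<and> 1 / real M \<le> \<delta> / 2 \<and> (ln (real M) + 1) / real M \<le> \<delta>\<^sup>2 / 4"
proof -
  have "(\<lambda>M::nat. 1 / real M) \<longlonglongrightarrow> 0" "(\<lambda>M::nat. (ln (real M) + 1) / real M) \<longlonglongrightarrow> 0"
    by real_asymp+
  then have "\<forall>\<^sub>F M in sequentially. 1 / real M < \<delta> / 2"
      "\<forall>\<^sub>F M in sequentially. (ln (real M) + 1) / real M < \<delta>\<^sup>2 / 4"
    using assms by (auto intro!: order_tendstoD(2) simp del: divide_less_eq_numeral1 less_divide_eq_numeral1)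
  then have "\<forall>\<^sub>F M in sequentially. 0 < M \<and> 1 / real M \<le> \<delta> / 2 \<and> (ln (real M) + 1) / real M \<le> \<delta>\<^sup>2 / 4"
    using eventually_gt_at_top[of 0] by eventually_elim auto
  then show ?thesis by (simp add: eventually_sequentially)
qed

text \<open>Half of the exponential rate is spent on the polynomial factor.\<close>

lemma eventually_poly_exp_le:
  fixes a :: real
  assumes "0 < a"
  shows "\<exists>N. \<forall>n\<ge>N. C * (real n + 1) * exp (- a * real n) \<le> exp (- (a / 2) * real n)"
proof -
  have "(\<lambda>n. C * (real n + 1) * exp (- (a / 2) * real n)) \<longlonglongrightarrow> 0"
    using assms by real_asymp
  then have "\<forall>\<^sub>F n in sequentially. C * (real n + 1) * exp (- (a / 2) * real n) < 1"
    by (rule order_tendstoD(2)) simp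
  then obtain N where N: "\<And>n. n \<ge> N \<Longrightarrow> C * (real n + 1) * exp (- (a / 2) * real n) < 1"
    by (auto simp: eventually_sequentially)
  show ?thesis
  proof (intro exI allI impI)
    fix n assume "n \<ge> N"
    then have "(C * (real n + 1) * exp (- (a / 2) * real n)) * exp (- (a / 2) * real n) \<le>
        1 * exp (- (a / 2) * real n)"
      using N[of n] by (intro mult_right_mono) auto
    moreover have "exp (- (a / 2) * real n) * exp (- (a / 2) * real n) = exp (- a * real n)"
      unfolding exp_add[symmetric] by (simp add: field_simps)
    ultimately show "C * (real n + 1) * exp (- a * real n) \<le> exp (- (a / 2) * real n)"
      by (simp only: mult.assoc mult_1)
  qed
qed

lemma subcritical_whp:
  fixes lam \<gamma> \<eta> :: real
  assumes "0 < lam" "0 < \<gamma>" "0 < \<eta>"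
  shows "\<exists>M0. \<forall>M\<ge>M0. \<exists>c>0. \<exists>N. \<forall>n\<ge>N. \<forall>V::nat set. finite V \<and> card V \<le> n \<and>
      lam * real (card V) \<le> (1 - \<gamma>) * real n \<longrightarrow>
      rprob (complete_edges V) (lam / real n) (\<lambda>G. \<eta> * real n \<le> real (card (big M V G)))
        \<le> exp (- c * real n)"
proof -
  \<comment> \<open>Makes \<open>\<delta> * n\<close> equal to the threshold
    \<open>\<gamma> * b\<close> of \<open>subcritical_big_le\<close> for
    \<open>b = \<eta> * n\<close>.\<close>
  define \<delta> where "\<delta> = \<gamma> * \<eta>"
  have \<delta>: "0 < \<delta>" using assms by (simp add: \<delta>_def)
  obtain M0 where M0: "\<And>M. M \<ge> M0 \<Longrightarrow> 0 < M \<and> 1 / real M \<le> \<delta> / 2 \<and> (ln (real M) + 1) / real M \<le> \<delta>\<^sup>2 / 4"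
    using ex_big_threshold[OF \<delta>] by auto
  obtain N0 where N0: "\<And>n. n \<ge> N0 \<Longrightarrow>
      1 * (real n + 1) * exp (- (\<delta>\<^sup>2 / 4) * real n) \<le> exp (- (\<delta>\<^sup>2 / 4 / 2) * real n)"
    using eventually_poly_exp_le[of "\<delta>\<^sup>2 / 4" 1] \<delta> by auto
  show ?thesis
  proof (rule exI[of _ M0], intro allI impI, rule exI[of _ "\<delta>\<^sup>2 / 4 / 2"], intro conjI,
      use \<delta> in simp, rule exI[of _ "max N0 (nat \<lceil>lam\<rceil>)"], intro allI impI, elim conjE)
    fix M n and V :: "nat set"
    assume M: "M0 \<le> M" and n: "max N0 (nat \<lceil>lam\<rceil>) \<le> n" and V: "finite V" "card V \<le> n"
      "lam * real (card V) \<le> (1 - \<gamma>) * real n"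
    have nl: "lam \<le> real n" using n by linarith
    then have n0: "0 < n" using assms by (auto intro: gr0I)
    define p where "p = lam / real n"
    have p: "0 \<le> p" "p \<le> 1" using nl n0 assms by (auto simp: p_def)
    have pV: "p * real (card V) \<le> 1 - \<gamma>" using V n0 by (simp add: p_def field_simps)
    have "rprob (complete_edges V) p (\<lambda>G. \<eta> * real n \<le> real (card (big M V G)))
        \<le> rprob (complete_edges V) p (irregular M p V (\<delta> * real n))"
    proof (rule rprob_mono[OF p], rule ccontr)
      fix G assume "G \<subseteq> complete_edges V" "\<eta> * real n \<le> real (card (big M V G))"
        "\<not> irregular M p V (\<delta> * real n) G"
      then show False
        using subcritical_big_le[OF V(1) _ p pV, of G M "\<eta> * real n"] assms
        by (simp add: \<delta>_def mult.assoc)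
    qed
    also have "\<dots> \<le> (real n + 1) * exp (- (\<delta>\<^sup>2 / 4) * real n)"
      using M0[OF M] V n0 p \<delta> by (intro rprob_irregular_le) auto
    also have "\<dots> \<le> exp (- (\<delta>\<^sup>2 / 4 / 2) * real n)" using N0[of n] n by simp
    finally show "rprob (complete_edges V) (lam / real n) (\<lambda>G. \<eta> * real n \<le> real (card (big M V G)))
        \<le> exp (- (\<delta>\<^sup>2 / 4 / 2) * real n)" by (simp add: p_def)
  qed
qed

section \<open>The supercritical regime\<close>

lemma one_minus_exp_concave:
  fixes a y :: real
  assumes "0 \<le> a" "a \<le> 1"
  shows "a * (1 - exp (- y)) \<le> 1 - exp (- (a * y))"
proof -
  have "convex_on UNIV (exp :: real \<Rightarrow> real)" using convex_on_exp[of 1] by simp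
  from convex_onD[OF this, of a 0 "- y"] assms show ?thesis by (simp add: algebra_simps)
qed

text \<open>The concave function \<open>1 - exp (- lam * y)\<close> lies above its chord over the
  interval from 0 to \<open>\<theta>\<close>. Hence the relative surplus at density
  \<open>\<theta>\<close> bounds the relative drift at all smaller densities.\<close>

lemma drift_ge:
  fixes lam \<theta> \<mu> :: real
  assumes "0 < n" "0 < lam" "lam \<le> real n" "0 < \<theta>" "0 \<le> \<mu>"
    and "\<mu> * real n \<le> real m" "real s \<le> \<theta> * real n"
  shows "real s * ((\<mu> * (1 - exp (- lam * \<theta>)) - \<theta>) / \<theta>) \<le> drift m (lam / real n) s"
proof -
  define a where "a = real s / (\<theta> * real n)"
  have a: "0 \<le> a" "a \<le> 1" using assms by (auto simp: a_def divide_simps)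
  have "(1 - lam / real n) ^ s \<le> exp (- (lam / real n)) ^ s"
    using exp_ge_add_one_self[of "- (lam / real n)"] assms by (intro power_mono) auto
  also have "\<dots> = exp (- (a * (lam * \<theta>)))"
    using assms by (simp add: exp_of_nat_mult[symmetric] a_def field_simps)
  finally have "a * (1 - exp (- (lam * \<theta>))) \<le> 1 - (1 - lam / real n) ^ s"
    using one_minus_exp_concave[OF a, of "lam * \<theta>"] by linarith
  moreover have "0 \<le> a * (1 - exp (- (lam * \<theta>)))" using a assms by auto
  ultimately have "(\<mu> * real n) * (a * (1 - exp (- (lam * \<theta>)))) \<le> real m * (1 - (1 - lam / real n) ^ s)"
    using assms by (intro mult_mono) auto
  moreover have "(\<mu> * real n) * (a * (1 - exp (- (lam * \<theta>)))) =
      real s * (\<mu> * (1 - exp (- (lam * \<theta>))) / \<theta>)"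
    using assms by (simp add: a_def field_simps)
  ultimately show ?thesis using assms by (simp add: drift_def diff_divide_distrib right_diff_distrib)
qed

text \<open>A seed outside the big clusters reaches at most \<open>M\<close> vertices. So if few
  seeds reach many vertices, then many vertices lie in big clusters.\<close>

lemma card_reach_le_big:
  assumes "finite V" "G \<subseteq> complete_edges V" "K \<subseteq> V"
  shows "card (reach G K) \<le> M * card K + card (big M V G)"
proof -
  have fK: "finite K" using assms finite_subset by blast
  have sub: "reach G K \<subseteq> big M V G \<union> (\<Union>v\<in>K - big M V G. reach G {v})"
  proof
    fix w assume "w \<in> reach G K"
    then obtain v where v: "v \<in> K" "w \<in> reach G {v}" using reach_eq_UN[of G K] by auto
    then show "w \<in> big M V G \<union> (\<Union>v\<in>K - big M V G. reach G {v})"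
      using reach_subset_big[OF assms(2), of v M] by (cases "v \<in> big M V G") auto
  qed
  have fr: "finite (reach G {v})" if "v \<in> K" for v
    using reach_subset[OF assms(2), of "{v}"] that assms finite_subset[of "reach G {v}" V] by auto
  have fb: "finite (big M V G)" using assms by (simp add: big_def)
  have "card (reach G K) \<le> card (big M V G \<union> (\<Union>v\<in>K - big M V G. reach G {v}))"
    using sub fr fK fb by (intro card_mono) auto
  also have "\<dots> \<le> card (big M V G) + card (\<Union>v\<in>K - big M V G. reach G {v})"
    by (rule card_Un_le)
  also have "card (\<Union>v\<in>K - big M V G. reach G {v}) \<le> (\<Sum>v\<in>K - big M V G. card (reach G {v}))"
    using fK by (intro card_UN_le) auto
  also have "\<dots> \<le> (\<Sum>v\<in>K - big M V G. M)"
    using assms by (intro sum_mono) (auto simp: big_def not_less)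
  also have "\<dots> \<le> M * card K" using fK by (simp add: card_mono mult.commute)
  finally show ?thesis by simp
qed

text \<open>If two disjoint unions of big clusters were both macroscopic, then by \<open>drift_add\<close> one of them,
  or their union, would have a drift of linear order.\<close>
lemma supercritical_giant:
  fixes lam \<theta> \<mu> \<eta> \<delta> :: real
  assumes "finite V" "card V \<le> n" "0 < n" "G \<subseteq> complete_edges V"
    and "0 < lam" "lam \<le> real n" "0 < \<theta>" "0 \<le> \<mu>" "\<mu> * real n \<le> real (card V)"
    and "0 < \<eta>" "2 * \<eta> \<le> \<theta>"
    and "\<delta> \<le> \<eta> * ((\<mu> * (1 - exp (- lam * \<theta>)) - \<theta>) / \<theta>)"
    and "\<theta> < \<mu> * (1 - exp (- lam * \<theta>))"
    and "3 * \<delta> \<le> \<mu> * (1 - exp (- lam * \<eta>))\<^sup>2"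
    and reg: "\<not> irregular M (lam / real n) V (\<delta> * real n) G"
    and large: "\<eta> * real n \<le> real (card (big M V G))"
  shows "\<exists>c\<in>V. \<theta> * real n \<le> real (card (reach G {c})) \<and>
    real (card (big M V G - reach G {c})) < \<eta> * real n"
proof -
  define p where "p = lam / real n"
  define closed where "closed = (\<lambda>U. U \<subseteq> big M V G \<and> (\<forall>v\<in>U. reach G {v} \<subseteq> U))"
  have dr: "\<bar>drift (card V) p (card U)\<bar> < \<delta> * real n" if "closed U" for U
    using regular_drift_less[OF assms(1,4) reg, of U] that by (auto simp: closed_def p_def)
  have fb: "finite (big M V G)" using assms by (simp add: big_def)
  have fin: "finite U" if "closed U" for U using that fb finite_subset by (auto simp: closed_def)
  \<comment> \<open>At sizes between \<open>\<eta> * n\<close> and \<open>\<theta> * n\<close> the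
    drift is at least \<open>\<delta> * n\<close>, which regularity forbids.\<close>
  have gap: "\<theta> * real n < real (card U)" if U: "closed U" "\<eta> * real n \<le> real (card U)" for U
  proof (rule ccontr)
    assume "\<not> ?thesis"
    then have le: "real (card U) \<le> \<theta> * real n" by simp
    let ?\<psi> = "(\<mu> * (1 - exp (- lam * \<theta>)) - \<theta>) / \<theta>"
    have "\<delta> * real n \<le> (\<eta> * ?\<psi>) * real n" using assms(12) by (intro mult_right_mono) auto
    also have "\<dots> = (\<eta> * real n) * ?\<psi>" by simp
    also have "\<dots> \<le> real (card U) * ?\<psi>"
      using assms(7,13) U by (intro mult_right_mono) auto
    also have "\<dots> \<le> drift (card V) p (card U)"
      unfolding p_def using assms le by (intro drift_ge) auto
    finally show False using dr[OF U(1)] by simp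
  qed
  \<comment> \<open>The drifts of \<open>U\<close>, \<open>W\<close> and their union are each below
    \<open>\<delta> * n\<close> in absolute value, so they cannot balance an overlap term of at
    least \<open>3 * \<delta> * n\<close> in \<open>drift_add\<close>.\<close>
  have two: False
    if U: "closed U" "closed W" "U \<inter> W = {}" "\<eta> * real n \<le> real (card U)" "\<eta> * real n \<le> real (card W)"
    for U W
  proof -
    have "closed (U \<union> W)" using U by (fastforce simp: closed_def)
    from dr[OF this] have 1: "\<bar>drift (card V) p (card U + card W)\<bar> < \<delta> * real n"
      using U fin by (simp add: card_Un_disjoint)
    have pw: "1 - exp (- lam * \<eta>) \<le> 1 - (1 - p) ^ s" if "\<eta> * real n \<le> real s" for s
    proof -
      have "(1 - p) ^ s \<le> exp (- p) ^ s"
        using exp_ge_add_one_self[of "- p"] assms by (intro power_mono) (auto simp: p_def)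
      also have "\<dots> = exp (- (p * real s))" by (simp add: exp_of_nat_mult[symmetric] mult.commute)
      also have "\<dots> \<le> exp (- lam * \<eta>)"
        using that assms mult_left_mono[of "\<eta> * real n" "real s" p] by (simp add: p_def)
      finally show ?thesis by simp
    qed
    have ex: "0 \<le> 1 - exp (- lam * \<eta>)" using assms by simp
    have "3 * \<delta> * real n \<le> (\<mu> * (1 - exp (- lam * \<eta>))\<^sup>2) * real n"
      using assms(14) by (intro mult_right_mono) auto
    also have "\<dots> = (\<mu> * real n) * ((1 - exp (- lam * \<eta>)) * (1 - exp (- lam * \<eta>)))"
      by (simp add: power2_eq_square)
    also have "\<dots> \<le> real (card V) * ((1 - (1 - p) ^ card U) * (1 - (1 - p) ^ card W))"
    proof (intro mult_mono)
      show "0 \<le> 1 - (1 - p) ^ card U"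
        using assms by (auto simp: p_def intro!: power_le_one)
    qed (use assms ex pw U in auto)
    finally show False
      using 1 dr[OF U(1)] dr[OF U(2)] drift_add[of "card V" p "card U" "card W"]
      by (simp add: mult.assoc)
  qed
  have clb: "closed (big M V G)" using reach_subset_big[OF assms(4)] by (auto simp: closed_def)
  have cld: "closed (U - reach G {v})" if "closed U" for U v
    using that reach_single_disjoint[of _ G "{v}"] by (fastforce simp: closed_def)
  have clr: "closed (reach G {v})" if "v \<in> big M V G" for v
    using reach_subset_big[OF assms(4) that] reach_single_eq[of _ G v] by (auto simp: closed_def)
  \<comment> \<open>A macroscopic union of minimal size loses this property when one cluster is
    removed. If that cluster were also below \<open>\<eta> * n\<close>, the union would have fewer
    than \<open>2 * \<eta> * n\<close> vertices, against \<open>gap\<close>; so a single cluster is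
    macroscopic.\<close>
  let ?P = "\<lambda>U. closed U \<and> \<eta> * real n \<le> real (card U)"
  obtain U where U: "?P U" and min: "\<And>W. ?P W \<Longrightarrow> card U \<le> card W"
    using ex_has_least_nat[of ?P "big M V G" card] clb large by auto
  have "U \<noteq> {}" using U assms by (auto simp: mult_le_0_iff)
  then obtain c where c: "c \<in> U" by auto
  then have cb: "c \<in> big M V G" using U by (auto simp: closed_def)
  have rU: "reach G {c} \<subseteq> U" using U c by (auto simp: closed_def)
  have fU: "finite U" using U fin by auto
  have card_eq: "card U = card (U - reach G {c}) + card (reach G {c})"
    using rU fU card_mono[OF fU rU] finite_subset[OF rU fU] by (simp add: card_Diff_subset)
  have "0 < card (reach G {c})"
    using reach_superset[of "{c}" G] finite_subset[OF rU fU] by (auto simp: card_gt_0_iff)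
  then have "\<not> ?P (U - reach G {c})" using min[of "U - reach G {c}"] card_eq by auto
  then have small: "real (card (U - reach G {c})) < \<eta> * real n" using cld U by auto
  have "\<eta> * real n \<le> real (card (reach G {c}))"
  proof (rule ccontr)
    assume "\<not> ?thesis"
    then have "real (card U) < 2 * \<eta> * real n" using card_eq small by simp
    also have "\<dots> \<le> \<theta> * real n" using assms by (intro mult_right_mono) auto
    finally show False using gap U by force
  qed
  then have L: "\<eta> * real n \<le> real (card (reach G {c}))" .
  have "real (card (big M V G - reach G {c})) < \<eta> * real n"
    using two[OF clr[OF cb] cld[OF clb, of c]] L by force
  moreover have "\<theta> * real n \<le> real (card (reach G {c}))" using gap[OF clr[OF cb] L] by simp
  moreover have "c \<in> V" using cb by (simp add: big_def)
  ultimately show ?thesis by blast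
qed

text \<open>\<open>supercritical_giant\<close> presupposes many vertices in big clusters. They come
  from one fixed set \<open>K\<close> of about \<open>\<kappa> * n\<close> seeds: positive drift
  makes it exponentially unlikely that the exploration from \<open>K\<close> stops below
  \<open>\<theta> * n\<close>, and only \<open>M * k\<close> of the vertices reached can lie outside
  big clusters.\<close>

lemma supercritical_whp:
  fixes lam \<theta> \<mu> \<eta> :: real
  assumes "0 < lam" "0 < \<theta>" "0 < \<mu>" "0 < \<eta>" "2 * \<eta> \<le> \<theta>" "\<theta> < \<mu> * (1 - exp (- lam * \<theta>))"
  shows "\<exists>M0. \<forall>M\<ge>M0. \<exists>c>0. \<exists>N. \<forall>n\<ge>N. \<forall>V::nat set. finite V \<and> card V \<le> n \<and> \<mu> * real n \<le> real (card V) \<longrightarrow>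
      rprob (complete_edges V) (lam / real n)
        (\<lambda>G. \<not> (\<exists>c\<in>V. \<theta> * real n \<le> real (card (reach G {c})) \<and>
            real (card (big M V G - reach G {c})) < \<eta> * real n))
      \<le> exp (- c * real n)"
proof -
  define \<psi> where "\<psi> = (\<mu> * (1 - exp (- lam * \<theta>)) - \<theta>) / \<theta>"
  have \<psi>: "0 < \<psi>" using assms by (simp add: \<psi>_def)
  \<comment> \<open>The two bounds required by \<open>supercritical_giant\<close>: the drift at size
    \<open>\<eta> * n\<close>, and a third of the overlap term of two sets of that size.\<close>
  define \<delta> where "\<delta> = min (\<eta> * \<psi>) (\<mu> * (1 - exp (- lam * \<eta>))\<^sup>2 / 3)"
  have "exp (- lam * \<eta>) < 1" using assms by simp
  then have \<delta>: "0 < \<delta>" using assms \<psi> by (simp add: \<delta>_def)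
  have \<delta>1: "\<delta> \<le> \<eta> * \<psi>" "3 * \<delta> \<le> \<mu> * (1 - exp (- lam * \<eta>))\<^sup>2" by (auto simp: \<delta>_def)
  obtain M0 where M0: "\<And>M. M \<ge> M0 \<Longrightarrow> 0 < M \<and> 1 / real M \<le> \<delta> / 2 \<and> (ln (real M) + 1) / real M \<le> \<delta>\<^sup>2 / 4"
    using ex_big_threshold[OF \<delta>] by auto
  show ?thesis
  proof (rule exI[of _ M0], intro allI impI)
    fix M assume M: "M0 \<le> M"
    \<comment> \<open>The first entry lets the seeds fit into \<open>V\<close>; the second keeps
      \<open>M * k\<close> below \<open>\<eta> * n\<close>.\<close>
    define \<kappa> where "\<kappa> = min \<mu> (\<eta> / real M)"
    have \<kappa>: "0 < \<kappa>" "\<kappa> \<le> \<mu>" "real M * \<kappa> \<le> \<eta>"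
      using assms M0[OF M] by (auto simp: \<kappa>_def min_def field_simps)
    define a where "a = min (\<delta>\<^sup>2 / 4) ((\<kappa> * \<psi>)\<^sup>2 / 2)"
    have a: "0 < a" using \<delta> \<kappa> \<psi> by (simp add: a_def)
    obtain N0 where N0: "\<And>n. n \<ge> N0 \<Longrightarrow>
        2 * (real n + 1) * exp (- a * real n) \<le> exp (- (a / 2) * real n)"
      using eventually_poly_exp_le[OF a, of 2] by auto
    show "\<exists>c>0. \<exists>N. \<forall>n\<ge>N. \<forall>V::nat set. finite V \<and> card V \<le> n \<and> \<mu> * real n \<le> real (card V) \<longrightarrow>
      rprob (complete_edges V) (lam / real n)
        (\<lambda>G. \<not> (\<exists>c\<in>V. \<theta> * real n \<le> real (card (reach G {c})) \<and>
            real (card (big M V G - reach G {c})) < \<eta> * real n))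
      \<le> exp (- c * real n)"
    proof (rule exI[of _ "a / 2"], intro conjI, use a in simp,
        rule exI[of _ "max N0 (max (nat \<lceil>lam\<rceil>) (nat \<lceil>2 / \<kappa>\<rceil>))"], intro allI impI, elim conjE)
      fix n and V :: "nat set"
      assume n: "max N0 (max (nat \<lceil>lam\<rceil>) (nat \<lceil>2 / \<kappa>\<rceil>)) \<le> n"
        and V: "finite V" "card V \<le> n" "\<mu> * real n \<le> real (card V)"
      have nl: "lam \<le> real n" "2 / \<kappa> \<le> real n" using n by linarith+
      then have n0: "0 < n" using assms by (auto intro: gr0I)
      have kn: "2 \<le> \<kappa> * real n" using nl \<kappa> by (simp add: field_simps)
      define p where "p = lam / real n"
      have p: "0 \<le> p" "p \<le> 1" using nl n0 assms by (auto simp: p_def)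
      \<comment> \<open>Rounding down loses at most half, because
        \<open>2 \<le> \<kappa> * n\<close>.\<close>
      define k where "k = nat \<lfloor>\<kappa> * real n\<rfloor>"
      have k: "real k \<le> \<kappa> * real n" "\<kappa> * real n / 2 \<le> real k" using kn unfolding k_def by linarith+
      have "real k \<le> real (card V)"
        using k V \<kappa> mult_right_mono[of \<kappa> \<mu> "real n"] by linarith
      then obtain K where K: "K \<subseteq> V" "card K = k" "finite K"
        using obtain_subset_with_card_n[of k V] by auto
      have Mk: "real M * real k \<le> \<eta> * real n"
        using mult_left_mono[OF k(1), of "real M"] mult_right_mono[OF \<kappa>(3), of "real n"]
        by (simp add: mult.assoc)
      define I where "I = {s. s \<le> n \<and> k \<le> s \<and> real s \<le> \<theta> * real n}"
      let ?E = "complete_edges V"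
      let ?bad = "\<lambda>G. \<not> (\<exists>c\<in>V. \<theta> * real n \<le> real (card (reach G {c})) \<and>
            real (card (big M V G - reach G {c})) < \<eta> * real n)"
      have "rprob ?E p ?bad \<le> rprob ?E p (\<lambda>G. irregular M p V (\<delta> * real n) G \<or>
          (\<exists>s\<in>I. card (reach G K) = s))"
      proof (rule rprob_mono[OF p], rule ccontr)
        fix G assume G: "G \<subseteq> ?E" and bad: "?bad G"
          and "\<not> (irregular M p V (\<delta> * real n) G \<or> (\<exists>s\<in>I. card (reach G K) = s))"
        then have reg: "\<not> irregular M p V (\<delta> * real n) G" and nI: "card (reach G K) \<notin> I" by auto
        have fr: "finite (reach G K)" "card (reach G K) \<le> card V"
          using reach_subset[OF G K(1)] V finite_subset card_mono by blast+
        have "k \<le> card (reach G K)"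
          using reach_superset[of K G] fr K card_mono by metis
        then have "\<theta> * real n < real (card (reach G K))" using nI fr V by (auto simp: I_def)
        also have "\<dots> \<le> real (M * k + card (big M V G))"
          using card_reach_le_big[OF V(1) G K(1), of M] K by (simp only: of_nat_le_iff)
        also have "\<dots> \<le> \<eta> * real n + real (card (big M V G))" using Mk by simp
        finally have "(\<theta> - \<eta>) * real n < real (card (big M V G))" by (simp add: algebra_simps)
        moreover have "\<eta> * real n \<le> (\<theta> - \<eta>) * real n" using assms by (intro mult_right_mono) auto
        ultimately have "\<eta> * real n \<le> real (card (big M V G))" by linarith
        then show False
          using supercritical_giant[OF V(1,2) n0 G, of lam \<theta> \<mu> \<eta> \<delta> M] assms nl V \<delta>1 reg bad
          by (simp add: \<psi>_def p_def)
      qed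
      also have "\<dots> \<le> rprob ?E p (irregular M p V (\<delta> * real n)) +
          rprob ?E p (\<lambda>G. \<exists>s\<in>I. card (reach G K) = s)"
        by (rule rprob_or_le[OF p])
      also have "rprob ?E p (irregular M p V (\<delta> * real n)) \<le> (real n + 1) * exp (- (\<delta>\<^sup>2 / 4) * real n)"
        using M0[OF M] V n0 p \<delta> by (intro rprob_irregular_le) auto
      also have "\<dots> \<le> (real n + 1) * exp (- a * real n)"
      proof (intro mult_left_mono)
        have "a * real n \<le> \<delta>\<^sup>2 / 4 * real n" unfolding a_def by (intro mult_right_mono) auto
        then show "exp (- (\<delta>\<^sup>2 / 4) * real n) \<le> exp (- a * real n)" by simp
      qed simp
      also have "rprob ?E p (\<lambda>G. \<exists>s\<in>I. card (reach G K) = s) \<le>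
          (\<Sum>s\<in>I. rprob ?E p (\<lambda>G. card (reach G K) = s))"
        by (rule rprob_union_bound[OF _ p]) (auto simp: I_def)
      also have "\<dots> \<le> (\<Sum>s\<in>I. exp (- a * real n))"
      proof (rule sum_mono)
        fix s assume s: "s \<in> I"
        define m where "m = card V"
        define x where "x = (1 - p) ^ s"
        have m: "0 < m" "m \<le> n"
        proof -
          have "0 < \<mu> * real n" using n0 assms by simp
          then show "0 < m" "m \<le> n" using V by (auto simp: m_def intro!: gr0I)
        qed
        have "0 \<le> x" using p by (simp add: x_def)
        have "\<kappa> * real n / 2 * \<psi> \<le> real s * \<psi>"
          using s k \<psi> by (intro mult_right_mono) (auto simp: I_def)
        also have "\<dots> \<le> drift m p s"
          unfolding p_def \<psi>_def m_def using assms n0 nl V s by (intro drift_ge) (auto simp: I_def)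
        also have "\<dots> \<le> drift m p s + real k * x" using \<open>0 \<le> x\<close> by simp
        finally have "(\<kappa> * real n / 2 * \<psi>)\<^sup>2 \<le> (drift m p s + real k * x)\<^sup>2"
          using \<kappa> \<psi> by (intro power_mono) auto
        then have "2 * (\<kappa> * real n / 2 * \<psi>)\<^sup>2 / real n \<le> 2 * (drift m p s + real k * x)\<^sup>2 / real m"
          using m by (intro frac_le) auto
        moreover have "2 * (\<kappa> * real n / 2 * \<psi>)\<^sup>2 / real n = (\<kappa> * \<psi>)\<^sup>2 / 2 * real n"
          using n0 by (simp add: power2_eq_square field_simps)
        moreover have "a * real n \<le> (\<kappa> * \<psi>)\<^sup>2 / 2 * real n"
          by (intro mult_right_mono) (auto simp: a_def)
        ultimately have le: "- 2 * (drift m p s + real k * x)\<^sup>2 / real m \<le> - a * real n" by simp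
        have "V \<noteq> {}" using m by (auto simp: m_def)
        then have "rprob ?E p (\<lambda>G. card (reach G K) = s) \<le>
            exp (- 2 * (drift m p s + real k * x)\<^sup>2 / real m)"
          using rprob_card_reach_le[of V K p s] V K p by (simp add: drift_def m_def x_def)
        also have "\<dots> \<le> exp (- a * real n)" using le by simp
        finally show "rprob ?E p (\<lambda>G. card (reach G K) = s) \<le> exp (- a * real n)" .
      qed
      also have "\<dots> = real (card I) * exp (- a * real n)" by simp
      also have "\<dots> \<le> (real n + 1) * exp (- a * real n)"
      proof (intro mult_right_mono)
        have "card I \<le> card {..n}" by (intro card_mono) (auto simp: I_def)
        then show "real (card I) \<le> real n + 1" by simp
      qed simp
      also have "(real n + 1) * exp (- a * real n) + (real n + 1) * exp (- a * real n) =
          2 * (real n + 1) * exp (- a * real n)" by simp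
      also have "\<dots> \<le> exp (- (a / 2) * real n)" using N0[of n] n by simp
      finally show "rprob ?E (lam / real n) ?bad \<le> exp (- (a / 2) * real n)" by (simp add: p_def)
    qed
  qed
qed

section \<open>Bottlenecks of reversible chains\<close>

locale reversible_chain =
  fixes \<Omega> :: "'s set" and P :: "'s \<Rightarrow> 's \<Rightarrow> real" and \<pi> :: "'s \<Rightarrow> real"
  assumes finite_states: "finite \<Omega>"
    and \<pi>_pos: "x \<in> \<Omega> \<Longrightarrow> 0 < \<pi> x"
    and \<pi>_sum: "sum \<pi> \<Omega> = 1"
    and P_nonneg: "x \<in> \<Omega> \<Longrightarrow> y \<in> \<Omega> \<Longrightarrow> 0 \<le> P x y"
    and P_sum: "x \<in> \<Omega> \<Longrightarrow> (\<Sum>y\<in>\<Omega>. P x y) = 1"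
    and detailed_balance: "x \<in> \<Omega> \<Longrightarrow> y \<in> \<Omega> \<Longrightarrow> \<pi> x * P x y = \<pi> y * P y x"
begin

lemma stationary: "y \<in> \<Omega> \<Longrightarrow> (\<Sum>x\<in>\<Omega>. \<pi> x * P x y) = \<pi> y"
proof -
  assume y: "y \<in> \<Omega>"
  have "(\<Sum>x\<in>\<Omega>. \<pi> x * P x y) = (\<Sum>x\<in>\<Omega>. \<pi> y * P y x)"
    using y detailed_balance by (intro sum.cong) auto
  also have "\<dots> = \<pi> y" using y by (simp add: P_sum sum_distrib_left[symmetric])
  finally show ?thesis .
qed

lemma finite_subset_states: "A \<subseteq> \<Omega> \<Longrightarrow> finite A"
  using finite_states finite_subset by blast

definition flow :: "'s set \<Rightarrow> 's set \<Rightarrow> real" where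
  "flow A B = (\<Sum>x\<in>A. \<Sum>y\<in>B. \<pi> x * P x y)"

lemma flow_sym:
  assumes "A \<subseteq> \<Omega>" "B \<subseteq> \<Omega>"
  shows "flow A B = flow B A"
proof -
  have "flow A B = (\<Sum>x\<in>A. \<Sum>y\<in>B. \<pi> y * P y x)"
    unfolding flow_def using assms by (intro sum.cong refl detailed_balance) auto
  also have "\<dots> = flow B A" unfolding flow_def by (rule sum.swap)
  finally show ?thesis .
qed

lemma flow_eq: "flow A B = (\<Sum>x\<in>A. \<pi> x * (\<Sum>y\<in>B. P x y))"
  by (simp add: flow_def sum_distrib_left)

lemma flow_le_mass:
  assumes "A \<subseteq> \<Omega>" "\<And>x. x \<in> A \<Longrightarrow> (\<Sum>y\<in>B. P x y) \<le> b"
  shows "flow A B \<le> b * sum \<pi> A"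
proof -
  have "flow A B \<le> (\<Sum>x\<in>A. \<pi> x * b)"
    unfolding flow_eq
    using assms by (intro sum_mono mult_left_mono) (auto intro!: less_imp_le[OF \<pi>_pos])
  then show ?thesis by (simp add: sum_distrib_left mult.commute)
qed

lemma flow_ge_mass:
  assumes "A \<subseteq> \<Omega>" "\<And>x. x \<in> A \<Longrightarrow> b \<le> (\<Sum>y\<in>B. P x y)"
  shows "b * sum \<pi> A \<le> flow A B"
proof -
  have "(\<Sum>x\<in>A. \<pi> x * b) \<le> flow A B"
    unfolding flow_eq
    using assms by (intro sum_mono mult_left_mono) (auto intro!: less_imp_le[OF \<pi>_pos])
  then show ?thesis by (simp add: sum_distrib_left mult.commute)
qed

lemma P_sum_le_1:
  assumes "x \<in> \<Omega>" "B \<subseteq> \<Omega>"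
  shows "(\<Sum>y\<in>B. P x y) \<le> 1"
proof -
  have "(\<Sum>y\<in>B. P x y) \<le> (\<Sum>y\<in>\<Omega>. P x y)"
    using assms finite_states P_nonneg by (intro sum_mono2) auto
  then show ?thesis using P_sum[OF assms(1)] by simp
qed

lemma flow_mono:
  assumes "A \<subseteq> A'" "A' \<subseteq> \<Omega>" "B \<subseteq> B'" "B' \<subseteq> \<Omega>"
  shows "flow A B \<le> flow A' B'"
proof -
  have nn: "0 \<le> \<pi> x * P x y" if "x \<in> \<Omega>" "y \<in> \<Omega>" for x y
    using that P_nonneg less_imp_le[OF \<pi>_pos] by simp
  have "flow A B \<le> flow A B'"
    unfolding flow_def using assms finite_subset_states[of B']
    by (intro sum_mono sum_mono2 nn) auto
  also have "\<dots> \<le> flow A' B'"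
    unfolding flow_def using assms finite_subset_states[of A']
    by (intro sum_mono2 sum_nonneg nn) auto
  finally show ?thesis .
qed

lemma flow_Un_le:
  assumes "A \<subseteq> \<Omega>" "A' \<subseteq> \<Omega>" "B \<subseteq> \<Omega>"
  shows "flow (A \<union> A') B \<le> flow A B + flow A' B"
proof -
  have "flow (A \<union> A') B = flow A B + flow (A' - A) B"
    unfolding flow_def using assms finite_subset_states
    by (subst sum.union_disjoint[symmetric]) (auto intro: finite_subset_states)
  also have "flow (A' - A) B \<le> flow A' B" using assms by (intro flow_mono) auto
  finally show ?thesis by simp
qed

lemma flow_le_sum: "A \<subseteq> \<Omega> \<Longrightarrow> B \<subseteq> \<Omega> \<Longrightarrow> flow A B \<le> sum \<pi> A"
  using flow_le_mass[of A B 1] P_sum_le_1 by auto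

text \<open>The stationary flow from \<open>T\<close> to \<open>I\<close> equals the flow back.
  Hence a set from which \<open>I\<close> is easily entered, but which is rarely entered from
  \<open>I\<close>, has little mass.\<close>

lemma mass_le_of_flow:
  assumes "T \<subseteq> \<Omega>" "I \<subseteq> \<Omega>"
    and "\<And>x. x \<in> T \<Longrightarrow> \<kappa> \<le> (\<Sum>y\<in>I. P x y)"
    and "\<And>x. x \<in> I \<Longrightarrow> (\<Sum>y\<in>T. P x y) \<le> b"
  shows "\<kappa> * sum \<pi> T \<le> b * sum \<pi> I"
  using flow_ge_mass[OF assms(1,3)] flow_le_mass[OF assms(2,4)] flow_sym[OF assms(1,2)] by simp

section \<open>Escape from a bottleneck and the mixing time\<close>

lemma kernel_pow_nonneg:
  "x \<in> \<Omega> \<Longrightarrow> y \<in> \<Omega> \<Longrightarrow> 0 \<le> kernel_pow \<Omega> P t x y"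
  by (induction t arbitrary: y) (auto intro!: sum_nonneg mult_nonneg_nonneg P_nonneg)

lemma kernel_pow_sum: "x \<in> \<Omega> \<Longrightarrow> (\<Sum>y\<in>\<Omega>. kernel_pow \<Omega> P t x y) = 1"
proof (induction t)
  case 0
  then show ?case using finite_states by simp
next
  case (Suc t)
  have "(\<Sum>y\<in>\<Omega>. kernel_pow \<Omega> P (Suc t) x y) =
      (\<Sum>z\<in>\<Omega>. \<Sum>y\<in>\<Omega>. kernel_pow \<Omega> P t x z * P z y)"
    by (simp, rule sum.swap)
  also have "\<dots> = 1" using Suc by (simp add: sum_distrib_left[symmetric] P_sum)
  finally show ?case .
qed

lemma kernel_pow_stationary:
  "y \<in> \<Omega> \<Longrightarrow> (\<Sum>x\<in>\<Omega>. \<pi> x * kernel_pow \<Omega> P t x y) = \<pi> y"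
proof (induction t arbitrary: y)
  case 0
  then show ?case using finite_states by (simp add: if_distrib[of "\<lambda>u. \<pi> _ * u"] cong: if_cong)
next
  case (Suc t)
  have "(\<Sum>x\<in>\<Omega>. \<pi> x * kernel_pow \<Omega> P (Suc t) x y) =
      (\<Sum>z\<in>\<Omega>. \<Sum>x\<in>\<Omega>. \<pi> x * kernel_pow \<Omega> P t x z * P z y)"
    by (simp add: sum_distrib_left mult.assoc, rule sum.swap)
  also have "\<dots> = (\<Sum>z\<in>\<Omega>. \<pi> z * P z y)" by (simp add: sum_distrib_right[symmetric] Suc)
  also have "\<dots> = \<pi> y" using stationary Suc.prems .
  finally show ?case .
qed

text \<open>Start from \<open>\<pi>\<close> restricted to \<open>A\<close>. By stationarity the
  evolved measure stays below \<open>\<pi>\<close> pointwise, so each step carries at most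
  \<open>flow A (\<Omega> - A)\<close> out of \<open>A\<close>.\<close>

lemma retained_mass:
  assumes "A \<subseteq> \<Omega>"
  shows "sum \<pi> A - real t * flow A (\<Omega> - A) \<le> (\<Sum>x\<in>A. \<Sum>y\<in>A. \<pi> x * kernel_pow \<Omega> P t x y)"
proof (induction t)
  case 0
  have "(\<Sum>x\<in>A. \<Sum>y\<in>A. \<pi> x * kernel_pow \<Omega> P 0 x y) = sum \<pi> A"
    using finite_subset_states[OF assms]
    by (auto intro!: sum.cong simp: if_distrib[of "\<lambda>u. \<pi> _ * u"] cong: if_cong)
  then show ?case by simp
next
  case (Suc t)
  define \<mu> where "\<mu> = (\<lambda>y. \<Sum>x\<in>A. \<pi> x * kernel_pow \<Omega> P t x y)"
  have \<mu>: "0 \<le> \<mu> y" "\<mu> y \<le> \<pi> y" if "y \<in> \<Omega>" for y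
  proof -
    show "0 \<le> \<mu> y"
      using that assms unfolding \<mu>_def
      by (intro sum_nonneg mult_nonneg_nonneg kernel_pow_nonneg less_imp_le[OF \<pi>_pos]) auto
    have "\<mu> y \<le> (\<Sum>x\<in>\<Omega>. \<pi> x * kernel_pow \<Omega> P t x y)"
      using that assms finite_states unfolding \<mu>_def
      by (intro sum_mono2 mult_nonneg_nonneg kernel_pow_nonneg less_imp_le[OF \<pi>_pos]) auto
    then show "\<mu> y \<le> \<pi> y" using kernel_pow_stationary[OF that] by simp
  qed
  have "sum \<pi> A - real t * flow A (\<Omega> - A) \<le> (\<Sum>z\<in>A. \<mu> z)"
    using Suc unfolding \<mu>_def by (subst sum.swap) 
  also have "\<dots> = (\<Sum>z\<in>A. \<mu> z * ((\<Sum>y\<in>A. P z y) + (\<Sum>y\<in>\<Omega> - A. P z y)))"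
  proof (rule sum.cong[OF refl])
    fix z assume z: "z \<in> A"
    have "(\<Sum>y\<in>A. P z y) + (\<Sum>y\<in>\<Omega> - A. P z y) = 1"
      using P_sum[of z] z assms finite_states sum.subset_diff[of A \<Omega> "P z"] by auto
    then show "\<mu> z = \<mu> z * ((\<Sum>y\<in>A. P z y) + (\<Sum>y\<in>\<Omega> - A. P z y))" by simp
  qed
  also have "\<dots> = (\<Sum>z\<in>A. \<Sum>y\<in>A. \<mu> z * P z y) + (\<Sum>z\<in>A. \<mu> z * (\<Sum>y\<in>\<Omega> - A. P z y))"
    by (simp add: distrib_left sum.distrib sum_distrib_left)
  also have "(\<Sum>z\<in>A. \<mu> z * (\<Sum>y\<in>\<Omega> - A. P z y)) \<le> flow A (\<Omega> - A)"
    unfolding flow_eq using assms \<mu> by (intro sum_mono mult_right_mono sum_nonneg P_nonneg) auto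
  also have "(\<Sum>z\<in>A. \<Sum>y\<in>A. \<mu> z * P z y) \<le> (\<Sum>x\<in>A. \<Sum>y\<in>A. \<pi> x * kernel_pow \<Omega> P (Suc t) x y)"
  proof -
    have "(\<Sum>z\<in>A. \<Sum>y\<in>A. \<mu> z * P z y) = (\<Sum>y\<in>A. \<Sum>z\<in>A. \<mu> z * P z y)" by (rule sum.swap)
    also have "\<dots> \<le> (\<Sum>y\<in>A. \<Sum>z\<in>\<Omega>. \<mu> z * P z y)"
      using assms finite_states \<mu> by (intro sum_mono sum_mono2 mult_nonneg_nonneg P_nonneg) auto
    also have "\<dots> = (\<Sum>y\<in>A. \<Sum>x\<in>A. \<pi> x * kernel_pow \<Omega> P (Suc t) x y)"
      unfolding \<mu>_def sum_distrib_right
      by (subst sum.swap[of _ A \<Omega>]) (simp add: sum_distrib_left mult.assoc)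
    also have "\<dots> = (\<Sum>x\<in>A. \<Sum>y\<in>A. \<pi> x * kernel_pow \<Omega> P (Suc t) x y)" by (rule sum.swap)
    finally show ?thesis .
  qed
  finally show ?case by (simp add: algebra_simps)
qed

text \<open>Both measures have mass 1, so the excess on \<open>A\<close> equals the deficit on the
  complement, and each is counted in the \<open>\<bar>_\<bar>\<close>-sum.\<close>

lemma tv_dist_ge:
  assumes "A \<subseteq> \<Omega>" "x \<in> \<Omega>"
  shows "(\<Sum>y\<in>A. kernel_pow \<Omega> P t x y) - sum \<pi> A \<le> tv_dist \<Omega> (kernel_pow \<Omega> P t x) \<pi>"
proof -
  let ?d = "\<lambda>y. kernel_pow \<Omega> P t x y - \<pi> y"
  have "sum ?d A + sum ?d (\<Omega> - A) = 0"
    using sum.subset_diff[OF assms(1) finite_states, of ?d] kernel_pow_sum[OF assms(2), of t] \<pi>_sum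
    by (simp add: sum_subtractf)
  moreover have "sum ?d A \<le> (\<Sum>y\<in>A. \<bar>?d y\<bar>)" "- sum ?d (\<Omega> - A) \<le> (\<Sum>y\<in>\<Omega> - A. \<bar>?d y\<bar>)"
    using sum_abs[of ?d A] sum_abs[of ?d "\<Omega> - A"] by linarith+
  moreover have "(\<Sum>y\<in>\<Omega>. \<bar>?d y\<bar>) = (\<Sum>y\<in>\<Omega> - A. \<bar>?d y\<bar>) + (\<Sum>y\<in>A. \<bar>?d y\<bar>)"
    by (rule sum.subset_diff[OF assms(1) finite_states])
  ultimately show ?thesis by (simp add: tv_dist_def sum_subtractf)
qed

text \<open>As \<open>1 / (2 * exp 1) \<le> 1 / 4\<close>, mixing at time \<open>t\<close> leaves
  each start in \<open>A\<close> with probability at most \<open>1 / 4 + 1 / 2\<close> of being in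
  \<open>A\<close>. By \<open>retained_mass\<close> the average over \<open>A\<close> is at least
  \<open>1 - t * b\<close>.\<close>

lemma mixing_time_ge:
  assumes A: "A \<subseteq> \<Omega>" "A \<noteq> {}" "sum \<pi> A \<le> 1 / 2"
    and b: "0 < b" "flow A (\<Omega> - A) \<le> b * sum \<pi> A"
  shows "ereal (1 / (4 * b)) \<le> mixing_time \<Omega> P \<pi>"
  unfolding mixing_time_def
proof (rule Inf_greatest, clarify)
  fix t assume t: "\<forall>x\<in>\<Omega>. tv_dist \<Omega> (kernel_pow \<Omega> P t x) \<pi> < 1 / (2 * exp 1)"
  have pos: "0 < sum \<pi> A"
    using A \<pi>_pos finite_subset_states by (intro sum_pos) auto
  have "2 \<le> exp (1::real)" using exp_ge_add_one_self[of 1] by simp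
  then have e: "1 / (2 * exp 1) \<le> (1 / 4 :: real)" by (simp add: divide_simps)
  have "sum \<pi> A - real t * (b * sum \<pi> A) \<le> sum \<pi> A - real t * flow A (\<Omega> - A)"
    using b by (simp add: mult_left_mono)
  also have "\<dots> \<le> (\<Sum>x\<in>A. \<pi> x * (\<Sum>y\<in>A. kernel_pow \<Omega> P t x y))"
    using retained_mass[OF A(1)] by (simp add: sum_distrib_left)
  also have "\<dots> \<le> (\<Sum>x\<in>A. \<pi> x * (1 / 4 + 1 / 2))"
  proof (intro sum_mono mult_left_mono)
    fix x assume x: "x \<in> A"
    then have x\<Omega>: "x \<in> \<Omega>" using A by auto
    show "(\<Sum>y\<in>A. kernel_pow \<Omega> P t x y) \<le> 1 / 4 + 1 / 2"
      using tv_dist_ge[OF A(1) x\<Omega>, of t] bspec[OF t x\<Omega>] e A(3) by linarith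
    show "0 \<le> \<pi> x" using \<pi>_pos[OF x\<Omega>] by simp
  qed
  also have "\<dots> = 3 / 4 * sum \<pi> A"
    by (simp only: sum_distrib_right[symmetric]) simp
  finally have "sum \<pi> A * (1 / 4) \<le> sum \<pi> A * (real t * b)" by (simp add: algebra_simps)
  then have "1 / 4 \<le> real t * b" using pos by simp
  then show "ereal (1 / (4 * b)) \<le> ereal (real t)" using b by (simp add: field_simps)
qed

end

section \<open>The FK measure and reversibility of the Glauber dynamics\<close>

lemma finite_configs [simp]: "finite (configs n)"
  by (simp add: configs_def edges_Kn_eq)

lemma configs_eq: "configs n = Pow (complete_edges {..<n})"
  by (simp add: configs_def edges_Kn_eq)

lemma fk_weight_eq:
  assumes "\<omega> \<in> configs n"
  shows "fk_weight n lam q \<omega> = rset (complete_edges {..<n}) (lam / real n) \<omega> * q ^ num_clusters n \<omega>"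
proof -
  have "\<omega> \<subseteq> complete_edges {..<n}" using assms by (simp add: configs_eq)
  moreover from this have "finite \<omega>" by (rule finite_subset) simp
  ultimately show ?thesis
    by (simp add: fk_weight_def Let_def rset_def edges_Kn_eq card_Diff_subset)
qed

lemma fk_weight_pos:
  assumes "0 < lam" "lam < real n" "0 < q"
  shows "0 < fk_weight n lam q \<omega>"
  using assms by (simp add: fk_weight_def Let_def divide_less_eq_1)

lemma fk_measure_pos:
  assumes "0 < lam" "lam < real n" "0 < q"
  shows "0 < fk_measure n lam q \<omega>"
proof -
  have "{} \<in> configs n" by (simp add: configs_def)
  then show ?thesis
    unfolding fk_measure_def using assms by (intro divide_pos_pos sum_pos fk_weight_pos) auto
qed

lemma fk_measure_sum:
  assumes "0 < lam" "lam < real n" "0 < q"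
  shows "sum (fk_measure n lam q) (configs n) = 1"
proof -
  have "{} \<in> configs n" by (simp add: configs_def)
  then have "0 < (\<Sum>\<eta>\<in>configs n. fk_weight n lam q \<eta>)"
    using assms by (intro sum_pos fk_weight_pos) auto
  then show ?thesis by (simp add: fk_measure_def sum_divide_distrib[symmetric])
qed

lemma glauber_reversible:
  assumes "0 < lam" "lam < real n" "0 < q" "2 \<le> n"
  shows "reversible_chain (configs n) (glauber_kernel n lam q) (fk_measure n lam q)"
proof
  let ?w = "fk_weight n lam q"
  have wpos: "0 < ?w \<omega>" for \<omega> using assms by (intro fk_weight_pos)
  have "{0, 1} \<in> edges_Kn n" using assms by (auto simp: edges_Kn_eq pair_in_complete_edges)
  then have E0: "0 < card (edges_Kn n)" by (auto simp: card_gt_0_iff edges_Kn_eq)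
  show "0 \<le> glauber_kernel n lam q x y" for x y
    unfolding glauber_kernel_def using less_imp_le[OF wpos]
    by (intro sum_nonneg mult_nonneg_nonneg) auto
  show "(\<Sum>y\<in>configs n. glauber_kernel n lam q x y) = 1" if x: "x \<in> configs n" for x
  proof -
    have "(\<Sum>y\<in>configs n. if y - {e} = x - {e} then ?w y / (?w (x - {e}) + ?w (insert e x)) else 0) = 1"
      if e: "e \<in> edges_Kn n" for e
    proof -
      have "(\<Sum>y\<in>configs n. if y - {e} = x - {e} then ?w y / (?w (x - {e}) + ?w (insert e x)) else 0) =
          (\<Sum>y\<in>{x - {e}, insert e x}. if y - {e} = x - {e} then ?w y / (?w (x - {e}) + ?w (insert e x)) else 0)"
      proof (rule sum.mono_neutral_right)
        show "{x - {e}, insert e x} \<subseteq> configs n" using x e by (auto simp: configs_def)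
        show "\<forall>y\<in>configs n - {x - {e}, insert e x}.
            (if y - {e} = x - {e} then ?w y / (?w (x - {e}) + ?w (insert e x)) else 0) = 0"
        proof
          fix y assume y: "y \<in> configs n - {x - {e}, insert e x}"
          have "y - {e} \<noteq> x - {e}"
          proof
            assume "y - {e} = x - {e}"
            then have "y = x - {e} \<or> y = insert e x" by blast
            then show False using y by simp
          qed
          then show "(if y - {e} = x - {e} then ?w y / (?w (x - {e}) + ?w (insert e x)) else 0) = 0"
            by simp
        qed
      qed simp
      also have "\<dots> = ?w (x - {e}) / (?w (x - {e}) + ?w (insert e x)) +
          ?w (insert e x) / (?w (x - {e}) + ?w (insert e x))"
        by (subst sum.insert) auto
      also have "\<dots> = 1"
        using wpos[of "x - {e}"] wpos[of "insert e x"] by (simp add: add_divide_distrib[symmetric])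
      finally show ?thesis .
    qed
    then have "(\<Sum>e\<in>edges_Kn n. \<Sum>y\<in>configs n. 1 / real (card (edges_Kn n)) *
        (if y - {e} = x - {e} then ?w y / (?w (x - {e}) + ?w (insert e x)) else 0)) = 1"
      using E0 by (simp only: sum_distrib_left[symmetric]) simp
    then show ?thesis unfolding glauber_kernel_def by (subst sum.swap)
  qed
  show "fk_measure n lam q x * glauber_kernel n lam q x y =
      fk_measure n lam q y * glauber_kernel n lam q y x" for x y
    unfolding glauber_kernel_def sum_distrib_left
  proof (rule sum.cong[OF refl])
    fix e
    \<comment> \<open>Detailed balance holds edge by edge: both states have the same two
      alternatives at \<open>e\<close> and hence the same normalisation.\<close>
    have "x - {e} = y - {e} \<Longrightarrow> insert e x = insert e y" by blast
    then show "fk_measure n lam q x * (1 / real (card (edges_Kn n)) *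
         (if y - {e} = x - {e} then ?w y / (?w (x - {e}) + ?w (insert e x)) else 0)) =
       fk_measure n lam q y * (1 / real (card (edges_Kn n)) *
         (if x - {e} = y - {e} then ?w x / (?w (y - {e}) + ?w (insert e y)) else 0))"
      by (auto simp: fk_measure_def)
  qed
qed (use assms fk_measure_pos fk_measure_sum in auto)

section \<open>Clusters and reversibility of the Chayes--Machta dynamics\<close>

lemma clusters_eq: "clusters n \<omega> = (\<lambda>v. reach \<omega> {v}) ` {..<n}"
  by (auto simp: clusters_def quotient_def reach_def)

lemma finite_clusters [simp]: "finite (clusters n \<omega>)"
  by (simp add: clusters_eq)

lemma clusters_subset: "\<omega> \<in> configs n \<Longrightarrow> C \<in> clusters n \<omega> \<Longrightarrow> C \<subseteq> {..<n}"
proof -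
  assume "\<omega> \<in> configs n" "C \<in> clusters n \<omega>"
  then obtain v where "\<omega> \<subseteq> complete_edges {..<n}" "v < n" "C = reach \<omega> {v}"
    by (auto simp: clusters_eq configs_eq)
  then show ?thesis using reach_subset[of \<omega> "{..<n}" "{v}"] by simp
qed

lemma clusters_disjoint:
  assumes "C \<in> clusters n \<omega>" "D \<in> clusters n \<omega>" "C \<noteq> D"
  shows "C \<inter> D = {}"
proof -
  obtain v w where "C = reach \<omega> {v}" "D = reach \<omega> {w}" using assms by (auto simp: clusters_eq)
  then show ?thesis using assms(3) reach_single_disjoint[of v \<omega> "{w}"] reach_single_eq[of v \<omega> w] by auto
qed

lemma cluster_eq_reach: "C \<in> clusters n \<omega> \<Longrightarrow> v \<in> C \<Longrightarrow> C = reach \<omega> {v}"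
  using reach_single_eq by (auto simp: clusters_eq)

lemma reach_in_clusters: "v < n \<Longrightarrow> reach \<omega> {v} \<in> clusters n \<omega>"
  by (auto simp: clusters_eq)

lemma reach_Union_clusters: "S \<subseteq> clusters n \<omega> \<Longrightarrow> reach \<omega> (\<Union>S) = \<Union>S"
proof -
  assume S: "S \<subseteq> clusters n \<omega>"
  have "reach \<omega> (\<Union>S) = (\<Union>v\<in>\<Union>S. reach \<omega> {v})" by (rule reach_eq_UN)
  also have "\<dots> \<subseteq> \<Union>S" using S cluster_eq_reach by fastforce
  finally show ?thesis using reach_superset by blast
qed

lemma Union_clusters_subset: "\<omega> \<in> configs n \<Longrightarrow> S \<subseteq> clusters n \<omega> \<Longrightarrow> \<Union>S \<subseteq> {..<n}"
  using clusters_subset by blast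

text \<open>Families of active clusters are encoded by their vertex sets. An active vertex set makes
  sense for \<open>\<omega>\<close> and for its update alike, whereas the clusters inside it
  change.\<close>

lemma bij_betw_clusters:
  assumes "\<omega> \<in> configs n"
  shows "bij_betw Union (Pow (clusters n \<omega>)) {V. V \<subseteq> {..<n} \<and> reach \<omega> V \<subseteq> V}"
proof (rule bij_betw_byWitness[where f' = "\<lambda>V. (\<lambda>v. reach \<omega> {v}) ` V"])
  show "\<forall>S\<in>Pow (clusters n \<omega>). (\<lambda>v. reach \<omega> {v}) ` \<Union>S = S"
  proof (intro ballI equalityI subsetI)
    fix S C assume S: "S \<in> Pow (clusters n \<omega>)"
    {
      assume "C \<in> (\<lambda>v. reach \<omega> {v}) ` \<Union>S"
      then obtain v D where "v \<in> D" "D \<in> S" "C = reach \<omega> {v}" by auto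
      then show "C \<in> S" using cluster_eq_reach[of D n \<omega> v] S by auto
    next
      assume C: "C \<in> S"
      then obtain v where v: "v < n" "C = reach \<omega> {v}" using S by (auto simp: clusters_eq)
      then have "v \<in> C" using reach_superset[of "{v}" \<omega>] by auto
      then show "C \<in> (\<lambda>v. reach \<omega> {v}) ` \<Union>S" using v C by blast
    }
  qed
  show "\<forall>V\<in>{V. V \<subseteq> {..<n} \<and> reach \<omega> V \<subseteq> V}. \<Union> ((\<lambda>v. reach \<omega> {v}) ` V) = V"
  proof
    fix V assume "V \<in> {V. V \<subseteq> {..<n} \<and> reach \<omega> V \<subseteq> V}"
    then show "\<Union> ((\<lambda>v. reach \<omega> {v}) ` V) = V"
      using reach_eq_UN[of \<omega> V] reach_superset[of V \<omega>] by auto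
  qed
  show "\<Union> ` Pow (clusters n \<omega>) \<subseteq> {V. V \<subseteq> {..<n} \<and> reach \<omega> V \<subseteq> V}"
    using Union_clusters_subset[OF assms] reach_Union_clusters by fastforce
  show "(\<lambda>V. (\<lambda>v. reach \<omega> {v}) ` V) ` {V. V \<subseteq> {..<n} \<and> reach \<omega> V \<subseteq> V} \<subseteq> Pow (clusters n \<omega>)"
    by (auto simp: clusters_eq)
qed

lemma cm_kernel_eq:
  assumes "\<omega> \<in> configs n"
  shows "cm_kernel n lam q \<omega> \<omega>' = rexp (clusters n \<omega>) (1 / q) (\<lambda>S.
     if \<omega>' - complete_edges (\<Union>S) = \<omega> - complete_edges (\<Union>S)
     then rset (complete_edges (\<Union>S)) (lam / real n) (\<omega>' \<inter> complete_edges (\<Union>S)) else 0)"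
  unfolding cm_kernel_def rexp_def Let_def
proof (rule sum.cong[OF refl])
  fix S assume S: "S \<in> Pow (clusters n \<omega>)"
  define V where "V = \<Union>S"
  have V: "V \<subseteq> {..<n}" using Union_clusters_subset[OF assms] S by (auto simp: V_def)
  have EA: "{e \<in> edges_Kn n. e \<subseteq> V} = complete_edges V"
    unfolding edges_Kn_eq by (rule complete_edges_restrict[OF V])
  have fS: "finite S" using S finite_subset[OF _ finite_clusters] by auto
  have "finite (complete_edges V)" using V finite_subset by (intro finite_complete_edges) auto
  then have "card (complete_edges V - \<omega>' \<inter> complete_edges V) =
      card (complete_edges V) - card (\<omega>' \<inter> complete_edges V)"
    by (intro card_Diff_subset) auto
  then show "(1 / q) ^ card S * (1 - 1 / q) ^ (card (clusters n \<omega>) - card S) *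
         (if \<omega>' - {e \<in> edges_Kn n. e \<subseteq> \<Union>S} = \<omega> - {e \<in> edges_Kn n. e \<subseteq> \<Union>S}
          then (lam / real n) ^ card (\<omega>' \<inter> {e \<in> edges_Kn n. e \<subseteq> \<Union>S}) *
               (1 - lam / real n) ^
               (card {e \<in> edges_Kn n. e \<subseteq> \<Union>S} - card (\<omega>' \<inter> {e \<in> edges_Kn n. e \<subseteq> \<Union>S}))
          else 0) =
         rset (clusters n \<omega>) (1 / q) S *
         (if \<omega>' - complete_edges (\<Union>S) = \<omega> - complete_edges (\<Union>S)
          then rset (complete_edges (\<Union>S)) (lam / real n) (\<omega>' \<inter> complete_edges (\<Union>S)) else 0)"
    using S fS unfolding V_def[symmetric] EA by (simp add: rset_def card_Diff_subset)
qed

text \<open>The kernel as a two-stage average: first over the active clusters, then over a fresh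
  random graph on their vertices.\<close>

lemma cm_expectation:
  assumes "\<omega> \<in> configs n"
  shows "(\<Sum>\<omega>'\<in>configs n. cm_kernel n lam q \<omega> \<omega>' * f \<omega>') =
    rexp (clusters n \<omega>) (1 / q) (\<lambda>S. rexp (complete_edges (\<Union>S)) (lam / real n)
      (\<lambda>G. f ((\<omega> - complete_edges (\<Union>S)) \<union> G)))"
proof -
  define g where "g = (\<lambda>S \<omega>'. if \<omega>' - complete_edges (\<Union>S) = \<omega> - complete_edges (\<Union>S)
     then rset (complete_edges (\<Union>S)) (lam / real n) (\<omega>' \<inter> complete_edges (\<Union>S)) else 0)"
  have "(\<Sum>\<omega>'\<in>configs n. cm_kernel n lam q \<omega> \<omega>' * f \<omega>') =
      (\<Sum>\<omega>'\<in>configs n. rexp (clusters n \<omega>) (1 / q) (\<lambda>S. g S \<omega>' * f \<omega>'))"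
    unfolding cm_kernel_eq[OF assms] g_def
    by (simp add: mult.commute[of _ "f _"] rexp_cmult[symmetric])
  also have "\<dots> = rexp (clusters n \<omega>) (1 / q) (\<lambda>S. \<Sum>\<omega>'\<in>configs n. g S \<omega>' * f \<omega>')"
    by (rule rexp_sum[symmetric])
  also have "\<dots> = rexp (clusters n \<omega>) (1 / q) (\<lambda>S. rexp (complete_edges (\<Union>S)) (lam / real n)
      (\<lambda>G. f ((\<omega> - complete_edges (\<Union>S)) \<union> G)))"
  proof (rule rexp_cong[OF refl])
    fix S assume S: "S \<subseteq> clusters n \<omega>"
    define E where "E = complete_edges (\<Union>S)"
    have E: "E \<subseteq> complete_edges {..<n}"
      unfolding E_def using Union_clusters_subset[OF assms S] by (rule complete_edges_mono)
    have bij: "bij_betw (\<lambda>G. (\<omega> - E) \<union> G) (Pow E) {\<omega>' \<in> configs n. \<omega>' - E = \<omega> - E}"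
      by (rule bij_betw_byWitness[where f' = "\<lambda>\<omega>'. \<omega>' \<inter> E"])
        (use E assms in \<open>auto simp: configs_eq\<close>)
    have "(\<Sum>\<omega>'\<in>configs n. g S \<omega>' * f \<omega>') =
        (\<Sum>\<omega>'\<in>{\<omega>' \<in> configs n. \<omega>' - E = \<omega> - E}. g S \<omega>' * f \<omega>')"
      by (rule sum.mono_neutral_right) (auto simp: g_def E_def)
    also have "\<dots> = (\<Sum>G\<in>Pow E. g S ((\<omega> - E) \<union> G) * f ((\<omega> - E) \<union> G))"
      by (rule sum.reindex_bij_betw[OF bij, symmetric])
    also have "\<dots> = rexp E (lam / real n) (\<lambda>G. f ((\<omega> - E) \<union> G))"
      unfolding rexp_def
    proof (rule sum.cong[OF refl])
      fix G assume G: "G \<in> Pow E"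
      then have "((\<omega> - E) \<union> G) - E = \<omega> - E" "((\<omega> - E) \<union> G) \<inter> E = G" by auto
      then show "g S ((\<omega> - E) \<union> G) * f ((\<omega> - E) \<union> G) = rset E (lam / real n) G * f ((\<omega> - E) \<union> G)"
        unfolding g_def E_def[symmetric] by simp
    qed
    finally show "(\<Sum>\<omega>'\<in>configs n. g S \<omega>' * f \<omega>') = rexp (complete_edges (\<Union>S)) (lam / real n)
      (\<lambda>G. f ((\<omega> - complete_edges (\<Union>S)) \<union> G))" by (simp add: E_def)
  qed
  finally show ?thesis .
qed

lemma reach_outside:
  assumes "reach \<omega> V \<subseteq> V" "\<omega>' - complete_edges V = \<omega> - complete_edges V" "v \<notin> V"
  shows "reach \<omega>' {v} \<subseteq> reach \<omega> {v}"
proof (rule reach_least)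
  show "{v} \<subseteq> reach \<omega> {v}" by (rule reach_superset)
  have "v \<notin> reach \<omega> V" using assms by auto
  then have disj: "reach \<omega> {v} \<inter> V = {}"
    using reach_single_disjoint[of v \<omega> V] reach_superset[of V \<omega>] by blast
  fix a b assume a: "a \<in> reach \<omega> {v}" and ab: "{a, b} \<in> \<omega>'"
  then have "{a, b} \<notin> complete_edges V" using disj by (auto simp: pair_in_complete_edges)
  then have "{a, b} \<in> \<omega>" using ab assms(2) by blast
  then show "b \<in> reach \<omega> {v}" using a reach_closed by blast
qed

text \<open>An edge leaving \<open>V\<close> is not in \<open>complete_edges V\<close>, so the two
  configurations agree on it. Being a union of clusters is thus preserved by the update, which makes
  the roles of \<open>\<omega>\<close> and \<open>\<omega>'\<close> symmetric.\<close>

lemma reach_closed_transfer: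
  assumes "reach \<omega> V \<subseteq> V" "\<omega>' - complete_edges V = \<omega> - complete_edges V"
  shows "reach \<omega>' V \<subseteq> V"
proof (rule reach_least)
  fix a b assume a: "a \<in> V" "{a, b} \<in> \<omega>'"
  show "b \<in> V"
  proof (cases "{a, b} \<in> complete_edges V")
    case False
    then have "{a, b} \<in> \<omega>" using a assms(2) by blast
    then show ?thesis using a assms(1) reach_closed[of a \<omega> V b] reach_superset[of V \<omega>] by blast
  qed (auto simp: pair_in_complete_edges)
qed simp

lemma reach_outside_eq:
  assumes "reach \<omega> V \<subseteq> V" "\<omega>' - complete_edges V = \<omega> - complete_edges V" "v \<notin> V"
  shows "reach \<omega>' {v} = reach \<omega> {v}"
  using reach_outside[OF assms] reach_outside[of \<omega>' V \<omega> v] reach_closed_transfer[OF assms(1,2)] assms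
  by auto

lemma reach_inside_eq:
  assumes "reach \<omega>' V \<subseteq> V" "\<omega>' \<subseteq> complete_edges W" "v \<in> V"
  shows "reach \<omega>' {v} = reach (\<omega>' \<inter> complete_edges V) {v}"
proof
  let ?G = "\<omega>' \<inter> complete_edges V"
  show "reach \<omega>' {v} \<subseteq> reach ?G {v}"
  proof (rule reach_least)
    show "{v} \<subseteq> reach ?G {v}" by (rule reach_superset)
    fix a b assume a: "a \<in> reach ?G {v}" and ab: "{a, b} \<in> \<omega>'"
    have aV: "a \<in> V" using a reach_subset[of ?G V "{v}"] assms by auto
    then have "b \<in> V" using ab assms(1) reach_closed[of a \<omega>' V b] reach_superset[of V \<omega>'] by blast
    moreover have "a \<noteq> b" using ab assms(2) pair_in_complete_edges[of a b W] by auto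
    ultimately have "{a, b} \<in> ?G" using ab aV by (simp add: pair_in_complete_edges)
    then show "b \<in> reach ?G {v}" using a reach_closed by blast
  qed
qed (intro reach_mono, auto)

text \<open>Summing over the active vertex set \<open>V\<close> turns the factor \<open>q ^ num_clusters n \<omega>\<close> into
  \<open>q - 1\<close> per inactive cluster, and inactive clusters survive the update.\<close>
lemma fk_weight_cm_kernel:
  assumes "\<omega> \<in> configs n" "\<omega>' \<in> configs n" "1 < q"
  shows "fk_weight n lam q \<omega> * cm_kernel n lam q \<omega> \<omega>' =
    (\<Sum>V\<in>Pow {..<n}. of_bool (reach \<omega> V \<subseteq> V \<and> \<omega>' - complete_edges V = \<omega> - complete_edges V) *
      ((q - 1) ^ card ((\<lambda>v. reach \<omega> {v}) ` ({..<n} - V)) *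
       (rset (complete_edges {..<n} - complete_edges V) (lam / real n) (\<omega> - complete_edges V) *
        (rset (complete_edges V) (lam / real n) (\<omega> \<inter> complete_edges V) *
         rset (complete_edges V) (lam / real n) (\<omega>' \<inter> complete_edges V)))))"
proof -
  define p where "p = lam / real n"
  define E where "E = complete_edges {..<n}"
  define h where "h = (\<lambda>V. of_bool (\<omega>' - complete_edges V = \<omega> - complete_edges V) *
      ((q - 1) ^ card ((\<lambda>v. reach \<omega> {v}) ` ({..<n} - V)) *
       (rset (E - complete_edges V) p (\<omega> - complete_edges V) *
        (rset (complete_edges V) p (\<omega> \<inter> complete_edges V) *
         rset (complete_edges V) p (\<omega>' \<inter> complete_edges V)))))"
  have \<omega>: "\<omega> \<subseteq> E" using assms by (simp add: configs_eq E_def)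
  have fE: "finite E" by (simp add: E_def)
  have split: "rset E p \<omega> = rset (E - F) p (\<omega> - F) * rset F p (\<omega> \<inter> F)" if F: "F \<subseteq> E" for F
  proof -
    have fin: "finite \<omega>" "finite F" using \<omega> F fE finite_subset by blast+
    have "card \<omega> = card (\<omega> - F) + card (\<omega> \<inter> F)"
      using card_Int_Diff[of \<omega> F] fin by simp
    moreover have "card (E - \<omega>) = card ((E - F) - (\<omega> - F)) + card (F - \<omega> \<inter> F)"
    proof -
      have "E - \<omega> = ((E - F) - (\<omega> - F)) \<union> (F - \<omega> \<inter> F)" using F by auto
      then show ?thesis using card_Un_disjoint[of "(E - F) - (\<omega> - F)" "F - \<omega> \<inter> F"] fin fE by auto
    qed
    ultimately show ?thesis by (simp add: rset_def power_add)
  qed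
  have "fk_weight n lam q \<omega> * cm_kernel n lam q \<omega> \<omega>' = (\<Sum>S\<in>Pow (clusters n \<omega>). h (\<Union>S))"
    unfolding cm_kernel_eq[OF assms(1)] rexp_def sum_distrib_left fk_weight_eq[OF assms(1)]
      p_def[symmetric] E_def[symmetric]
  proof (rule sum.cong[OF refl])
    fix S assume "S \<in> Pow (clusters n \<omega>)"
    then have S: "S \<subseteq> clusters n \<omega>" by simp
    define V where "V = \<Union>S"
    have V: "V \<subseteq> {..<n}" using Union_clusters_subset[OF assms(1) S] by (simp add: V_def)
    have F: "complete_edges V \<subseteq> E" unfolding E_def using V by (rule complete_edges_mono)
    have fS: "finite S" using S finite_subset[OF _ finite_clusters] by auto
    have inact: "(\<lambda>v. reach \<omega> {v}) ` ({..<n} - V) = clusters n \<omega> - S"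
    proof (intro equalityI subsetI)
      fix C assume "C \<in> (\<lambda>v. reach \<omega> {v}) ` ({..<n} - V)"
      then obtain v where v: "v < n" "v \<notin> V" "C = reach \<omega> {v}" by auto
      then have "v \<in> C" using reach_superset[of "{v}" \<omega>] by auto
      then show "C \<in> clusters n \<omega> - S" using v by (auto simp: V_def reach_in_clusters)
    next
      fix C assume C: "C \<in> clusters n \<omega> - S"
      then obtain v where v: "v < n" "C = reach \<omega> {v}" by (auto simp: clusters_eq)
      then have vC: "v \<in> C" using reach_superset[of "{v}" \<omega>] by auto
      have "v \<notin> V"
      proof
        assume "v \<in> V"
        then obtain D where "D \<in> S" "v \<in> D" by (auto simp: V_def)
        then show False using clusters_disjoint[of C n \<omega> D] C S vC by auto
      qed
      then show "C \<in> (\<lambda>v. reach \<omega> {v}) ` ({..<n} - V)" using v by auto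
    qed
    have "num_clusters n \<omega> = card S + card (clusters n \<omega> - S)"
      unfolding num_clusters_def using S fS card_mono[OF finite_clusters S]
      by (simp add: card_Diff_subset)
    \<comment> \<open>Each active cluster has weight \<open>q * (1 / q) = 1\<close>, each inactive
      one \<open>q * (1 - 1 / q) = q - 1\<close>.\<close>
    then have "q ^ num_clusters n \<omega> * rset (clusters n \<omega>) (1 / q) S =
        (q * (1 / q)) ^ card S * (q * (1 - 1 / q)) ^ card (clusters n \<omega> - S)"
      by (simp only: rset_def power_add power_mult_distrib mult_ac)
    also have "\<dots> = (q - 1) ^ card (clusters n \<omega> - S)"
      using assms(3) by (simp add: right_diff_distrib)
    finally have "q ^ num_clusters n \<omega> * rset (clusters n \<omega>) (1 / q) S =
        (q - 1) ^ card ((\<lambda>v. reach \<omega> {v}) ` ({..<n} - V))" by (simp add: inact)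
    then show "rset E p \<omega> * q ^ num_clusters n \<omega> * (rset (clusters n \<omega>) (1 / q) S *
         (if \<omega>' - complete_edges (\<Union>S) = \<omega> - complete_edges (\<Union>S)
          then rset (complete_edges (\<Union>S)) p (\<omega>' \<inter> complete_edges (\<Union>S)) else 0)) = h (\<Union>S)"
      unfolding V_def[symmetric] h_def using split[OF F] by (simp add: mult_ac)
  qed
  also have "\<dots> = (\<Sum>V\<in>{V. V \<subseteq> {..<n} \<and> reach \<omega> V \<subseteq> V}. h V)"
    by (rule sum.reindex_bij_betw[OF bij_betw_clusters[OF assms(1)]])
  also have "\<dots> = (\<Sum>V\<in>Pow {..<n}. of_bool (reach \<omega> V \<subseteq> V) * h V)"
    by (rule sum.mono_neutral_cong_left) auto
  also have "\<dots> = (\<Sum>V\<in>Pow {..<n}. of_bool (reach \<omega> V \<subseteq> V \<and> \<omega>' - complete_edges V = \<omega> - complete_edges V) *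
      ((q - 1) ^ card ((\<lambda>v. reach \<omega> {v}) ` ({..<n} - V)) *
       (rset (E - complete_edges V) p (\<omega> - complete_edges V) *
        (rset (complete_edges V) p (\<omega> \<inter> complete_edges V) *
         rset (complete_edges V) p (\<omega>' \<inter> complete_edges V)))))"
    unfolding h_def by (intro sum.cong) auto
  finally show ?thesis by (simp add: E_def p_def)
qed

lemma cm_reversible:
  assumes "0 < lam" "lam < real n" "1 < q"
  shows "reversible_chain (configs n) (cm_kernel n lam q) (fk_measure n lam q)"
proof
  let ?p = "lam / real n"
  have p: "0 \<le> ?p" "?p \<le> 1" "0 \<le> 1 / q" "1 / q \<le> 1" using assms by auto
  show "0 \<le> cm_kernel n lam q x y" if "x \<in> configs n" for x y
    unfolding cm_kernel_eq[OF that] using p by (intro rexp_nonneg) (auto intro: rset_nonneg)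
  show "(\<Sum>y\<in>configs n. cm_kernel n lam q x y) = 1" if x: "x \<in> configs n" for x
  proof -
    have "(\<Sum>y\<in>configs n. cm_kernel n lam q x y) = rexp (clusters n x) (1 / q)
        (\<lambda>S. rexp (complete_edges (\<Union>S)) (lam / real n) (\<lambda>G. 1))"
      using cm_expectation[OF x, of lam q "\<lambda>_. 1"] by simp
    also have "\<dots> = rexp (clusters n x) (1 / q) (\<lambda>S. 1)"
    proof (rule rexp_cong)
      fix S assume "S \<subseteq> clusters n x"
      then have "finite (\<Union>S)" by (rule finite_subset[OF Union_clusters_subset[OF x]]) simp
      then show "rexp (complete_edges (\<Union>S)) (lam / real n) (\<lambda>G. 1) = 1" by simp
    qed simp
    finally show ?thesis by simp
  qed
  show "fk_measure n lam q x * cm_kernel n lam q x y = fk_measure n lam q y * cm_kernel n lam q y x"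
    if xy: "x \<in> configs n" "y \<in> configs n" for x y
  proof -
    have "fk_weight n lam q x * cm_kernel n lam q x y = fk_weight n lam q y * cm_kernel n lam q y x"
      unfolding fk_weight_cm_kernel[OF xy assms(3)] fk_weight_cm_kernel[OF xy(2,1) assms(3)]
    proof (rule sum.cong[OF refl])
      fix V
      let ?F = "complete_edges V"
      show "of_bool (reach x V \<subseteq> V \<and> y - ?F = x - ?F) *
          ((q - 1) ^ card ((\<lambda>v. reach x {v}) ` ({..<n} - V)) *
           (rset (complete_edges {..<n} - ?F) ?p (x - ?F) *
            (rset ?F ?p (x \<inter> ?F) * rset ?F ?p (y \<inter> ?F)))) =
        of_bool (reach y V \<subseteq> V \<and> x - ?F = y - ?F) *
          ((q - 1) ^ card ((\<lambda>v. reach y {v}) ` ({..<n} - V)) *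
           (rset (complete_edges {..<n} - ?F) ?p (y - ?F) *
            (rset ?F ?p (y \<inter> ?F) * rset ?F ?p (x \<inter> ?F))))"
      \<comment> \<open>For a given active set \<open>V\<close> both states have the same inactive
        clusters and the same edges outside \<open>complete_edges V\<close>; the two weights inside
        are merely exchanged.\<close>
      proof (cases "reach x V \<subseteq> V \<and> y - ?F = x - ?F")
        case True
        then have "reach y V \<subseteq> V" using reach_closed_transfer by blast
        moreover have "(\<lambda>v. reach y {v}) ` ({..<n} - V) = (\<lambda>v. reach x {v}) ` ({..<n} - V)"
          using True reach_outside_eq[of x V y] by (intro image_cong) auto
        ultimately show ?thesis using True by simp
      next
        case False
        then have "\<not> (reach y V \<subseteq> V \<and> x - ?F = y - ?F)" using reach_closed_transfer[of y V x] by auto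
        then show ?thesis by (simp only: False of_bool_eq mult_zero_left)
      qed
    qed
    then show ?thesis by (simp add: fk_measure_def)
  qed
qed (use assms fk_measure_pos fk_measure_sum in auto)

section \<open>One Chayes--Machta step\<close>

text \<open>Hoeffding's bound in which the sum of the squares of the weights is controlled by
  \<open>B * N\<close>. The sign \<open>\<sigma>\<close> selects the tail.\<close>

lemma rprob_subset_sum_upper:
  fixes w :: "'a \<Rightarrow> real" and p d \<sigma> B N :: real
  assumes E: "finite E" and p: "0 \<le> p" "p \<le> 1"
    and w: "\<And>x. x \<in> E \<Longrightarrow> 0 \<le> w x \<and> w x \<le> B" "sum w E \<le> N"
    and \<sigma>: "\<sigma>\<^sup>2 = 1" and pos: "0 \<le> d" "0 < B" "0 < N"
  shows "rprob E p (\<lambda>S. d < \<sigma> * (sum w S - p * sum w E)) \<le> exp (- 2 * d\<^sup>2 / (B * N))"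
proof -
  \<comment> \<open>The minimiser of the final exponent
    \<open>t\<^sup>2 * B / 8 * N - t * d\<close>.\<close>
  define t where "t = 4 * d / (B * N)"
  have t: "0 \<le> t" using pos by (simp add: t_def)
  have "rprob E p (\<lambda>S. d < \<sigma> * (sum w S - p * sum w E)) \<le>
      rexp E p (\<lambda>S. exp (- t * d - t * \<sigma> * p * sum w E) * (\<Prod>x\<in>S. exp (t * \<sigma> * w x)))"
  proof (rule rexp_mono[OF p])
    fix S assume "S \<subseteq> E"
    then have "finite S" using E finite_subset by auto
    then have "exp (- t * d - t * \<sigma> * p * sum w E) * (\<Prod>x\<in>S. exp (t * \<sigma> * w x)) =
        exp (t * (\<sigma> * (sum w S - p * sum w E) - d))"
      by (simp add: exp_sum[symmetric] exp_add[symmetric] sum_distrib_left[symmetric] algebra_simps)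
    moreover have "d < \<sigma> * (sum w S - p * sum w E) \<Longrightarrow> 0 \<le> t * (\<sigma> * (sum w S - p * sum w E) - d)"
      using t by simp
    ultimately show "of_bool (d < \<sigma> * (sum w S - p * sum w E)) \<le>
        exp (- t * d - t * \<sigma> * p * sum w E) * (\<Prod>x\<in>S. exp (t * \<sigma> * w x))"
      by (cases "d < \<sigma> * (sum w S - p * sum w E)") simp_all
  qed
  also have "\<dots> = exp (- t * d - t * \<sigma> * p * sum w E) * (\<Prod>x\<in>E. 1 - p + p * exp (t * \<sigma> * w x))"
    unfolding rexp_cmult rexp_prod[OF E] ..
  also have "(\<Prod>x\<in>E. 1 - p + p * exp (t * \<sigma> * w x)) \<le>
      (\<Prod>x\<in>E. exp (p * (t * \<sigma> * w x) + t\<^sup>2 * B / 8 * w x))"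
  proof (rule prod_mono)
    fix x assume x: "x \<in> E"
    have "(w x)\<^sup>2 \<le> B * w x"
      using w(1)[OF x] by (simp add: power2_eq_square mult_right_mono)
    then have "t\<^sup>2 * (w x)\<^sup>2 \<le> t\<^sup>2 * (B * w x)" by (intro mult_left_mono) auto
    then have "(t * \<sigma> * w x)\<^sup>2 / 8 \<le> t\<^sup>2 * B / 8 * w x"
      using \<sigma> by (simp add: power_mult_distrib)
    then have "exp (p * (t * \<sigma> * w x) + (t * \<sigma> * w x)\<^sup>2 / 8) \<le> exp (p * (t * \<sigma> * w x) + t\<^sup>2 * B / 8 * w x)"
      by simp
    then have "1 - p + p * exp (t * \<sigma> * w x) \<le> exp (p * (t * \<sigma> * w x) + t\<^sup>2 * B / 8 * w x)"
      using bernoulli_mgf_le[OF p, of "t * \<sigma> * w x"] by linarith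
    then show "0 \<le> 1 - p + p * exp (t * \<sigma> * w x) \<and>
        1 - p + p * exp (t * \<sigma> * w x) \<le> exp (p * (t * \<sigma> * w x) + t\<^sup>2 * B / 8 * w x)"
      using p by simp
  qed
  also have "\<dots> = exp (t * \<sigma> * p * sum w E + t\<^sup>2 * B / 8 * sum w E)"
  proof -
    have "(\<Sum>x\<in>E. p * (t * \<sigma> * w x) + t\<^sup>2 * B / 8 * w x) =
        (\<Sum>x\<in>E. (t * \<sigma> * p + t\<^sup>2 * B / 8) * w x)"
      by (intro sum.cong) (auto simp: algebra_simps)
    also have "\<dots> = t * \<sigma> * p * sum w E + t\<^sup>2 * B / 8 * sum w E"
      unfolding sum_distrib_left[symmetric] by (rule distrib_right)
    finally show ?thesis by (simp only: exp_sum[OF E, symmetric])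
  qed
  also have "\<dots> \<le> exp (t * \<sigma> * p * sum w E + t\<^sup>2 * B / 8 * N)"
    using w(2) pos by (simp add: mult_left_mono)
  also have "exp (- t * d - t * \<sigma> * p * sum w E) * exp (t * \<sigma> * p * sum w E + t\<^sup>2 * B / 8 * N) =
      exp (t\<^sup>2 * B / 8 * N - t * d)"
    by (simp add: exp_add[symmetric])
  also have "t\<^sup>2 * B / 8 * N - t * d = - 2 * d\<^sup>2 / (B * N)"
    using pos by (simp add: t_def power2_eq_square field_simps)
  finally show ?thesis by simp
qed

lemma rprob_subset_sum:
  fixes w :: "'a \<Rightarrow> real" and p d B N :: real
  assumes "finite E" "0 \<le> p" "p \<le> 1"
    and "\<And>x. x \<in> E \<Longrightarrow> 0 \<le> w x \<and> w x \<le> B" "sum w E \<le> N" "0 \<le> d" "0 < B" "0 < N"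
  shows "rprob E p (\<lambda>S. d < \<bar>sum w S - p * sum w E\<bar>) \<le> 2 * exp (- 2 * d\<^sup>2 / (B * N))"
proof -
  have "rprob E p (\<lambda>S. d < \<bar>sum w S - p * sum w E\<bar>) \<le>
      rprob E p (\<lambda>S. d < 1 * (sum w S - p * sum w E) \<or> d < - 1 * (sum w S - p * sum w E))"
    using assms(2,3) by (intro rprob_mono) auto
  also have "\<dots> \<le> rprob E p (\<lambda>S. d < 1 * (sum w S - p * sum w E)) +
      rprob E p (\<lambda>S. d < - 1 * (sum w S - p * sum w E))"
    using assms(2,3) by (rule rprob_or_le)
  also have "\<dots> \<le> exp (- 2 * d\<^sup>2 / (B * N)) + exp (- 2 * d\<^sup>2 / (B * N))"
    using assms by (intro add_mono rprob_subset_sum_upper) auto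
  finally show ?thesis by simp
qed

lemma rprob_contains_avoids:
  fixes p :: real
  assumes "finite E" "F \<subseteq> E" "D \<subseteq> E" "F \<inter> D = {}"
  shows "rprob E p (\<lambda>S. F \<subseteq> S \<and> D \<inter> S = {}) = p ^ card F * (1 - p) ^ card D"
proof -
  define R where "R = E - (F \<union> D)"
  have fin: "finite F" "finite D" "finite R" using assms finite_subset by (auto simp: R_def)
  have E: "E = F \<union> (D \<union> R)" using assms by (auto simp: R_def)
  have dj: "F \<inter> (D \<union> R) = {}" "D \<inter> R = {}" using assms by (auto simp: R_def)
  have single: "rexp A p (\<lambda>X. of_bool (X = Y) * c) = rset A p Y * c" if "finite A" "Y \<subseteq> A" for A Y c
  proof -
    have "rexp A p (\<lambda>X. of_bool (X = Y) * c) = (\<Sum>X\<in>{Y}. rset A p X * (of_bool (X = Y) * c))"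
      unfolding rexp_def using that by (intro sum.mono_neutral_right) auto
    then show ?thesis by simp
  qed
  have "rprob E p (\<lambda>S. F \<subseteq> S \<and> D \<inter> S = {}) =
      rexp F p (\<lambda>X. rexp D p (\<lambda>Y. rexp R p (\<lambda>Z.
        of_bool (F \<subseteq> X \<union> (Y \<union> Z) \<and> D \<inter> (X \<union> (Y \<union> Z)) = {}))))"
    unfolding E using fin dj by (subst rexp_Un; (subst rexp_Un)?) auto
  also have "\<dots> = rexp F p (\<lambda>X. rexp D p (\<lambda>Y. rexp R p (\<lambda>Z. of_bool (X = F) * of_bool (Y = {}))))"
  proof (intro rexp_cong refl)
    fix X Y Z assume "X \<subseteq> F" "Y \<subseteq> D" "Z \<subseteq> R"
    then have "F \<subseteq> X \<union> (Y \<union> Z) \<and> D \<inter> (X \<union> (Y \<union> Z)) = {} \<longleftrightarrow> X = F \<and> Y = {}"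
      using dj assms(4) by blast
    then show "of_bool (F \<subseteq> X \<union> (Y \<union> Z) \<and> D \<inter> (X \<union> (Y \<union> Z)) = {}) =
        (of_bool (X = F) * of_bool (Y = {}) :: real)" by simp
  qed
  also have "\<dots> = rexp F p (\<lambda>X. of_bool (X = F) * rset D p {})"
    using fin single[of D "{}" 1] by (simp add: rexp_cmult)
  also have "\<dots> = rset F p F * rset D p {}" using fin by (intro single) auto
  finally show ?thesis by (simp add: rset_def)
qed

section \<open>Phases and the effect of one update\<close>

text \<open>\<open>K\<close> marks the giants: \<open>l\<close> bounds the joint size of the
  clusters meeting \<open>K\<close>, and \<open>r\<close> the number of stray vertices in other big
  clusters. Taking the joint size lets two seeds describe a giant that an edge deletion has cut in
  two.\<close>

definition phase :: "nat \<Rightarrow> nat \<Rightarrow> nat \<Rightarrow> real \<Rightarrow> real \<Rightarrow> nat set set set" where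
  "phase n M k l r = {\<omega> \<in> configs n. \<exists>K\<subseteq>{..<n}. card K \<le> k \<and> l \<le> real (card (reach \<omega> K)) \<and>
     real (card (big M {..<n} \<omega> - reach \<omega> K)) \<le> r}"

lemma phase_subset: "phase n M k l r \<subseteq> configs n"
  by (auto simp: phase_def)

lemma phase_mono: "k \<le> k' \<Longrightarrow> r \<le> r' \<Longrightarrow> phase n M k l r \<subseteq> phase n M k' l r'"
  unfolding phase_def by (blast intro: order_trans)

text \<open>The probabilistic input for one fixed \<open>n\<close>. \<open>\<mu>\<close> bounds from
  below the density of the active set when a giant is active: the giant and a share
  \<open>1 / q\<close> of the rest, less \<open>\<epsilon>\<close> for fluctuations of the
  activation and \<open>\<epsilon>\<close> for stray vertices. The bounds \<open>sub\<close> and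
  \<open>sup\<close> concern the new graph on the active set \<open>V\<close>.\<close>

locale update_estimates =
  fixes n M :: nat and lam q \<epsilon> \<eta> \<theta> \<mu> \<beta> :: real
  assumes lam: "0 < lam" "lam < real n"
    and q: "1 < q"
    and M: "0 < M"
    and \<epsilon>: "0 < \<epsilon>" and \<eta>: "0 < \<eta>" "6 * q * \<eta> \<le> \<epsilon>"
    and \<mu>: "\<mu> \<le> \<theta> + (1 - \<theta>) / q - 2 * \<epsilon>"
    and \<beta>: "0 \<le> \<beta>" "2 * exp (- 2 * \<epsilon>\<^sup>2 * real n / real M) \<le> \<beta>"
    and sub: "V \<subseteq> {..<n} \<Longrightarrow> real (card V) \<le> (1 / q + 2 * \<epsilon>) * real n \<Longrightarrow>
      rprob (complete_edges V) (lam / real n) (\<lambda>G. \<eta> * real n \<le> real (card (big M V G))) \<le> \<beta>"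
    and sup: "V \<subseteq> {..<n} \<Longrightarrow> \<mu> * real n \<le> real (card V) \<Longrightarrow>
      rprob (complete_edges V) (lam / real n)
        (\<lambda>G. \<not> (\<exists>c\<in>V. \<theta> * real n \<le> real (card (reach G {c})) \<and>
            real (card (big M V G - reach G {c})) < \<eta> * real n)) \<le> \<beta>"
begin

abbreviation p where "p \<equiv> lam / real n"
abbreviation big_outside where "big_outside \<omega> K \<equiv> big M {..<n} \<omega> - reach \<omega> K"
abbreviation small where "small \<omega> K \<equiv> {..<n} - big M {..<n} \<omega> - reach \<omega> K"

lemma n_pos: "0 < real n" using lam by linarith

lemma p: "0 \<le> p" "p \<le> 1" using lam by auto

lemma iq: "0 \<le> 1 / q" "1 / q \<le> 1" using q by auto

definition unbalanced :: "nat set set \<Rightarrow> nat set \<Rightarrow> nat set set \<Rightarrow> bool" where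
  "unbalanced \<omega> K S \<longleftrightarrow>
    \<epsilon> * real n < \<bar>real (card (\<Union>S \<inter> small \<omega> K)) - real (card (small \<omega> K)) / q\<bar>"

text \<open>A cluster meeting \<open>small \<omega> K\<close> has at most \<open>M\<close> vertices,
  so \<open>rprob_subset_sum\<close> applies with \<open>B = M\<close> and
  \<open>N = n\<close>.\<close>

lemma rprob_unbalanced:
  assumes "\<omega> \<in> configs n"
  shows "rprob (clusters n \<omega>) (1 / q) (unbalanced \<omega> K) \<le> \<beta>"
proof -
  define w where "w = (\<lambda>C. real (card (C \<inter> small \<omega> K)))"
  have fin: "finite (small \<omega> K)" by simp
  have sumw: "sum w S = real (card (\<Union>S \<inter> small \<omega> K))" if S: "S \<subseteq> clusters n \<omega>" for S
  proof -
    have "card (\<Union>C\<in>S. C \<inter> small \<omega> K) = (\<Sum>C\<in>S. card (C \<inter> small \<omega> K))"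
    proof (rule card_UN_disjoint)
      show "finite S" using S finite_subset[OF _ finite_clusters] by auto
      show "\<forall>C\<in>S. \<forall>D\<in>S. C \<noteq> D \<longrightarrow> C \<inter> small \<omega> K \<inter> (D \<inter> small \<omega> K) = {}"
        using clusters_disjoint S by blast
    qed auto
    moreover have "(\<Union>C\<in>S. C \<inter> small \<omega> K) = \<Union>S \<inter> small \<omega> K" by auto
    ultimately show ?thesis by (simp add: w_def)
  qed
  have "small \<omega> K \<subseteq> \<Union>(clusters n \<omega>)"
    using reach_superset by (fastforce simp: clusters_eq)
  then have "\<Union>(clusters n \<omega>) \<inter> small \<omega> K = small \<omega> K" by auto
  then have total: "sum w (clusters n \<omega>) = real (card (small \<omega> K))" using sumw by simp
  have wB: "0 \<le> w C \<and> w C \<le> real M" if C: "C \<in> clusters n \<omega>" for C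
  proof (cases "C \<inter> small \<omega> K = {}")
    case False
    then obtain v where v: "v \<in> C" "v \<in> small \<omega> K" by auto
    have "C = reach \<omega> {v}" using cluster_eq_reach[OF C v(1)] .
    then have "card C \<le> M" using v by (auto simp: big_def)
    moreover have "finite C" using clusters_subset[OF assms C] finite_subset by auto
    then have "card (C \<inter> small \<omega> K) \<le> card C" by (intro card_mono) auto
    ultimately show ?thesis by (simp add: w_def)
  qed (simp add: w_def)
  have cs: "card (small \<omega> K) \<le> card {..<n}" by (intro card_mono) auto
  have "rprob (clusters n \<omega>) (1 / q) (unbalanced \<omega> K) =
      rprob (clusters n \<omega>) (1 / q)
        (\<lambda>S. \<epsilon> * real n < \<bar>sum w S - 1 / q * sum w (clusters n \<omega>)\<bar>)"
    by (rule rexp_cong[OF refl]) (simp add: unbalanced_def sumw total)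
  also have "\<dots> \<le> 2 * exp (- 2 * (\<epsilon> * real n)\<^sup>2 / (real M * real n))"
    using iq wB cs total n_pos M \<epsilon> by (intro rprob_subset_sum) auto
  also have "- 2 * (\<epsilon> * real n)\<^sup>2 / (real M * real n) = - 2 * \<epsilon>\<^sup>2 * real n / real M"
    using n_pos by (simp add: power2_eq_square)
  finally show ?thesis using \<beta>(2) by linarith
qed

context
  fixes \<omega> S V K
  assumes \<omega>: "\<omega> \<in> configs n" and S: "S \<subseteq> clusters n \<omega>" and V_def: "V = \<Union>S"
    and K: "K \<subseteq> {..<n}" and bal: "\<not> unbalanced \<omega> K S"
    and rho: "real (card (big_outside \<omega> K)) \<le> \<epsilon> * real n"
begin

lemma V: "V \<subseteq> {..<n}" "reach \<omega> V = V" "finite V"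
proof -
  show "V \<subseteq> {..<n}" using Union_clusters_subset[OF \<omega> S] by (simp add: V_def)
  then show "finite V" by (rule finite_subset) simp
  show "reach \<omega> V = V" using reach_Union_clusters[OF S] by (simp add: V_def)
qed

lemma update:
  assumes "G \<subseteq> complete_edges V"
  defines "\<omega>' \<equiv> (\<omega> - complete_edges V) \<union> G"
  shows "\<omega>' \<in> configs n" "\<And>v. v \<notin> V \<Longrightarrow> reach \<omega>' {v} = reach \<omega> {v}"
    "\<And>v. v \<in> V \<Longrightarrow> reach \<omega>' {v} = reach G {v}"
proof -
  have E: "complete_edges V \<subseteq> complete_edges {..<n}" using V by (intro complete_edges_mono) auto
  then show cfg: "\<omega>' \<in> configs n" using \<omega> assms by (auto simp: configs_eq)
  have eq: "\<omega>' - complete_edges V = \<omega> - complete_edges V" "\<omega>' \<inter> complete_edges V = G"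
    using assms by auto
  show "reach \<omega>' {v} = reach \<omega> {v}" if "v \<notin> V" for v
    using V eq that by (intro reach_outside_eq[of \<omega> V]) auto
  show "reach \<omega>' {v} = reach G {v}" if "v \<in> V" for v
    using reach_inside_eq[of \<omega>' V "{..<n}" v] reach_closed_transfer[of \<omega> V \<omega>'] V eq that cfg
    by (simp add: configs_eq)
qed

lemma big_update:
  assumes "G \<subseteq> complete_edges V"
  shows "big M {..<n} ((\<omega> - complete_edges V) \<union> G) = (big M {..<n} \<omega> - V) \<union> big M V G"
proof (intro set_eqI)
  fix v
  show "v \<in> big M {..<n} ((\<omega> - complete_edges V) \<union> G) \<longleftrightarrow>
      v \<in> (big M {..<n} \<omega> - V) \<union> big M V G"
    using V(1) update(2,3)[OF assms, of v] by (cases "v \<in> V") (auto simp: big_def)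
qed

text \<open>The active set consists of about a share \<open>1 / q\<close> of the small vertices and
  at most \<open>\<epsilon> * n\<close> stray ones, so \<open>sub\<close> applies. The clusters of
  \<open>K\<close> are untouched, and new stray vertices arise only in
  \<open>big M V G\<close>.\<close>

lemma update_inactive:
  assumes "K \<inter> V = {}" "card K \<le> k" "l \<le> real (card (reach \<omega> K))"
  shows "rprob (complete_edges V) p
    (\<lambda>G. (\<omega> - complete_edges V) \<union> G \<notin>
      phase n M k l (real (card (big_outside \<omega> K - V)) + \<eta> * real n)) \<le> \<beta>"
proof -
  have rKV: "reach \<omega> K \<inter> V = {}"
  proof (rule ccontr)
    assume "reach \<omega> K \<inter> V \<noteq> {}"
    then obtain x v where x: "x \<in> V" "v \<in> K" "x \<in> reach \<omega> {v}" using reach_eq_UN[of \<omega> K] by auto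
    then have "v \<in> reach \<omega> {x}" by (simp add: reach_sym)
    then have "v \<in> V" using reach_mono[of \<omega> \<omega> "{x}" V] x V by auto
    then show False using assms x by auto
  qed
  have "card V \<le> card (V \<inter> small \<omega> K \<union> big_outside \<omega> K)"
    using V rKV by (intro card_mono) (auto simp: big_def)
  also have "\<dots> \<le> card (V \<inter> small \<omega> K) + card (big_outside \<omega> K)" by (rule card_Un_le)
  finally have cV: "real (card V) \<le> real (card (V \<inter> small \<omega> K)) + real (card (big_outside \<omega> K))"
    by linarith
  have "card (small \<omega> K) \<le> card {..<n}" by (intro card_mono) auto
  then have "real (card (small \<omega> K)) / q \<le> real n / q"
    using q by (intro divide_right_mono) auto
  then have "real (card V) \<le> (1 / q + 2 * \<epsilon>) * real n"
    using cV rho bal unfolding unbalanced_def V_def[symmetric] by (simp add: algebra_simps)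
  then have "rprob (complete_edges V) p (\<lambda>G. \<eta> * real n \<le> real (card (big M V G))) \<le> \<beta>"
    using V by (intro sub) auto
  moreover have "rprob (complete_edges V) p
    (\<lambda>G. (\<omega> - complete_edges V) \<union> G \<notin>
      phase n M k l (real (card (big_outside \<omega> K - V)) + \<eta> * real n)) \<le>
    rprob (complete_edges V) p (\<lambda>G. \<eta> * real n \<le> real (card (big M V G)))"
  proof (rule rprob_mono[OF p], rule ccontr)
    fix G let ?\<omega>' = "(\<omega> - complete_edges V) \<union> G"
    assume G: "G \<subseteq> complete_edges V"
      and out: "?\<omega>' \<notin> phase n M k l (real (card (big_outside \<omega> K - V)) + \<eta> * real n)"
      and lt: "\<not> \<eta> * real n \<le> real (card (big M V G))"
    have rK: "reach ?\<omega>' K = reach \<omega> K"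
    proof -
      have "(\<Union>v\<in>K. reach ?\<omega>' {v}) = (\<Union>v\<in>K. reach \<omega> {v})"
        using update(2)[OF G] assms(1) by (intro SUP_cong) auto
      then show ?thesis using reach_eq_UN[of ?\<omega>' K] reach_eq_UN[of \<omega> K] by simp
    qed
    have "big_outside ?\<omega>' K \<subseteq> (big_outside \<omega> K - V) \<union> big M V G"
      unfolding rK big_update[OF G] by auto
    then have "card (big_outside ?\<omega>' K) \<le> card ((big_outside \<omega> K - V) \<union> big M V G)"
      using V by (intro card_mono) (auto simp: big_def)
    also have "\<dots> \<le> card (big_outside \<omega> K - V) + card (big M V G)" by (rule card_Un_le)
    finally have "real (card (big_outside ?\<omega>' K)) \<le> real (card (big_outside \<omega> K - V)) + \<eta> * real n"
      using lt by linarith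
    then have "?\<omega>' \<in> phase n M k l (real (card (big_outside \<omega> K - V)) + \<eta> * real n)"
      unfolding phase_def using update(1)[OF G] K assms(2,3) rK
      by (intro CollectI conjI exI[of _ K]) auto
    then show False using out by simp
  qed
  ultimately show ?thesis by linarith
qed

text \<open>The fresh graph on \<open>V\<close> is supercritical and forms its own giant, whatever
  the old one was. \<open>K\<close> may contain several seeds while the result needs only one: this
  is how a divided giant is reunited.\<close>

lemma update_active:
  assumes "K \<subseteq> V" "\<theta> * real n \<le> real (card (reach \<omega> K))"
  shows "rprob (complete_edges V) p
    (\<lambda>G. (\<omega> - complete_edges V) \<union> G \<notin>
      phase n M 1 (\<theta> * real n) (real (card (big_outside \<omega> K - V)) + \<eta> * real n)) \<le> \<beta>"
proof -
  have rKV: "reach \<omega> K \<subseteq> V" using reach_mono[of \<omega> \<omega> K V] assms V by auto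
  define L where "L = real (card (reach \<omega> K))"
  have frK: "finite (reach \<omega> K)" using V(3) by (rule finite_subset[OF rKV])
  have "card (reach \<omega> K) + card (V \<inter> small \<omega> K) = card (reach \<omega> K \<union> (V \<inter> small \<omega> K))"
    using frK by (intro card_Un_disjoint[symmetric]) auto
  also have "\<dots> \<le> card V" using rKV V by (intro card_mono) auto
  finally have 1: "L + real (card (V \<inter> small \<omega> K)) \<le> real (card V)" by (simp add: L_def)
  have "card {..<n} \<le> card (small \<omega> K \<union> (reach \<omega> K \<union> big_outside \<omega> K))"
    using frK by (intro card_mono) (auto simp: big_def)
  also have "\<dots> \<le> card (small \<omega> K) + (card (reach \<omega> K) + card (big_outside \<omega> K))"
    using card_Un_le[of "small \<omega> K" "reach \<omega> K \<union> big_outside \<omega> K"]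
      card_Un_le[of "reach \<omega> K" "big_outside \<omega> K"] by linarith
  finally have "real n - L - \<epsilon> * real n \<le> real (card (small \<omega> K))" using rho by (simp add: L_def)
  then have "(real n - L - \<epsilon> * real n) / q \<le> real (card (small \<omega> K)) / q"
    using q by (intro divide_right_mono) auto
  moreover have "(\<epsilon> * real n) / q \<le> \<epsilon> * real n" using q \<epsilon> n_pos by (simp add: divide_le_eq mult_left_mono)
  ultimately have 2: "(real n - L) / q - \<epsilon> * real n \<le> real (card (small \<omega> K)) / q"
    by (simp add: diff_divide_distrib)
  have "\<mu> * real n \<le> (\<theta> + (1 - \<theta>) / q - 2 * \<epsilon>) * real n"
    using \<mu> by (intro mult_right_mono) auto
  also have "\<dots> = (\<theta> * real n) * (1 - 1 / q) + real n / q - 2 * \<epsilon> * real n"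
    by (simp add: algebra_simps diff_divide_distrib)
  \<comment> \<open>The active mass \<open>L + (n - L) / q\<close> increases with the size
    \<open>L\<close> of the old giant, so \<open>L = \<theta> * n\<close> is the worst case.\<close>
  also have "(\<theta> * real n) * (1 - 1 / q) \<le> L * (1 - 1 / q)"
    using assms(2) iq by (intro mult_right_mono) (auto simp: L_def)
  also have "L * (1 - 1 / q) + real n / q - 2 * \<epsilon> * real n = L + (real n - L) / q - 2 * \<epsilon> * real n"
    by (simp add: algebra_simps diff_divide_distrib)
  also have "\<dots> \<le> real (card V)"
    using 1 2 bal unfolding unbalanced_def V_def[symmetric] by (simp add: algebra_simps)
  finally have "rprob (complete_edges V) p
        (\<lambda>G. \<not> (\<exists>c\<in>V. \<theta> * real n \<le> real (card (reach G {c})) \<and>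
            real (card (big M V G - reach G {c})) < \<eta> * real n)) \<le> \<beta>"
    using V by (intro sup) auto
  moreover have "rprob (complete_edges V) p
    (\<lambda>G. (\<omega> - complete_edges V) \<union> G \<notin>
      phase n M 1 (\<theta> * real n) (real (card (big_outside \<omega> K - V)) + \<eta> * real n)) \<le>
    rprob (complete_edges V) p
        (\<lambda>G. \<not> (\<exists>c\<in>V. \<theta> * real n \<le> real (card (reach G {c})) \<and>
            real (card (big M V G - reach G {c})) < \<eta> * real n))"
  proof (rule rprob_mono[OF p], rule notI, elim bexE conjE)
    fix G c let ?\<omega>' = "(\<omega> - complete_edges V) \<union> G"
    assume G: "G \<subseteq> complete_edges V"
      and out: "?\<omega>' \<notin> phase n M 1 (\<theta> * real n) (real (card (big_outside \<omega> K - V)) + \<eta> * real n)"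
      and c: "c \<in> V" "\<theta> * real n \<le> real (card (reach G {c}))"
        "real (card (big M V G - reach G {c})) < \<eta> * real n"
    have rc: "reach ?\<omega>' {c} = reach G {c}" using update(3)[OF G c(1)] .
    have "big_outside ?\<omega>' {c} \<subseteq> (big_outside \<omega> K - V) \<union> (big M V G - reach G {c})"
      unfolding rc big_update[OF G] using rKV by auto
    then have "card (big_outside ?\<omega>' {c}) \<le> card ((big_outside \<omega> K - V) \<union> (big M V G - reach G {c}))"
      using V by (intro card_mono) (auto simp: big_def)
    also have "\<dots> \<le> card (big_outside \<omega> K - V) + card (big M V G - reach G {c})" by (rule card_Un_le)
    finally have "real (card (big_outside ?\<omega>' {c})) \<le> real (card (big_outside \<omega> K - V)) + \<eta> * real n"
      using c by linarith
    then have "?\<omega>' \<in> phase n M 1 (\<theta> * real n) (real (card (big_outside \<omega> K - V)) + \<eta> * real n)"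
      unfolding phase_def using update(1)[OF G] c V rc
      by (intro CollectI conjI exI[of _ "{c}"]) auto
    then show False using out by simp
  qed
  ultimately show ?thesis by linarith
qed

end

lemma cm_prob_eq:
  assumes "\<omega> \<in> configs n" "T \<subseteq> configs n"
  shows "(\<Sum>\<omega>'\<in>T. cm_kernel n lam q \<omega> \<omega>') = rexp (clusters n \<omega>) (1 / q) (\<lambda>S.
    rprob (complete_edges (\<Union>S)) p (\<lambda>G. (\<omega> - complete_edges (\<Union>S)) \<union> G \<in> T))"
proof -
  have "(\<Sum>\<omega>'\<in>T. cm_kernel n lam q \<omega> \<omega>') =
      (\<Sum>\<omega>'\<in>configs n. cm_kernel n lam q \<omega> \<omega>' * of_bool (\<omega>' \<in> T))"
    using assms(2) by (intro sum.mono_neutral_cong_left) auto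
  then show ?thesis using cm_expectation[OF assms(1), of lam q "\<lambda>\<omega>'. of_bool (\<omega>' \<in> T)"] by simp
qed

text \<open>One \<open>\<beta>\<close> pays for an unbalanced activation, the other for a failure of
  the fresh graph. With at most one seed, \<open>K\<close> is either contained in the active set or
  disjoint from it, and one of the two update lemmas applies.\<close>

lemma leave_phase:
  assumes mode: "(k = 0 \<and> l = 0) \<or> (k = 1 \<and> l = \<theta> * real n \<and> 0 < l)"
    and \<omega>: "\<omega> \<in> phase n M k l r" and r: "r \<le> \<epsilon> * real n"
  shows "(\<Sum>\<omega>'\<in>configs n - phase n M k l (r + \<eta> * real n). cm_kernel n lam q \<omega> \<omega>') \<le> 2 * \<beta>"
proof -
  obtain K where cfg: "\<omega> \<in> configs n" and K: "K \<subseteq> {..<n}" "card K \<le> k" "l \<le> real (card (reach \<omega> K))"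
      "real (card (big_outside \<omega> K)) \<le> r"
    using \<omega> by (auto simp: phase_def)
  have fK: "finite K" using K finite_subset by auto
  let ?Q = "phase n M k l (r + \<eta> * real n)"
  have step: "rprob (complete_edges (\<Union>S)) p
      (\<lambda>G. (\<omega> - complete_edges (\<Union>S)) \<union> G \<in> configs n - ?Q) \<le> of_bool (unbalanced \<omega> K S) + \<beta>"
    if S: "S \<subseteq> clusters n \<omega>" for S
  proof (cases "unbalanced \<omega> K S")
    case True
    have "finite (\<Union>S)" by (rule finite_subset[OF Union_clusters_subset[OF cfg S]]) simp
    then show ?thesis
      using True rprob_le_1[OF finite_complete_edges p, of "\<Union>S"] \<beta>(1) by (simp add: add_increasing2)
  next
    case False
    have rho: "real (card (big_outside \<omega> K)) \<le> \<epsilon> * real n" using K r by linarith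
    let ?r' = "real (card (big_outside \<omega> K - \<Union>S)) + \<eta> * real n"
    have "card (big_outside \<omega> K - \<Union>S) \<le> card (big_outside \<omega> K)"
      by (intro card_mono) (auto simp: big_def)
    then have le: "?r' \<le> r + \<eta> * real n" using K by linarith
    have "rprob (complete_edges (\<Union>S)) p
      (\<lambda>G. (\<omega> - complete_edges (\<Union>S)) \<union> G \<in> configs n - ?Q) \<le>
      rprob (complete_edges (\<Union>S)) p (\<lambda>G. (\<omega> - complete_edges (\<Union>S)) \<union> G \<notin> phase n M k l ?r')"
      using phase_mono[OF order_refl le, of n M k l] by (intro rprob_mono[OF p]) auto
    also have "\<dots> \<le> \<beta>"
    proof (cases "K \<inter> \<Union>S = {}")
      case True
      then show ?thesis using update_inactive[OF cfg S refl K(1) False rho] K by blast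
    next
      case meets: False
      then have "K \<noteq> {}" by auto
      then have k: "k = 1" "l = \<theta> * real n" using mode K fK by auto
      then have "card K = 1" using \<open>K \<noteq> {}\<close> K fK by (simp add: le_Suc_eq)
      then obtain c where "K = {c}" by (rule card_1_singletonE)
      then have "K \<subseteq> \<Union>S" using meets by auto
      then show ?thesis using update_active[OF cfg S refl K(1) False rho] K k by blast
    qed
    finally show ?thesis using False by simp
  qed
  have "(\<Sum>\<omega>'\<in>configs n - ?Q. cm_kernel n lam q \<omega> \<omega>') \<le>
      rexp (clusters n \<omega>) (1 / q) (\<lambda>S. of_bool (unbalanced \<omega> K S) + \<beta>)"
    unfolding cm_prob_eq[OF cfg Diff_subset] by (rule rexp_mono[OF iq step])
  also have "\<dots> = rprob (clusters n \<omega>) (1 / q) (unbalanced \<omega> K) + \<beta>"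
    by (simp add: rexp_add)
  also have "\<dots> \<le> 2 * \<beta>" using rprob_unbalanced[OF cfg, of K] by simp
  finally show ?thesis .
qed

text \<open>The at most two clusters of \<open>K\<close> are active with probability at least
  \<open>1 / q ^ 2\<close>. Given this, each stray vertex stays inactive with probability
  \<open>1 - 1 / q\<close>, and Markov's inequality at the larger level
  \<open>1 - 1 / (2 * q)\<close> leaves a conditional probability of at least
  \<open>1 / (2 * q)\<close>.\<close>

lemma rprob_shrinking_activation:
  assumes cfg: "\<omega> \<in> configs n" and K: "K \<subseteq> {..<n}" "card K \<le> 2"
  shows "1 / (2 * q ^ 3) \<le> rprob (clusters n \<omega>) (1 / q)
    (\<lambda>S. K \<subseteq> \<Union>S \<and> real (card (big_outside \<omega> K - \<Union>S)) \<le> (1 - 1 / (2 * q)) * real (card (big_outside \<omega> K)))"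
proof -
  define Y where "Y = big_outside \<omega> K"
  define a where "a = 1 - 1 / (2 * q)"
  define F where "F = (\<lambda>v. reach \<omega> {v}) ` K"
  define good where "good = (\<lambda>S. F \<subseteq> S \<and> real (card (Y - \<Union>S)) \<le> a * real (card Y))"
  define bad where "bad = (\<lambda>S. F \<subseteq> S \<and> \<not> real (card (Y - \<Union>S)) \<le> a * real (card Y))"
  have a: "1 / 2 \<le> a" "a \<le> 1" using q by (auto simp: a_def field_simps)
  have fK: "finite K" using K finite_subset by auto
  have F: "F \<subseteq> clusters n \<omega>" "card F \<le> 2"
    using K card_image_le[OF fK, of "\<lambda>v. reach \<omega> {v}"] by (auto simp: F_def clusters_eq)
  have KF: "K \<subseteq> \<Union>S" if "F \<subseteq> S" for S
  proof
    fix v assume "v \<in> K"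
    then have "reach \<omega> {v} \<in> S" using that by (auto simp: F_def)
    moreover have "v \<in> reach \<omega> {v}" using reach_superset[of "{v}" \<omega>] by simp
    ultimately show "v \<in> \<Union>S" by blast
  qed
  have fY: "finite Y" by (simp add: Y_def big_def)
  let ?E = "clusters n \<omega>"
  have PF: "rprob ?E (1 / q) (\<lambda>S. F \<subseteq> S) = (1 / q) ^ card F"
    using rprob_contains_avoids[of ?E F "{}" "1 / q"] F by simp
  have "a * real (card Y) * rprob ?E (1 / q) bad \<le>
      rexp ?E (1 / q) (\<lambda>S. \<Sum>v\<in>Y. of_bool (F \<subseteq> S \<and> {reach \<omega> {v}} \<inter> S = {}))"
    unfolding rexp_cmult[symmetric]
  proof (rule rexp_mono[OF iq])
    fix S assume S: "S \<subseteq> ?E"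
    have *: "real (card (Y - \<Union>S)) \<le> (\<Sum>v\<in>Y. of_bool ({reach \<omega> {v}} \<inter> S = {}))"
    proof -
      have "Y - \<Union>S \<subseteq> {v\<in>Y. {reach \<omega> {v}} \<inter> S = {}}"
      proof
        fix v assume v: "v \<in> Y - \<Union>S"
        have "v \<in> reach \<omega> {v}" using reach_superset[of "{v}" \<omega>] by auto
        then show "v \<in> {v\<in>Y. {reach \<omega> {v}} \<inter> S = {}}" using v by auto
      qed
      then have "card (Y - \<Union>S) \<le> card {v\<in>Y. {reach \<omega> {v}} \<inter> S = {}}"
        using fY by (intro card_mono) auto
      also have "real (card {v\<in>Y. {reach \<omega> {v}} \<inter> S = {}}) = (\<Sum>v\<in>Y. of_bool ({reach \<omega> {v}} \<inter> S = {}))"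
        using fY by (simp add: of_bool_def sum.If_cases Int_def)
      finally show ?thesis by simp
    qed
    show "a * real (card Y) * of_bool (bad S) \<le>
        (\<Sum>v\<in>Y. of_bool (F \<subseteq> S \<and> {reach \<omega> {v}} \<inter> S = {}))"
    proof (cases "bad S")
      case True
      then have "F \<subseteq> S" "a * real (card Y) \<le> real (card (Y - \<Union>S))" by (auto simp: bad_def)
      then show ?thesis using * True by simp
    qed (simp add: sum_nonneg)
  qed
  also have "\<dots> = (\<Sum>v\<in>Y. (1 / q) ^ card F * (1 - 1 / q))"
    unfolding rexp_sum
  proof (rule sum.cong[OF refl])
    fix v assume v: "v \<in> Y"
    \<comment> \<open>Hence the activation of the cluster of \<open>v\<close> is independent of the
      activation of \<open>F\<close>.\<close>
    have "reach \<omega> {v} \<notin> F"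
    proof
      assume "reach \<omega> {v} \<in> F"
      then obtain u where u: "u \<in> K" "reach \<omega> {v} = reach \<omega> {u}" by (auto simp: F_def)
      then have "v \<in> reach \<omega> K"
        using reach_superset[of "{v}" \<omega>] reach_mono[of \<omega> \<omega> "{u}" K] by auto
      then show False using v by (simp add: Y_def)
    qed
    moreover have "reach \<omega> {v} \<in> ?E" using v by (auto simp: Y_def big_def reach_in_clusters)
    ultimately show "rprob ?E (1 / q) (\<lambda>S. F \<subseteq> S \<and> {reach \<omega> {v}} \<inter> S = {}) = (1 / q) ^ card F * (1 - 1 / q)"
      using rprob_contains_avoids[of ?E F "{reach \<omega> {v}}" "1 / q"] F by simp
  qed
  also have "\<dots> = real (card Y) * ((1 / q) ^ card F * (1 - 1 / q))" by simp
  finally have markov: "real (card Y) * (a * rprob ?E (1 / q) bad) \<le>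
      real (card Y) * ((1 / q) ^ card F * (1 - 1 / q))" by (simp add: mult_ac)
  have "a * rprob ?E (1 / q) bad \<le> (1 / q) ^ card F * (1 - 1 / q)"
  proof (cases "card Y = 0")
    case True
    then have "Y = {}" using fY by simp
    then have "rprob ?E (1 / q) bad = 0" by (simp add: bad_def rexp_def)
    then show ?thesis using q by simp
  next
    case False
    then have "0 < real (card Y)" by simp
    then show ?thesis using markov by (rule mult_left_le_imp_le[rotated])
  qed
  moreover have "rprob ?E (1 / q) good + rprob ?E (1 / q) bad = (1 / q) ^ card F"
    unfolding rexp_add[symmetric] PF[symmetric] by (rule rexp_cong) (auto simp: good_def bad_def)
  ultimately have "a * ((1 / q) ^ card F - rprob ?E (1 / q) good) \<le> (1 / q) ^ card F * (1 - 1 / q)"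
    by (metis add_diff_cancel_left')
  then have "(1 / q) ^ card F * (a - (1 - 1 / q)) \<le> a * rprob ?E (1 / q) good"
    by (simp add: algebra_simps)
  also have "\<dots> \<le> 1 * rprob ?E (1 / q) good"
    using a rprob_nonneg[OF iq] by (intro mult_right_mono) auto
  also have "a - (1 - 1 / q) = 1 / (2 * q)" using q by (simp add: a_def field_simps)
  finally have "(1 / q) ^ card F * (1 / (2 * q)) \<le> rprob ?E (1 / q) good" by simp
  moreover have "(1 / q) ^ 2 * (1 / (2 * q)) \<le> (1 / q) ^ card F * (1 / (2 * q))"
    using F(2) q iq by (intro mult_right_mono power_decreasing) auto
  moreover have "1 / (2 * q ^ 3) = (1 / q) ^ 2 * (1 / (2 * q))"
    by (simp add: power_divide power3_eq_cube power2_eq_square)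
  moreover have "rprob ?E (1 / q) good \<le> rprob ?E (1 / q)
    (\<lambda>S. K \<subseteq> \<Union>S \<and> real (card (Y - \<Union>S)) \<le> a * real (card Y))"
    by (rule rprob_mono[OF iq]) (auto simp: good_def dest: KF)
  ultimately show ?thesis by (simp add: Y_def a_def)
qed

text \<open>The activation of \<open>rprob_shrinking_activation\<close> has probability at least
  \<open>1 / (2 * q ^ 3)\<close>; imbalance costs at most \<open>1 / (4 * q ^ 3)\<close>, and the
  fresh graph succeeds with probability at least \<open>1 / 2\<close>.\<close>

lemma enter_phase:
  assumes mode: "(k = 0 \<and> l = 0) \<or> (k = 1 \<and> l = \<theta> * real n)"
    and \<omega>: "\<omega> \<in> phase n M (2 * k) l (\<epsilon> * real n)" and \<beta>q: "\<beta> \<le> 1 / (4 * q ^ 3)"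
  shows "1 / (8 * q ^ 3) \<le> (\<Sum>\<omega>'\<in>phase n M k l ((\<epsilon> - 2 * \<eta>) * real n). cm_kernel n lam q \<omega> \<omega>')"
proof -
  obtain K where cfg: "\<omega> \<in> configs n" and K: "K \<subseteq> {..<n}" "card K \<le> 2 * k" "l \<le> real (card (reach \<omega> K))"
      "real (card (big_outside \<omega> K)) \<le> \<epsilon> * real n"
    using \<omega> by (auto simp: phase_def)
  have fK: "finite K" using K finite_subset by auto
  let ?Q = "phase n M k l ((\<epsilon> - 2 * \<eta>) * real n)"
  define act where "act = (\<lambda>S. K \<subseteq> \<Union>S \<and>
    real (card (big_outside \<omega> K - \<Union>S)) \<le> (1 - 1 / (2 * q)) * real (card (big_outside \<omega> K)))"
  have q3: "1 \<le> q ^ 3" using q by simp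
  have "1 / (4 * q ^ 3) \<le> 1 / 4" using q3 q by (intro divide_left_mono) auto
  then have \<beta>1: "\<beta> \<le> 1 / 4" using \<beta>q by linarith
  have shrink: "(1 - 1 / (2 * q)) * (\<epsilon> * real n) + \<eta> * real n \<le> (\<epsilon> - 2 * \<eta>) * real n"
  proof -
    \<comment> \<open>This is equivalent to \<open>6 * q * \<eta> \<le> \<epsilon>\<close> and is
      the origin of that assumption.\<close>
    have "(1 - 1 / (2 * q)) * \<epsilon> + \<eta> \<le> \<epsilon> - 2 * \<eta>" using \<eta> q by (simp add: field_simps)
    then have "((1 - 1 / (2 * q)) * \<epsilon> + \<eta>) * real n \<le> (\<epsilon> - 2 * \<eta>) * real n"
      by (intro mult_right_mono) auto
    then show ?thesis by (simp add: distrib_right mult.assoc)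
  qed
  have step: "(1 - \<beta>) * of_bool (act S \<and> \<not> unbalanced \<omega> K S) \<le>
      rprob (complete_edges (\<Union>S)) p (\<lambda>G. (\<omega> - complete_edges (\<Union>S)) \<union> G \<in> ?Q)"
    if S: "S \<subseteq> clusters n \<omega>" for S
  proof (cases "act S \<and> \<not> unbalanced \<omega> K S")
    case False
    then show ?thesis using rprob_nonneg[OF p] by auto
  next
    case True
    let ?r' = "real (card (big_outside \<omega> K - \<Union>S)) + \<eta> * real n"
    have "(1 - 1 / (2 * q)) * real (card (big_outside \<omega> K)) \<le> (1 - 1 / (2 * q)) * (\<epsilon> * real n)"
      using K q by (intro mult_left_mono) (auto simp: field_simps)
    then have le: "?r' \<le> (\<epsilon> - 2 * \<eta>) * real n" using True shrink unfolding act_def by linarith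
    have "rprob (complete_edges (\<Union>S)) p (\<lambda>G. (\<omega> - complete_edges (\<Union>S)) \<union> G \<notin> phase n M k l ?r') \<le> \<beta>"
    proof (cases "k = 0")
      case k0: True
      then have K0: "K = {}" using K fK by simp
      then show ?thesis
        using update_inactive[OF cfg S refl K(1) _ K(4), of k l] True K k0 by auto
    next
      case False
      then have "k = 1" "l = \<theta> * real n" using mode by auto
      then show ?thesis
        using update_active[OF cfg S refl K(1) _ K(4)] True K by (auto simp: act_def)
    qed
    moreover have "finite (complete_edges (\<Union>S))"
      by (intro finite_complete_edges, rule finite_subset[OF Union_clusters_subset[OF cfg S]]) simp
    moreover have "rprob (complete_edges (\<Union>S)) p (\<lambda>G. (\<omega> - complete_edges (\<Union>S)) \<union> G \<in> phase n M k l ?r') \<le>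
       rprob (complete_edges (\<Union>S)) p (\<lambda>G. (\<omega> - complete_edges (\<Union>S)) \<union> G \<in> ?Q)"
      using phase_mono[OF order_refl le, of n M k l] by (intro rprob_mono[OF p]) auto
    ultimately show ?thesis using True by (simp add: rprob_not)
  qed
  let ?E = "clusters n \<omega>"
  have "k \<le> 1" using mode by auto
  then have "1 / (2 * q ^ 3) \<le> rprob ?E (1 / q) act"
    unfolding act_def using rprob_shrinking_activation[OF cfg K(1)] K by auto
  also have "\<dots> \<le> rprob ?E (1 / q) (\<lambda>S. (act S \<and> \<not> unbalanced \<omega> K S) \<or> unbalanced \<omega> K S)"
    by (rule rprob_mono[OF iq]) auto
  also have "\<dots> \<le> rprob ?E (1 / q) (\<lambda>S. act S \<and> \<not> unbalanced \<omega> K S) + rprob ?E (1 / q) (unbalanced \<omega> K)"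
    by (rule rprob_or_le[OF iq])
  also have "rprob ?E (1 / q) (unbalanced \<omega> K) \<le> 1 / (4 * q ^ 3)"
    using rprob_unbalanced[OF cfg, of K] \<beta>q by linarith
  finally have "1 / (4 * q ^ 3) \<le> rprob ?E (1 / q) (\<lambda>S. act S \<and> \<not> unbalanced \<omega> K S)"
    by (simp add: field_simps)
  then have "(1 / 2) * (1 / (4 * q ^ 3)) \<le> (1 - \<beta>) * rprob ?E (1 / q) (\<lambda>S. act S \<and> \<not> unbalanced \<omega> K S)"
    using \<beta>1 q by (intro mult_mono) auto
  also have "\<dots> \<le> rexp ?E (1 / q) (\<lambda>S. rprob (complete_edges (\<Union>S)) p (\<lambda>G. (\<omega> - complete_edges (\<Union>S)) \<union> G \<in> ?Q))"
    unfolding rexp_cmult[symmetric] by (rule rexp_mono[OF iq]) (rule step)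
  also have "\<dots> = (\<Sum>\<omega>'\<in>?Q. cm_kernel n lam q \<omega> \<omega>')"
    by (rule cm_prob_eq[OF cfg phase_subset, symmetric])
  finally show ?thesis by simp
qed

end

section \<open>Slow mixing\<close>

text \<open>A vertex can become stray only if its old cluster had at most \<open>M\<close> vertices
  and contained an endpoint of the new edge. The two endpoints account for at most
  \<open>2 * M\<close> such vertices.\<close>

lemma phase_insert_edge:
  assumes \<omega>: "\<omega> \<in> phase n M k l r" and e: "{a, b} \<in> complete_edges {..<n}"
  shows "insert {a, b} \<omega> \<in> phase n M k l (r + 2 * real M)"
proof -
  let ?\<omega>' = "insert {a, b} \<omega>"
  obtain K where cfg: "\<omega> \<in> configs n" and K: "K \<subseteq> {..<n}" "card K \<le> k" "l \<le> real (card (reach \<omega> K))"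
      "real (card (big M {..<n} \<omega> - reach \<omega> K)) \<le> r"
    using \<omega> by (auto simp: phase_def)
  have cfg': "?\<omega>' \<in> configs n" using cfg e by (simp add: configs_eq)
  have rV: "reach w X \<subseteq> {..<n}" if "w \<in> configs n" "X \<subseteq> {..<n}" for w X
    using that by (intro reach_subset) (auto simp: configs_eq)
  have mono: "reach \<omega> X \<subseteq> reach ?\<omega>' X" for X by (intro reach_mono) auto
  have ab: "a < n" "b < n" using e by (auto simp: pair_in_complete_edges)
  define D where "D = (\<lambda>x. if card (reach \<omega> {x}) \<le> M then reach \<omega> {x} else {})"
  have D: "card (D x) \<le> M" "finite (D x)" if "x < n" for x
    using rV[OF cfg, of "{x}"] that finite_subset by (auto simp: D_def)
  have "big M {..<n} ?\<omega>' - reach ?\<omega>' K \<subseteq> (big M {..<n} \<omega> - reach \<omega> K) \<union> (D a \<union> D b)"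
  proof
    fix v assume v: "v \<in> big M {..<n} ?\<omega>' - reach ?\<omega>' K"
    show "v \<in> (big M {..<n} \<omega> - reach \<omega> K) \<union> (D a \<union> D b)"
    proof (cases "M < card (reach \<omega> {v})")
      case True
      then show ?thesis using v mono[of K] by (auto simp: big_def)
    next
      case False
      have "a \<in> reach \<omega> {v} \<or> b \<in> reach \<omega> {v}"
      proof (rule ccontr)
        assume no: "\<not> ?thesis"
        have "reach ?\<omega>' {v} \<subseteq> reach \<omega> {v}"
        proof (rule reach_least)
          fix x y assume "x \<in> reach \<omega> {v}" "{x, y} \<in> ?\<omega>'"
          then show "y \<in> reach \<omega> {v}"
            using no reach_closed[of x \<omega> "{v}" y] by (auto simp: doubleton_eq_iff)
        qed (rule reach_superset)
        moreover have "finite (reach \<omega> {v})" using rV[OF cfg, of "{v}"] v finite_subset by (auto simp: big_def)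
        ultimately have "card (reach ?\<omega>' {v}) \<le> card (reach \<omega> {v})" by (rule card_mono[rotated])
        then show False using v False by (auto simp: big_def)
      qed
      then obtain x where x: "x = a \<or> x = b" "x \<in> reach \<omega> {v}" by blast
      then have "reach \<omega> {x} = reach \<omega> {v}" using reach_single_eq by blast
      then have "v \<in> D x" using False reach_superset[of "{v}" \<omega>] by (auto simp: D_def)
      then show ?thesis using x by auto
    qed
  qed
  then have "card (big M {..<n} ?\<omega>' - reach ?\<omega>' K) \<le>
      card ((big M {..<n} \<omega> - reach \<omega> K) \<union> (D a \<union> D b))"
    using D ab by (intro card_mono) (auto simp: big_def)
  also have "\<dots> \<le> card (big M {..<n} \<omega> - reach \<omega> K) + (card (D a) + card (D b))"
    using card_Un_le[of "big M {..<n} \<omega> - reach \<omega> K" "D a \<union> D b"] card_Un_le[of "D a" "D b"]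
    by linarith
  finally have "real (card (big M {..<n} ?\<omega>' - reach ?\<omega>' K)) \<le> r + 2 * real M"
    using K D(1)[of a] D(1)[of b] ab by linarith
  moreover have "card (reach \<omega> K) \<le> card (reach ?\<omega>' K)"
    using mono finite_subset[OF rV[OF cfg' K(1)]] by (intro card_mono) auto
  ultimately show ?thesis
    unfolding phase_def using cfg' K by (intro CollectI conjI exI[of _ K]) auto
qed

text \<open>Deletion creates no big clusters but may cut the giant. If the edge lies in the giant,
  its two endpoints are seeds that still reach exactly the same vertices.\<close>

lemma phase_delete_edge:
  assumes \<omega>: "\<omega> \<in> phase n M k l r" and k: "k \<le> 1"
  shows "\<omega> - {e} \<in> phase n M (2 * k) l r"
proof -
  let ?\<omega>' = "\<omega> - {e}"
  obtain K where cfg: "\<omega> \<in> configs n" and K: "K \<subseteq> {..<n}" "card K \<le> k" "l \<le> real (card (reach \<omega> K))"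
      "real (card (big M {..<n} \<omega> - reach \<omega> K)) \<le> r"
    using \<omega> by (auto simp: phase_def)
  have fK: "finite K" using K finite_subset by auto
  have "\<exists>K'\<subseteq>{..<n}. card K' \<le> 2 * k \<and> reach ?\<omega>' K' = reach \<omega> K"
  proof (cases "e \<in> \<omega> \<and> K \<noteq> {}")
    case False
    then have "reach ?\<omega>' K = reach \<omega> K" by auto
    then show ?thesis using K by (intro exI[of _ K]) auto
  next
    case True
    then have "card K = 1" "k = 1" using k K(2) fK card_gt_0_iff[of K] by linarith+
    then obtain c where c: "K = {c}" using card_1_singletonE[of K] by blast
    have "e \<in> complete_edges {..<n}" using True cfg by (auto simp: configs_eq)
    then obtain a b where e: "e = {a, b}" "a < n" "b < n" by (auto simp: complete_edges_def)
    have sub: "reach ?\<omega>' X \<subseteq> reach \<omega> X" for X by (intro reach_mono) auto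
    show ?thesis
    proof (cases "a \<in> reach \<omega> {c}")
      case a: True
      then have b: "b \<in> reach \<omega> {c}" using True e reach_closed by blast
      have ab: "a \<in> reach ?\<omega>' {a, b}" "b \<in> reach ?\<omega>' {a, b}"
        using reach_superset[of "{a, b}" ?\<omega>'] by auto
      have "reach ?\<omega>' {a, b} = reach \<omega> {c}"
      proof
        have "reach ?\<omega>' {a, b} \<subseteq> reach \<omega> (reach \<omega> {c})"
          using a b by (intro reach_mono) auto
        then show "reach ?\<omega>' {a, b} \<subseteq> reach \<omega> {c}" by simp
        have "reach \<omega> {a} \<subseteq> reach ?\<omega>' {a, b}"
        proof (rule reach_least)
          fix x y assume x: "x \<in> reach ?\<omega>' {a, b}" and xy: "{x, y} \<in> \<omega>"
          show "y \<in> reach ?\<omega>' {a, b}"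
          proof (cases "{x, y} = e")
            case True
            then show ?thesis using ab e by (auto simp: doubleton_eq_iff)
          next
            case False
            then have "{x, y} \<in> ?\<omega>'" using xy by auto
            then show ?thesis using x reach_closed by blast
          qed
        qed (use ab in auto)
        then show "reach \<omega> {c} \<subseteq> reach ?\<omega>' {a, b}" using reach_single_eq[OF a] by simp
      qed
      moreover have "card {a, b} \<le> 2" by (simp add: card_insert_le_m1)
      ultimately show ?thesis
        using e c \<open>k = 1\<close> by (intro exI[of _ "{a, b}"]) auto
    next
      case a: False
      have "{b, a} \<in> \<omega>" using True e by (simp add: insert_commute)
      then have b: "b \<notin> reach \<omega> {c}" using a reach_closed by blast
      have "reach \<omega> {c} \<subseteq> reach ?\<omega>' {c}"
      proof (rule reach_least)
        fix x y assume x: "x \<in> reach ?\<omega>' {c}" and xy: "{x, y} \<in> \<omega>"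
        have "x \<in> reach \<omega> {c}" using x sub by auto
        then have "{x, y} \<noteq> e" using a b e by (auto simp: doubleton_eq_iff)
        then have "{x, y} \<in> ?\<omega>'" using xy by auto
        then show "y \<in> reach ?\<omega>' {c}" using x reach_closed by blast
      qed (rule reach_superset)
      then have "reach ?\<omega>' {c} = reach \<omega> {c}" using sub by blast
      then show ?thesis using K c \<open>k = 1\<close> by (intro exI[of _ "{c}"]) auto
    qed
  qed
  then obtain K' where K': "K' \<subseteq> {..<n}" "card K' \<le> 2 * k" "reach ?\<omega>' K' = reach \<omega> K" by blast
  have bigsub: "big M {..<n} ?\<omega>' \<subseteq> big M {..<n} \<omega>"
  proof
    fix v assume v: "v \<in> big M {..<n} ?\<omega>'"
    have "reach \<omega> {v} \<subseteq> {..<n}"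
      using cfg v by (intro reach_subset) (auto simp: configs_eq big_def)
    then have "card (reach ?\<omega>' {v}) \<le> card (reach \<omega> {v})"
      using finite_subset by (intro card_mono reach_mono) auto
    then show "v \<in> big M {..<n} \<omega>" using v by (auto simp: big_def)
  qed
  have "card (big M {..<n} ?\<omega>' - reach ?\<omega>' K') \<le> card (big M {..<n} \<omega> - reach \<omega> K)"
    unfolding K'(3) using bigsub by (intro card_mono) (auto simp: big_def)
  moreover have "?\<omega>' \<in> configs n" using cfg by (auto simp: configs_def)
  ultimately show ?thesis
    unfolding phase_def using K K' by (intro CollectI conjI exI[of _ K']) auto
qed

lemma empty_in_phase:
  assumes "0 < M" "0 \<le> r"
  shows "{} \<in> phase n M 0 0 r"
proof -
  have "reach {} {v} = {v}" for v
    using reach_least[of "{v}" "{v}" "{}"] reach_superset[of "{v}" "{}"] by auto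
  then have "big M {..<n} {} = {}" using assms by (auto simp: big_def)
  then show ?thesis using assms by (auto simp: phase_def configs_def)
qed

lemma complete_in_phase:
  assumes "0 < n" "0 \<le> r" "l \<le> real n"
  shows "complete_edges {..<n} \<in> phase n M 1 l r"
proof -
  let ?E = "complete_edges {..<n}"
  have "{..<n} \<subseteq> reach ?E {0}"
  proof
    fix v assume "v \<in> {..<n}"
    then show "v \<in> reach ?E {0}"
      using reach_superset[of "{0}" ?E] reach_closed[of 0 ?E "{0}" v] assms
      by (cases "v = 0") (auto simp: pair_in_complete_edges)
  qed
  then have "reach ?E {0} = {..<n}"
    using reach_subset[of ?E "{..<n}" "{0}"] assms by auto
  moreover from this have "card (big M {..<n} ?E - reach ?E {0}) = 0" by (auto simp: big_def)
  ultimately show ?thesis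
    unfolding phase_def using assms
    by (intro CollectI conjI exI[of _ "{0}"]) (simp_all add: configs_eq del: card_eq_0_iff)
qed

text \<open>A cluster of at least \<open>l > M\<close> vertices consists of vertices in big
  clusters; without a marked giant at most \<open>r < l\<close> of these are allowed.\<close>

lemma phases_disjoint:
  assumes "real M < l" "r < l"
  shows "phase n M 0 0 r \<inter> phase n M 1 l r' = {}"
proof (rule ccontr)
  assume "phase n M 0 0 r \<inter> phase n M 1 l r' \<noteq> {}"
  then obtain \<omega> K where \<omega>: "\<omega> \<in> phase n M 0 0 r" and cfg: "\<omega> \<in> configs n"
    and K: "K \<subseteq> {..<n}" "card K \<le> 1" "l \<le> real (card (reach \<omega> K))"
    by (auto simp: phase_def)
  have fK: "finite K" using K finite_subset by auto
  have "K \<noteq> {}" using K assms by auto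
  then have "card K = 1" using K fK card_gt_0_iff[of K] by linarith
  then obtain c where c: "K = {c}" by (rule card_1_singletonE)
  obtain K0 where K0: "K0 \<subseteq> {..<n}" "card K0 = 0" "real (card (big M {..<n} \<omega> - reach \<omega> K0)) \<le> r"
    using \<omega> by (auto simp: phase_def)
  then have "K0 = {}" using finite_subset by fastforce
  then have b: "real (card (big M {..<n} \<omega>)) \<le> r" using K0 by simp
  have "reach \<omega> {c} \<subseteq> big M {..<n} \<omega>"
    using K c cfg assms by (intro reach_subset_big) (auto simp: configs_eq big_def)
  then have "card (reach \<omega> {c}) \<le> card (big M {..<n} \<omega>)"
    by (intro card_mono) (auto simp: big_def)
  then show False using b K c assms by simp
qed

section \<open>Escape rates of the two dynamics\<close>

context update_estimates
begin

text \<open>Reversibility bounds the mass of the boundary layer by the flow back out of the inner layer,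
  so no equilibrium computation is needed.\<close>
lemma boundary_mass:
  assumes mode: "(k = 0 \<and> l = 0) \<or> (k = 1 \<and> l = \<theta> * real n \<and> 0 < l)" and \<beta>q: "\<beta> \<le> 1 / (4 * q ^ 3)"
  defines "T \<equiv> phase n M (2 * k) l (\<epsilon> * real n) - phase n M k l ((\<epsilon> - \<eta>) * real n)"
    and "A \<equiv> phase n M k l (\<epsilon> * real n)"
  shows "sum (fk_measure n lam q) T \<le> 16 * q ^ 3 * \<beta> * sum (fk_measure n lam q) A"
proof -
  interpret CM: reversible_chain "configs n" "cm_kernel n lam q" "fk_measure n lam q"
    using lam q by (rule cm_reversible)
  \<comment> \<open>From this level one step exceeds \<open>(\<epsilon> - \<eta>) * n\<close> with
    probability at most \<open>2 * \<beta>\<close>, and below that level it cannot be in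
    \<open>T\<close>.\<close>
  define I where "I = phase n M k l ((\<epsilon> - 2 * \<eta>) * real n)"
  have I: "I \<subseteq> configs n" "T \<subseteq> configs n" "A \<subseteq> configs n"
    unfolding I_def T_def A_def by (blast dest: subsetD[OF phase_subset])+
  have IA: "I \<subseteq> A"
    unfolding I_def A_def using \<eta> by (intro phase_mono mult_right_mono) auto
  have "1 / (8 * q ^ 3) * sum (fk_measure n lam q) T \<le> 2 * \<beta> * sum (fk_measure n lam q) I"
  proof (rule CM.mass_le_of_flow[OF I(2,1)])
    show "1 / (8 * q ^ 3) \<le> (\<Sum>y\<in>I. cm_kernel n lam q x y)" if "x \<in> T" for x
      unfolding I_def using that mode \<beta>q by (intro enter_phase) (auto simp: T_def)
    show "(\<Sum>y\<in>T. cm_kernel n lam q x y) \<le> 2 * \<beta>" if x: "x \<in> I" for x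
    proof -
      have eq: "(\<epsilon> - 2 * \<eta>) * real n + \<eta> * real n = (\<epsilon> - \<eta>) * real n" by (simp add: algebra_simps)
      have "(\<Sum>y\<in>T. cm_kernel n lam q x y) \<le>
          (\<Sum>y\<in>configs n - phase n M k l ((\<epsilon> - 2 * \<eta>) * real n + \<eta> * real n). cm_kernel n lam q x y)"
        unfolding eq using x I CM.P_nonneg by (intro sum_mono2) (auto simp: T_def)
      also have "\<dots> \<le> 2 * \<beta>"
        using x \<eta> by (intro leave_phase[OF mode]) (auto simp: I_def mult_right_mono)
      finally show ?thesis .
    qed
  qed
  also have "\<dots> \<le> 2 * \<beta> * sum (fk_measure n lam q) A"
    using \<beta> IA I finite_subset[OF I(3)]
    by (intro mult_left_mono sum_mono2 less_imp_le[OF CM.\<pi>_pos]) auto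
  finally show ?thesis using q by (simp add: field_simps)
qed

text \<open>\<open>A\<close> is covered by \<open>T\<close> and the inner set \<open>B\<close>. The
  layer \<open>T\<close> contributes at most its mass; from \<open>B\<close>, one step leaves
  \<open>A\<close> with probability at most \<open>2 * \<beta>\<close>.\<close>

lemma cm_escape:
  assumes mode: "(k = 0 \<and> l = 0) \<or> (k = 1 \<and> l = \<theta> * real n \<and> 0 < l)" and \<beta>q: "\<beta> \<le> 1 / (4 * q ^ 3)"
  defines "A \<equiv> phase n M k l (\<epsilon> * real n)"
  shows "reversible_chain.flow (cm_kernel n lam q) (fk_measure n lam q) A (configs n - A) \<le>
    32 * q ^ 3 * \<beta> * sum (fk_measure n lam q) A"
proof -
  interpret CM: reversible_chain "configs n" "cm_kernel n lam q" "fk_measure n lam q"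
    using lam q by (rule cm_reversible)
  define T where "T = phase n M (2 * k) l (\<epsilon> * real n) - phase n M k l ((\<epsilon> - \<eta>) * real n)"
  define B where "B = phase n M k l ((\<epsilon> - \<eta>) * real n)"
  have sub: "A \<subseteq> configs n" "T \<subseteq> configs n" "B \<subseteq> configs n"
    unfolding A_def T_def B_def by (blast dest: subsetD[OF phase_subset])+
  have BA: "B \<subseteq> A" unfolding B_def A_def using \<eta> by (intro phase_mono mult_right_mono) auto
  have "A \<subseteq> phase n M (2 * k) l (\<epsilon> * real n)" unfolding A_def by (rule phase_mono) auto
  then have "CM.flow A (configs n - A) \<le> CM.flow (T \<union> B) (configs n - A)"
    using sub by (intro CM.flow_mono) (auto simp: T_def B_def)
  also have "\<dots> \<le> CM.flow T (configs n - A) + CM.flow B (configs n - A)"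
    using sub by (intro CM.flow_Un_le) auto
  also have "CM.flow T (configs n - A) \<le> sum (fk_measure n lam q) T"
    using sub by (intro CM.flow_le_sum) auto
  also have "\<dots> \<le> 16 * q ^ 3 * \<beta> * sum (fk_measure n lam q) A"
    unfolding T_def A_def by (rule boundary_mass[OF mode \<beta>q])
  also have "CM.flow B (configs n - A) \<le> 2 * \<beta> * sum (fk_measure n lam q) B"
  proof (rule CM.flow_le_mass[OF sub(3)])
    fix x assume x: "x \<in> B"
    have eq: "(\<epsilon> - \<eta>) * real n + \<eta> * real n = \<epsilon> * real n" by (simp add: algebra_simps)
    have "(\<Sum>y\<in>configs n - phase n M k l ((\<epsilon> - \<eta>) * real n + \<eta> * real n). cm_kernel n lam q x y) \<le> 2 * \<beta>"
      using x \<eta> by (intro leave_phase[OF mode]) (auto simp: B_def mult_right_mono)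
    then show "(\<Sum>y\<in>configs n - A. cm_kernel n lam q x y) \<le> 2 * \<beta>" unfolding eq A_def .
  qed
  also have "\<dots> \<le> 2 * \<beta> * sum (fk_measure n lam q) A"
    using \<beta> BA sub finite_subset[OF sub(1)]
    by (intro mult_left_mono sum_mono2 less_imp_le[OF CM.\<pi>_pos]) auto
  also have "16 * q ^ 3 * \<beta> * sum (fk_measure n lam q) A + 2 * \<beta> * sum (fk_measure n lam q) A =
      (16 * q ^ 3 + 2) * (\<beta> * sum (fk_measure n lam q) A)" by (simp add: algebra_simps)
  also have "\<dots> \<le> (32 * q ^ 3) * (\<beta> * sum (fk_measure n lam q) A)"
  proof (rule mult_right_mono)
    have "1 \<le> q ^ 3" using q by simp
    then show "16 * q ^ 3 + 2 \<le> 32 * q ^ 3" by linarith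
    show "0 \<le> \<beta> * sum (fk_measure n lam q) A"
      using \<beta> sub by (intro mult_nonneg_nonneg sum_nonneg less_imp_le[OF CM.\<pi>_pos]) auto
  qed
  finally show ?thesis by (simp add: mult.assoc)
qed

text \<open>One edge change cannot jump from \<open>B\<close> over \<open>T\<close>: a deletion
  stays in the family with \<open>2 * k\<close> seeds, and an insertion adds at most
  \<open>2 * M \<le> \<eta> * n\<close> stray vertices, so it stays in \<open>A\<close>. The flow
  out of \<open>B\<close> therefore ends in \<open>T\<close> and, being symmetric, is at most the
  mass of \<open>T\<close>.\<close>

lemma glauber_escape:
  assumes mode: "(k = 0 \<and> l = 0) \<or> (k = 1 \<and> l = \<theta> * real n \<and> 0 < l)" and \<beta>q: "\<beta> \<le> 1 / (4 * q ^ 3)"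
    and n: "2 \<le> n" "2 * real M \<le> \<eta> * real n"
  defines "A \<equiv> phase n M k l (\<epsilon> * real n)"
  shows "reversible_chain.flow (glauber_kernel n lam q) (fk_measure n lam q) A (configs n - A) \<le>
    32 * q ^ 3 * \<beta> * sum (fk_measure n lam q) A"
proof -
  have q0: "0 < q" using q by simp
  interpret GL: reversible_chain "configs n" "glauber_kernel n lam q" "fk_measure n lam q"
    using lam q0 n(1) by (rule glauber_reversible)
  define T where "T = phase n M (2 * k) l (\<epsilon> * real n) - phase n M k l ((\<epsilon> - \<eta>) * real n)"
  define B where "B = phase n M k l ((\<epsilon> - \<eta>) * real n)"
  have sub: "A \<subseteq> configs n" "T \<subseteq> configs n" "B \<subseteq> configs n"
    unfolding A_def T_def B_def by (blast dest: subsetD[OF phase_subset])+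
  have BA: "B \<subseteq> A" unfolding B_def A_def using \<eta> by (intro phase_mono mult_right_mono) auto
  have k1: "k \<le> 1" using mode by auto
  have AT: "A - T \<subseteq> B"
    using phase_mono[of k "2 * k" "\<epsilon> * real n" "\<epsilon> * real n" n M l] by (auto simp: A_def T_def B_def)
  have zero: "glauber_kernel n lam q x y = 0" if x: "x \<in> B" and y: "y \<in> configs n - A - T" for x y
    unfolding glauber_kernel_def
  proof (rule sum.neutral, rule ballI)
    fix e assume e: "e \<in> edges_Kn n"
    have "y - {e} \<noteq> x - {e}"
    proof
      assume "y - {e} = x - {e}"
      then consider "y = x - {e}" | "y = insert e x" by blast
      then show False
      proof cases
        case 1
        have "x \<in> A" using x BA by auto
        then have "y \<in> phase n M (2 * k) l (\<epsilon> * real n)"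
          unfolding 1 A_def by (rule phase_delete_edge[OF _ k1])
        then show False using y BA unfolding T_def B_def by auto
      next
        case 2
        obtain a b where ab: "e = {a, b}" "{a, b} \<in> complete_edges {..<n}"
          using e by (auto simp: edges_Kn_eq complete_edges_def)
        have "y \<in> phase n M k l ((\<epsilon> - \<eta>) * real n + 2 * real M)"
          unfolding 2 ab(1) using x ab(2) unfolding B_def by (rule phase_insert_edge)
        moreover have "(\<epsilon> - \<eta>) * real n + 2 * real M \<le> \<epsilon> * real n"
          using n(2) by (simp add: algebra_simps)
        ultimately have "y \<in> A" unfolding A_def using phase_mono[OF order_refl] by blast
        then show False using y by simp
      qed
    qed
    then show "1 / real (card (edges_Kn n)) *
        (if y - {e} = x - {e} then fk_weight n lam q y /
          (fk_weight n lam q (x - {e}) + fk_weight n lam q (insert e x)) else 0) = 0" by simp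
  qed
  have "GL.flow A (configs n - A) \<le> GL.flow (T \<union> B) (configs n - A)"
    using AT sub by (intro GL.flow_mono) auto
  also have "\<dots> \<le> GL.flow T (configs n - A) + GL.flow B (configs n - A)"
    using sub by (intro GL.flow_Un_le) auto
  also have "GL.flow T (configs n - A) \<le> sum (fk_measure n lam q) T"
    using sub by (intro GL.flow_le_sum) auto
  also have "GL.flow B (configs n - A) = GL.flow B ((configs n - A) \<inter> T)"
    unfolding GL.flow_def
  proof (intro sum.cong[OF refl] sum.mono_neutral_right ballI)
    fix x y assume "x \<in> B" "y \<in> (configs n - A) - (configs n - A) \<inter> T"
    then have "glauber_kernel n lam q x y = 0" by (intro zero) auto
    then show "fk_measure n lam q x * glauber_kernel n lam q x y = 0" by simp
  qed auto
  also have "\<dots> \<le> GL.flow B T" using sub by (intro GL.flow_mono) auto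
  also have "\<dots> = GL.flow T B" using sub by (intro GL.flow_sym)
  also have "\<dots> \<le> sum (fk_measure n lam q) T" using sub by (intro GL.flow_le_sum)
  finally have "GL.flow A (configs n - A) \<le> 2 * sum (fk_measure n lam q) T" by simp
  also have "\<dots> \<le> 2 * (16 * q ^ 3 * \<beta> * sum (fk_measure n lam q) A)"
    unfolding T_def A_def by (intro mult_left_mono boundary_mass[OF mode \<beta>q]) auto
  finally show ?thesis by simp
qed

lemma mixing_times_ge:
  assumes "0 < \<beta>" "\<beta> \<le> 1 / (4 * q ^ 3)" "2 \<le> n" "2 * real M \<le> \<eta> * real n"
    and "0 < \<theta>" "\<theta> \<le> 1" "\<epsilon> < \<theta>" "real M < \<theta> * real n"
  shows "ereal (1 / (128 * q ^ 3 * \<beta>)) \<le>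
      mixing_time (configs n) (glauber_kernel n lam q) (fk_measure n lam q)"
    and "ereal (1 / (128 * q ^ 3 * \<beta>)) \<le>
      mixing_time (configs n) (cm_kernel n lam q) (fk_measure n lam q)"
proof -
  have q0: "0 < q" using q by simp
  interpret CM: reversible_chain "configs n" "cm_kernel n lam q" "fk_measure n lam q"
    using lam q by (rule cm_reversible)
  interpret GL: reversible_chain "configs n" "glauber_kernel n lam q" "fk_measure n lam q"
    using lam q0 assms(3) by (rule glauber_reversible)
  let ?\<pi> = "sum (fk_measure n lam q)"
  define D where "D = phase n M 0 0 (\<epsilon> * real n)"
  define Q where "Q = phase n M 1 (\<theta> * real n) (\<epsilon> * real n)"
  have DQ: "D \<subseteq> configs n" "Q \<subseteq> configs n" "D \<inter> Q = {}"
    using phase_subset phases_disjoint[of M "\<theta> * real n" "\<epsilon> * real n" n "\<epsilon> * real n"] assms n_pos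
    by (auto simp: D_def Q_def)
  have ne: "D \<noteq> {}" "Q \<noteq> {}"
    using empty_in_phase[OF M, of "\<epsilon> * real n" n]
      complete_in_phase[of n "\<epsilon> * real n" "\<theta> * real n" M] \<epsilon> assms
    by (auto simp: D_def Q_def mult_left_le_one_le)
  have "?\<pi> D + ?\<pi> Q = ?\<pi> (D \<union> Q)"
    using DQ CM.finite_subset_states by (intro sum.union_disjoint[symmetric]) auto
  also have "\<dots> \<le> ?\<pi> (configs n)"
    using DQ CM.\<pi>_pos by (intro sum_mono2) (auto intro: less_imp_le)
  finally have half: "?\<pi> D \<le> 1 / 2 \<or> ?\<pi> Q \<le> 1 / 2" using CM.\<pi>_sum by linarith
  have mD: "((0::nat) = 0 \<and> (0::real) = 0) \<or> ((0::nat) = 1 \<and> (0::real) = \<theta> * real n \<and> (0::real) < 0)"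
    by simp
  have mQ: "((1::nat) = 0 \<and> \<theta> * real n = 0) \<or> ((1::nat) = 1 \<and> \<theta> * real n = \<theta> * real n \<and> 0 < \<theta> * real n)"
    using assms n_pos by simp
  obtain A where A: "A \<subseteq> configs n" "A \<noteq> {}" "?\<pi> A \<le> 1 / 2"
    "CM.flow A (configs n - A) \<le> 32 * q ^ 3 * \<beta> * ?\<pi> A"
    "GL.flow A (configs n - A) \<le> 32 * q ^ 3 * \<beta> * ?\<pi> A"
  proof (cases "?\<pi> D \<le> 1 / 2")
    case True
    then show ?thesis
      using that[of D] DQ ne cm_escape[OF mD assms(2)] glauber_escape[OF mD assms(2,3,4)]
      by (simp add: D_def)
  next
    case False
    then show ?thesis
      using that[of Q] half DQ ne cm_escape[OF mQ assms(2)] glauber_escape[OF mQ assms(2,3,4)]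
      by (simp add: Q_def)
  qed
  have b: "0 < 32 * q ^ 3 * \<beta>" using q0 assms by simp
  have eq: "1 / (128 * q ^ 3 * \<beta>) = 1 / (4 * (32 * q ^ 3 * \<beta>))" by simp
  show "ereal (1 / (128 * q ^ 3 * \<beta>)) \<le>
      mixing_time (configs n) (glauber_kernel n lam q) (fk_measure n lam q)"
    unfolding eq by (rule GL.mixing_time_ge[OF A(1,2,3) b A(5)])
  show "ereal (1 / (128 * q ^ 3 * \<beta>)) \<le>
      mixing_time (configs n) (cm_kernel n lam q) (fk_measure n lam q)"
    unfolding eq by (rule CM.mixing_time_ge[OF A(1,2,3) b A(4)])
qed

end

text \<open>With \<open>z = lam * \<theta>\<close>, the inequality \<open>z + q * z / (exp z - 1) < lam\<close> says that an active giant
  of density \<open>\<theta>\<close> is replaced, on average, by a larger one.\<close>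
lemma ex_growing_density:
  assumes "1 < q" "lambda_s q < lam"
  shows "0 < lam" "\<exists>\<theta>>0. \<theta> < 1 \<and> \<theta> < (\<theta> + (1 - \<theta>) / q) * (1 - exp (- lam * \<theta>))"
proof -
  let ?h = "\<lambda>z::real. z + q * z / (exp z - 1)"
  have "\<exists>y\<in>?h ` {0<..}. y < lam"
  proof (rule cInf_lessD)
    show "?h ` {0<..} \<noteq> {}" by (auto intro: exI[of _ 1])
    show "Inf (?h ` {0<..}) < lam" using assms by (simp add: lambda_s_def)
  qed
  then obtain z where z: "0 < z" "z + q * z / (exp z - 1) < lam" by auto
  have ez: "0 < exp z - 1" using z by simp
  have "0 < q * z / (exp z - 1)" using z assms ez by simp
  then have zl: "z < lam" using z by linarith
  then show lam: "0 < lam" using z by simp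
  define \<theta> where "\<theta> = z / lam"
  have \<theta>: "0 < \<theta>" "\<theta> < 1" "lam * \<theta> = z" using z zl lam by (auto simp: \<theta>_def)
  have "z * (exp z - 1) + q * z < lam * (exp z - 1)"
    using z(2) ez by (simp add: field_simps)
  then have "\<theta> * (exp z - 1) + q * \<theta> < exp z - 1"
    using lam by (simp add: \<theta>_def field_simps)
  \<comment> \<open>Multiplication by \<open>exp (- z)\<close> turns \<open>exp z - 1\<close> into
    \<open>1 - exp (- z)\<close>, the limiting chance that a giant of density
    \<open>\<theta>\<close> hits a given vertex.\<close>
  then have "0 < ((exp z - 1) * (1 - \<theta>) - q * \<theta>) * exp (- z)"
    by (intro mult_pos_pos) (auto simp: algebra_simps)
  also have "\<dots> = q * ((\<theta> + (1 - \<theta>) / q) * (1 - exp (- z)) - \<theta>)"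
    using assms(1) by (simp add: field_simps exp_minus)
  finally have "\<theta> < (\<theta> + (1 - \<theta>) / q) * (1 - exp (- lam * \<theta>))"
    using \<theta> assms(1) by (simp add: zero_less_mult_iff)
  then show "\<exists>\<theta>>0. \<theta> < 1 \<and> \<theta> < (\<theta> + (1 - \<theta>) / q) * (1 - exp (- lam * \<theta>))" using \<theta> by blast
qed

section \<open>Choice of the parameters and conclusion\<close>

theorem theorem2:
  fixes q lam :: real
  assumes "q > 2" and "lambda_s q < lam" and "lam < lambda_S q"
  shows "(\<exists>c>0. \<exists>N0. \<forall>n\<ge>N0.
            ereal (exp (c * real n)) \<le>
              mixing_time (configs n) (glauber_kernel n lam q) (fk_measure n lam q))
       \<and> (\<exists>c>0. \<exists>N0. \<forall>n\<ge>N0.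
            ereal (exp (c * real n)) \<le>
              mixing_time (configs n) (cm_kernel n lam q) (fk_measure n lam q))"
proof -
  have q: "1 < q" and lq: "lam < q" using assms by (auto simp: lambda_S_def)
  note lam = ex_growing_density(1)[OF q assms(2)]
  obtain \<theta> where \<theta>: "0 < \<theta>" "\<theta> < 1" "\<theta> < (\<theta> + (1 - \<theta>) / q) * (1 - exp (- lam * \<theta>))"
    using ex_growing_density(2)[OF q assms(2)] by auto
  \<comment> \<open>The surplus density of the new giant after an activation of one of density
    \<open>\<theta>\<close>, before errors.\<close>
  define g where "g = (\<theta> + (1 - \<theta>) / q) * (1 - exp (- lam * \<theta>)) - \<theta>"
  \<comment> \<open>The entry \<open>g / 4\<close> keeps \<open>\<mu>\<close> supercritical,
    \<open>\<theta> / 2\<close> separates the two phases, and the last entry keeps an activation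
    without giant subcritical.\<close>
  define \<epsilon> where "\<epsilon> = min (g / 4) (min (\<theta> / 2) ((1 / lam - 1 / q) / 4))"
  have "1 / q < 1 / lam" using lam lq by (intro divide_strict_left_mono) auto
  then have \<epsilon>: "0 < \<epsilon>" using \<theta> by (simp add: \<epsilon>_def g_def)
  have \<epsilon>': "\<epsilon> \<le> g / 4" "\<epsilon> \<le> \<theta> / 2" "\<epsilon> \<le> (1 / lam - 1 / q) / 4"
    unfolding \<epsilon>_def by linarith+
  define \<eta> where "\<eta> = \<epsilon> / (6 * q)"
  have \<eta>: "0 < \<eta>" "6 * q * \<eta> \<le> \<epsilon>" using \<epsilon> q by (auto simp: \<eta>_def)
  have "6 * \<eta> \<le> 6 * q * \<eta>" using \<eta> q by simp
  then have \<eta>\<theta>: "2 * \<eta> \<le> \<theta>" using \<eta> \<epsilon>' \<theta> by linarith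
  define \<mu> where "\<mu> = \<theta> + (1 - \<theta>) / q - 2 * \<epsilon>"
  have e1: "0 < 1 - exp (- lam * \<theta>)" "1 - exp (- lam * \<theta>) \<le> 1" using lam \<theta> by auto
  have \<mu>g: "\<theta> < \<mu> * (1 - exp (- lam * \<theta>))"
  proof -
    have "2 * \<epsilon> * (1 - exp (- lam * \<theta>)) \<le> 2 * \<epsilon> * 1" using e1 \<epsilon> by (intro mult_left_mono) auto
    moreover have "\<mu> * (1 - exp (- lam * \<theta>)) = g + \<theta> - 2 * \<epsilon> * (1 - exp (- lam * \<theta>))"
      by (simp add: \<mu>_def g_def algebra_simps)
    ultimately show ?thesis using \<epsilon> \<epsilon>' by linarith
  qed
  then have "0 < \<mu> * (1 - exp (- lam * \<theta>))" using \<theta> by linarith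
  then have \<mu>: "0 < \<mu>" using e1(1) by (simp only: zero_less_mult_iff) linarith
  \<comment> \<open>Half of the gap between \<open>lam / q\<close> and 1; the other half is used up
    by the error \<open>2 * \<epsilon>\<close> in the active density.\<close>
  define \<gamma> where "\<gamma> = (1 - lam / q) / 2"
  have \<gamma>: "0 < \<gamma>" using lq q by (simp add: \<gamma>_def)
  have \<gamma>': "lam * (1 / q + 2 * \<epsilon>) \<le> 1 - \<gamma>"
  proof -
    have "lam * (1 / q + 2 * \<epsilon>) \<le> lam * (1 / q + (1 / lam - 1 / q) / 2)"
      using \<epsilon>' lam by (intro mult_left_mono) auto
    also have "\<dots> = 1 - \<gamma>" using lam q by (simp add: \<gamma>_def field_simps)
    finally show ?thesis .
  qed
  obtain M1 where M1: "\<And>M. M \<ge> M1 \<Longrightarrow> \<exists>c>0. \<exists>N. \<forall>n\<ge>N. \<forall>V. finite V \<and> card V \<le> n \<and>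
      lam * real (card V) \<le> (1 - \<gamma>) * real n \<longrightarrow>
      rprob (complete_edges V) (lam / real n) (\<lambda>G. \<eta> * real n \<le> real (card (big M V G)))
        \<le> exp (- c * real n)"
    using subcritical_whp[OF lam \<gamma> \<eta>(1)] by auto
  obtain M2 where M2: "\<And>M. M \<ge> M2 \<Longrightarrow> \<exists>c>0. \<exists>N. \<forall>n\<ge>N. \<forall>V. finite V \<and> card V \<le> n \<and>
      \<mu> * real n \<le> real (card V) \<longrightarrow>
      rprob (complete_edges V) (lam / real n)
        (\<lambda>G. \<not> (\<exists>c\<in>V. \<theta> * real n \<le> real (card (reach G {c})) \<and>
            real (card (big M V G - reach G {c})) < \<eta> * real n))
      \<le> exp (- c * real n)"
    using supercritical_whp[OF lam \<theta>(1) \<mu> \<eta>(1) \<eta>\<theta> \<mu>g] by auto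
  \<comment> \<open>\<open>M\<close> is fixed here once and for all; the rates \<open>c1\<close>,
    \<open>c2\<close> and \<open>a\<close> below may depend on it.\<close>
  define M where "M = max 1 (max M1 M2)"
  have M: "0 < M" "M1 \<le> M" "M2 \<le> M" by (auto simp: M_def)
  obtain c1 N1 where c1: "0 < c1" and sub: "\<And>n V. n \<ge> N1 \<Longrightarrow> finite V \<Longrightarrow> card V \<le> n \<Longrightarrow>
      lam * real (card V) \<le> (1 - \<gamma>) * real n \<Longrightarrow>
      rprob (complete_edges V) (lam / real n) (\<lambda>G. \<eta> * real n \<le> real (card (big M V G)))
        \<le> exp (- c1 * real n)"
    using M1[OF M(2)] by blast
  obtain c2 N2 where c2: "0 < c2" and sup: "\<And>n V. n \<ge> N2 \<Longrightarrow> finite V \<Longrightarrow> card V \<le> n \<Longrightarrow>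
      \<mu> * real n \<le> real (card V) \<Longrightarrow>
      rprob (complete_edges V) (lam / real n)
        (\<lambda>G. \<not> (\<exists>c\<in>V. \<theta> * real n \<le> real (card (reach G {c})) \<and>
            real (card (big M V G - reach G {c})) < \<eta> * real n))
      \<le> exp (- c2 * real n)"
    using M2[OF M(3)] by blast
  define a where "a = 2 * \<epsilon>\<^sup>2 / real M"
  have a: "0 < a" using \<epsilon> M by (simp add: a_def)
  obtain N3 where N3: "\<And>n. n \<ge> N3 \<Longrightarrow> 2 * (real n + 1) * exp (- a * real n) \<le> exp (- (a / 2) * real n)"
    using eventually_poly_exp_le[OF a, of 2] by blast
  \<comment> \<open>The common rate of the three error events: a subcritical failure, a
    supercritical failure and an unbalanced activation. The last has given up half its rate for the
    factor 2.\<close>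
  define c where "c = min c1 (min c2 (a / 2))"
  have c: "0 < c" "c \<le> c1" "c \<le> c2" "c \<le> a / 2" using c1 c2 a by (auto simp: c_def)
  obtain N4 where N4: "\<And>n. n \<ge> N4 \<Longrightarrow> 128 * q ^ 3 * (real n + 1) * exp (- c * real n) \<le> exp (- (c / 2) * real n)"
    using eventually_poly_exp_le[OF c(1), of "128 * q ^ 3"] by blast
  \<comment> \<open>A sum, so that every single threshold is at most \<open>n\<close>. The two
    increments by 1 after a ceiling make \<open>lam < n\<close> and \<open>M / \<theta> < n\<close>
    strict.\<close>
  define N0 where "N0 = N1 + N2 + N3 + N4 + 2 + (nat \<lceil>lam\<rceil> + 1) +
    nat \<lceil>2 * real M / \<eta>\<rceil> + (nat \<lceil>real M / \<theta>\<rceil> + 1)"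
  have main: "ereal (exp (c / 2 * real n)) \<le>
        mixing_time (configs n) (glauber_kernel n lam q) (fk_measure n lam q) \<and>
      ereal (exp (c / 2 * real n)) \<le>
        mixing_time (configs n) (cm_kernel n lam q) (fk_measure n lam q)" if "N0 \<le> n" for n
  proof -
    have n: "N1 \<le> n" "N2 \<le> n" "N3 \<le> n" "N4 \<le> n" "2 \<le> n" "nat \<lceil>lam\<rceil> + 1 \<le> n"
      "nat \<lceil>2 * real M / \<eta>\<rceil> \<le> n" "nat \<lceil>real M / \<theta>\<rceil> + 1 \<le> n"
      using that unfolding N0_def by linarith+
    have r: "lam < real n" "2 * real M / \<eta> \<le> real n" "real M / \<theta> < real n" using n by linarith+
    define \<beta> where "\<beta> = exp (- c * real n)"
    have le\<beta>: "exp (- c' * real n) \<le> \<beta>" if "c \<le> c'" for c'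
      using that by (simp add: \<beta>_def mult_right_mono)
    \<comment> \<open>Half of the rate absorbs the constant \<open>128 * q ^ 3\<close>; hence the
      final exponent \<open>c / 2\<close>.\<close>
    have \<beta>_small: "128 * q ^ 3 * \<beta> \<le> exp (- (c / 2) * real n)"
    proof -
      have "128 * q ^ 3 * \<beta> \<le> 128 * q ^ 3 * (real n + 1) * \<beta>"
        using q by (intro mult_right_mono) (auto simp: \<beta>_def)
      then show ?thesis using N4[OF n(4)] by (simp add: \<beta>_def)
    qed
    also have "\<dots> \<le> 1" using c by simp
    finally have \<beta>q: "\<beta> \<le> 1 / (4 * q ^ 3)" using q by (simp add: field_simps)
    interpret update_estimates n M lam q \<epsilon> \<eta> \<theta> \<mu> \<beta>
    proof
      show "2 * exp (- 2 * \<epsilon>\<^sup>2 * real n / real M) \<le> \<beta>"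
      proof -
        have "2 * exp (- a * real n) \<le> 2 * (real n + 1) * exp (- a * real n)"
          by (intro mult_right_mono) auto
        also have "\<dots> \<le> exp (- (a / 2) * real n)" by (rule N3[OF n(3)])
        also have "\<dots> \<le> \<beta>" by (rule le\<beta>[OF c(4)])
        finally show ?thesis by (simp add: a_def)
      qed
      fix V :: "nat set" assume V: "V \<subseteq> {..<n}"
      have fV: "finite V" by (rule finite_subset[OF V]) simp
      have cV: "card V \<le> n" using card_mono[OF _ V] by simp
      show "rprob (complete_edges V) (lam / real n) (\<lambda>G. \<eta> * real n \<le> real (card (big M V G))) \<le> \<beta>"
        if "real (card V) \<le> (1 / q + 2 * \<epsilon>) * real n"
      proof -
        have "lam * real (card V) \<le> lam * (1 / q + 2 * \<epsilon>) * real n"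
          using that lam by (simp add: mult.assoc)
        also have "\<dots> \<le> (1 - \<gamma>) * real n" using \<gamma>' by (rule mult_right_mono) simp
        finally show ?thesis using sub[OF n(1) fV cV] le\<beta>[OF c(2)] by linarith
      qed
      show "rprob (complete_edges V) (lam / real n)
        (\<lambda>G. \<not> (\<exists>c\<in>V. \<theta> * real n \<le> real (card (reach G {c})) \<and>
            real (card (big M V G - reach G {c})) < \<eta> * real n)) \<le> \<beta>"
        if "\<mu> * real n \<le> real (card V)"
        using sup[OF n(2) fV cV that] le\<beta>[OF c(3)] by linarith
    qed (use lam r q M \<epsilon> \<eta> in \<open>auto simp: \<mu>_def \<beta>_def\<close>)
    have conds: "0 < \<beta>" "2 * real M \<le> \<eta> * real n" "\<theta> \<le> 1" "\<epsilon> < \<theta>" "real M < \<theta> * real n"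
      using r \<eta> \<theta> \<epsilon>' by (auto simp: \<beta>_def field_simps)
    have "exp (c / 2 * real n) = 1 / exp (- (c / 2) * real n)" by (simp add: exp_minus field_simps)
    also have "\<dots> \<le> 1 / (128 * q ^ 3 * \<beta>)"
      using \<beta>_small q by (intro divide_left_mono) (auto simp: \<beta>_def)
    finally have "ereal (exp (c / 2 * real n)) \<le> ereal (1 / (128 * q ^ 3 * \<beta>))" by simp
    then show ?thesis
      using mixing_times_ge[OF conds(1) \<beta>q n(5) conds(2) \<theta>(1) conds(3,4,5)] order_trans by blast
  qed
  then show ?thesis using c by (intro conjI exI[of _ "c / 2"] exI[of _ N0]) auto
qed

end
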